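(* Let $U$ be a Lie group and $G\le U$ a compact subgroup. There is an open neighborhood $V$ of $G$ in $U$ and a map $$\{\text{compact subgroups } K\le U \text{ contained in } V\}\ni K\longmapsto u_K\in U,$$ continuous at the point $G$ with respect to the weak 0-topology $\mathcal T_{0,w}$ on its domain, such that - $u_G=1$; and - the conjugate $u_K\cdot K\cdot u_K^{-1}$ is contained in $G$ for every $K$ in the domain.
   Context: "Lie group" means analytic real Banach Lie group (possibly infinite-dimensional, modeled on a Banach space). Weak 0-topology: for a collection $\mathcal S$ of subgroups of a topological group $U$, the topology $\mathcal T_{0,w}$ on $\mathcal S$ has as a basis the sets $\{H\in\mathcal S \mid H\subset W\}$, where $W$ ranges over the open subsets of $U$. *)

theory Defs
  imports "HOL-Analysis.Analysis" "HOL-Algebra.Group"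
begin

section \<open>Analytic maps between Banach spaces\<close>

text \<open>
  An \<open>n\<close>-linear map is represented as a function on lists, of which only the values on lists of
  length \<open>n\<close> are relevant; \<open>c\<close> is a bound for its norm.
\<close>

definition multilinear_bound ::
    "nat \<Rightarrow> real \<Rightarrow> ('e::real_normed_vector list \<Rightarrow> 'f::real_normed_vector) \<Rightarrow> bool" where
  "multilinear_bound n c L \<longleftrightarrow>
     (\<forall>xs ys. Suc (length xs + length ys) = n \<longrightarrow> linear (\<lambda>x. L (xs @ x # ys))) \<and>
     0 \<le> c \<and> (\<forall>xs. length xs = n \<longrightarrow> norm (L xs) \<le> c * prod_list (map norm xs))"

text \<open>
  Near \<open>x\<close> the map is the sum of a convergent power series \<open>\<Sum>n. L\<^sub>n(h, \<dots>, h)\<close>, with \<open>L\<^sub>n\<close> continuous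
  \<open>n\<close>-linear and \<open>\<Sum>n. \<parallel>L\<^sub>n\<parallel> r\<^sup>n < \<infinity>\<close> for some \<open>r > 0\<close>.  Symmetry of the \<open>L\<^sub>n\<close> may be omitted, since
  symmetrisation changes neither the diagonal values nor the bounds.  Only the germ of the map at
  \<open>x\<close> matters.
\<close>

definition real_analytic_at ::
    "('e::real_normed_vector \<Rightarrow> 'f::real_normed_vector) \<Rightarrow> 'e \<Rightarrow> bool" where
  "real_analytic_at f x \<longleftrightarrow>
     (\<exists>L c r. (\<forall>n. multilinear_bound n (c n) (L n)) \<and> 0 < r \<and> summable (\<lambda>n. c n * r ^ n) \<and>
        (\<forall>h. norm h < r \<longrightarrow> (\<lambda>n. L n (replicate n h)) sums f (x + h)))"

section \<open>Analytic Banach manifolds\<close>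

text \<open>
  A chart is a pair of its domain and its coordinate map, which is irrelevant outside the domain.
  The analytic structure is given by an atlas, not necessarily a maximal one.
\<close>

type_synonym ('a, 'e) chart = "'a set \<times> ('a \<Rightarrow> 'e)"

locale analytic_manifold =
  fixes T :: "'a topology" and A :: "('a, 'e::banach) chart set"
  assumes Hausdorff: "Hausdorff_space T"
    and chart_open: "(D, \<phi>) \<in> A \<Longrightarrow> openin T D"
    and chart_open_image: "(D, \<phi>) \<in> A \<Longrightarrow> open (\<phi> ` D)"
    and chart_homeo:
      "(D, \<phi>) \<in> A \<Longrightarrow> homeomorphic_map (subtopology T D) (top_of_set (\<phi> ` D)) \<phi>"
    and charts_cover: "(\<Union>(D, \<phi>)\<in>A. D) = topspace T"
    and chart_change:
      "\<lbrakk>(D, \<phi>) \<in> A; (E, \<psi>) \<in> A; x \<in> D \<inter> E\<rbrakk> \<Longrightarrow> real_analytic_at (\<psi> \<circ> inv_into D \<phi>) (\<phi> x)"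

definition analytic_map ::
    "'a topology \<Rightarrow> ('a, 'e::real_normed_vector) chart set \<Rightarrow>
     'b topology \<Rightarrow> ('b, 'f::real_normed_vector) chart set \<Rightarrow> ('a \<Rightarrow> 'b) \<Rightarrow> bool" where
  "analytic_map T A S B f \<longleftrightarrow>
     continuous_map T S f \<and>
     (\<forall>(D, \<phi>)\<in>A. \<forall>(E, \<psi>)\<in>B. \<forall>x\<in>D. f x \<in> E \<longrightarrow>
        real_analytic_at (\<psi> \<circ> f \<circ> inv_into D \<phi>) (\<phi> x))"

definition prod_atlas ::
    "('a, 'e) chart set \<Rightarrow> ('b, 'f) chart set \<Rightarrow> ('a \<times> 'b, 'e \<times> 'f) chart set" where
  "prod_atlas A B = (\<lambda>((D, \<phi>), (E, \<psi>)). (D \<times> E, map_prod \<phi> \<psi>)) ` (A \<times> B)"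

section \<open>Banach Lie groups\<close>

locale banach_lie_group = group U + analytic_manifold T A
  for U :: "('a, 'm) monoid_scheme" (structure)
    and T :: "'a topology" and A :: "('a, 'e::banach) chart set" +
  assumes topspace_eq_carrier: "topspace T = carrier U"
    and mult_analytic:
      "analytic_map (prod_topology T T) (prod_atlas A A) T A (\<lambda>(x, y). x \<otimes> y)"
    and inv_analytic: "analytic_map T A T A (\<lambda>x. inv x)"

section \<open>The weak 0-topology\<close>

definition weak_0_topology :: "'a topology \<Rightarrow> 'a set set \<Rightarrow> 'a set topology" where
  "weak_0_topology T \<S> =
     topology (arbitrary union_of (\<lambda>\<B>. \<exists>W. openin T W \<and> \<B> = {H \<in> \<S>. H \<subseteq> W}))"

lemma openin_weak_0_topology:
  "openin (weak_0_topology T \<S>) =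
     arbitrary union_of (\<lambda>\<B>. \<exists>W. openin T W \<and> \<B> = {H \<in> \<S>. H \<subseteq> W})"
  unfolding weak_0_topology_def
proof (rule topology_inverse', rule istopology_base)
  fix \<B> \<C>
  assume "\<exists>W. openin T W \<and> \<B> = {H \<in> \<S>. H \<subseteq> W}" "\<exists>W. openin T W \<and> \<C> = {H \<in> \<S>. H \<subseteq> W}"
  then obtain V W where "openin T V" "\<B> = {H \<in> \<S>. H \<subseteq> V}" "openin T W" "\<C> = {H \<in> \<S>. H \<subseteq> W}"
    by blast
  then show "\<exists>W. openin T W \<and> \<B> \<inter> \<C> = {H \<in> \<S>. H \<subseteq> W}"
    by (intro exI[of _ "V \<inter> W"]) auto
qed

lemma topspace_weak_0_topology:
  assumes "\<And>H. H \<in> \<S> \<Longrightarrow> H \<subseteq> topspace T"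
  shows "topspace (weak_0_topology T \<S>) = \<S>"
proof
  show "topspace (weak_0_topology T \<S>) \<subseteq> \<S>"
    unfolding topspace_def openin_weak_0_topology by (auto simp: union_of_def)
  have "openin (weak_0_topology T \<S>) {H \<in> \<S>. H \<subseteq> topspace T}"
    unfolding openin_weak_0_topology by (rule arbitrary_union_of_inc) blast
  then have "{H \<in> \<S>. H \<subseteq> topspace T} \<subseteq> topspace (weak_0_topology T \<S>)"
    by (rule openin_subset)
  with assms show "\<S> \<subseteq> topspace (weak_0_topology T \<S>)"
    by blast
qed

definition compact_subgroups_in ::
    "('a, 'm) monoid_scheme \<Rightarrow> 'a topology \<Rightarrow> 'a set \<Rightarrow> 'a set set" where
  "compact_subgroups_in U T V = {K. subgroup K U \<and> compactin T K \<and> K \<subseteq> V}"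

end

theory Submission
  imports Defs
begin

text \<open>
Conjugating a compact subgroup \<open>K\<close> into \<open>G\<close> amounts to finding a fixed point of \<open>K\<close> in the
  homogeneous space of cosets of \<open>G\<close>, near the base point.  If \<open>K\<close> lies in a thin tube around \<open>G\<close>,
  then the orbit of the base point is small, and on a small scale the action is affine up to a
  relatively small error.  The barycentre of the orbit is therefore moved much less than the base
  point was.  This is a Newton step: conjugating by the barycentre halves the width of the tube that
  contains \<open>K\<close>, at the cost of a conjugator no larger than that width
  (\<open>halve_defect\<close>).  The product of the successive conjugators converges, and its limit carries \<open>K\<close>
  into \<open>G\<close> (\<open>conjugate_into_G_of_near_G\<close>).

  Written out, every \<open>k \<in> K\<close> is a product \<open>v\<^sub>k g\<^sub>k\<close> of a small element and an element of
  \<open>G\<close>.  With \<open>x\<^sub>k\<close> the coordinate of \<open>v\<^sub>k\<close> in a chart \<open>\<phi>\<close> centred at the identity, multiplicativity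
  of \<open>K\<close> says that \<open>x\<close> is a cocycle up to small errors:
  \<open>x\<^sub>k\<^sub>h \<approx> x\<^sub>k + L\<^sub>k x\<^sub>h\<close> modulo the tangent space of \<open>G\<close>, where \<open>L\<^sub>k\<close> is the derivative of conjugation
  by \<open>g\<^sub>k\<close> (\<open>normal_size_cocycle\<close>).  Averaging over \<open>h\<close> exhibits \<open>x\<close> as a coboundary,
  \<open>x\<^sub>k \<approx> m - L\<^sub>k m\<close> with \<open>m\<close> the mean of \<open>x\<close>, and the element with coordinate \<open>m\<close> is the
  conjugator.  The mean is a finite one.  If a function on a group is nearly invariant under
  left translation by a set \<open>V\<close>, and finitely many right translates of \<open>V\<close> cover the group, then
  repeated averaging over the inverse centres of these translates makes the function nearly constant
  (\<open>almost_invariant_mean\<close>).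

  To work modulo the tangent space of \<open>G\<close>, one needs that \<open>G\<close> is tangent to it uniformly near the
  identity.  One half (\<open>tangent_approximates_subgroup\<close>) follows by taking powers.  The other
  (\<open>subgroup_approximated_by_tangent\<close>) is the content of the theorem that closed subgroups are Lie
  subgroups.  In an infinite-dimensional space the directions of elements of \<open>G\<close> tending
  to the identity need a reason to accumulate, and that reason is the compactness of \<open>G\<close>: a power of such an
  element of \<open>G\<close> has the same direction but a fixed size (\<open>directions_accumulate\<close>).

  All estimates rest on two properties of the group law in the chart: strict differentiability
  at the identity, which makes \<open>\<phi> (u v) - \<phi> u - \<phi> v\<close> small relative to either factor, and the
  differentiability of conjugations.

  Finally, \<open>u\<^sub>K\<close> is chosen among all conjugators of \<open>K\<close> into \<open>G\<close> with norm at most twice the infimum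
  of their norms, and \<open>u\<^sub>K = \<one>\<close> if \<open>K \<subseteq> G\<close>; the infimum tends to \<open>0\<close> as \<open>K\<close> approaches \<open>G\<close>.
\<close>

section \<open>Power series are strictly differentiable\<close>

text \<open>The arguments \<open>h\<close> are exchanged for \<open>h'\<close> one at a time; linearity in the slot concerned turns each
  exchange into a factor \<open>h - h'\<close>.\<close>

lemma multilinear_bound_power_diff:
  fixes L :: "'e::real_normed_vector list \<Rightarrow> 'f::real_normed_vector"
  assumes L: "multilinear_bound n c L" and h: "norm h \<le> \<rho>" and h': "norm h' \<le> \<rho>"
  shows "norm (L (replicate n h) - L (replicate n h')) \<le> real n * c * \<rho> ^ (n - 1) * norm (h - h')"
proof -
  define t where "t i = L (replicate i h' @ replicate (n - i) h)" for i
  have c: "0 \<le> c" and Lb: "\<And>xs. length xs = n \<Longrightarrow> norm (L xs) \<le> c * prod_list (map norm xs)"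
    using L by (auto simp: multilinear_bound_def)
  have \<rho>: "0 \<le> \<rho>" using h norm_ge_zero order_trans by blast
  have step: "norm (t i - t (Suc i)) \<le> c * \<rho> ^ (n - 1) * norm (h - h')" if "i < n" for i
  proof -
    let ?l = "\<lambda>x. L (replicate i h' @ x # replicate (n - Suc i) h)"
    have lin: "linear ?l"
      using L that by (auto simp: multilinear_bound_def)
    have ni: "n - i = Suc (n - Suc i)" using that by simp
    have "t i = ?l h" by (simp add: t_def ni)
    moreover have "t (Suc i) = ?l h'"
      by (simp add: t_def replicate_app_Cons_same)
    ultimately have "t i - t (Suc i) = ?l (h - h')"
      by (simp add: linear_diff[OF lin])
    also have "norm \<dots> \<le> c * (norm h' ^ i * (norm (h - h') * norm h ^ (n - Suc i)))"
      using Lb[of "replicate i h' @ (h - h') # replicate (n - Suc i) h"] that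
      by (simp add: prod_list_replicate)
    also have "\<dots> \<le> c * (\<rho> ^ i * (norm (h - h') * \<rho> ^ (n - Suc i)))"
      by (intro mult_left_mono mult_mono power_mono h h' c) (use \<rho> in auto)
    also have "\<dots> = c * \<rho> ^ (i + (n - Suc i)) * norm (h - h')"
      by (simp add: power_add)
    also have "i + (n - Suc i) = n - 1" using that by simp
    finally show ?thesis .
  qed
  have "L (replicate n h) - L (replicate n h') = t 0 - t n" by (simp add: t_def)
  also have "\<dots> = (\<Sum>i<n. t i - t (Suc i))" by (rule sum_lessThan_telescope'[symmetric])
  also have "norm \<dots> \<le> (\<Sum>i<n. c * \<rho> ^ (n - 1) * norm (h - h'))"
    by (rule sum_norm_le) (use step in auto)
  finally show ?thesis by simp
qed

text \<open>The term of degree \<open>n\<close> changes by at most \<open>n c\<^sub>n \<rho>\<^sup>n\<^sup>-\<^sup>1 \<parallel>h - h'\<parallel>\<close> on the ball of radius \<open>\<rho>\<close>.  For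
  \<open>\<rho> \<le> r/2\<close> the factor \<open>n\<close> is absorbed by a power of \<open>2\<close>, so that the terms with \<open>n \<ge> 2\<close> together contribute
  at most a constant times \<open>\<rho> \<parallel>h - h'\<parallel>\<close>.\<close>

lemma real_analytic_at_imp_strict_derivative:
  fixes f :: "'e::real_normed_vector \<Rightarrow> 'f::banach"
  assumes "real_analytic_at f x"
  obtains f' where "bounded_linear f'"
    and "\<And>\<eta>. 0 < \<eta> \<Longrightarrow> \<exists>r>0. \<forall>h h'. norm h < r \<longrightarrow> norm h' < r \<longrightarrow>
           norm (f (x + h) - f (x + h') - f' (h - h')) \<le> \<eta> * norm (h - h')"
proof -
  obtain L c r where L: "\<And>n. multilinear_bound n (c n) (L n)" and r: "0 < r"
    and sm: "summable (\<lambda>n. c n * r ^ n)"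
    and f: "\<And>h. norm h < r \<Longrightarrow> (\<lambda>n. L n (replicate n h)) sums f (x + h)"
    using assms unfolding real_analytic_at_def by blast
  define f' where "f' v = L 1 [v]" for v
  have c: "0 \<le> c n" for n using L[of n] by (auto simp: multilinear_bound_def)
  have lin: "linear f'"
  proof -
    have "\<forall>xs ys. Suc (length xs + length ys) = 1 \<longrightarrow> linear (\<lambda>v. L 1 (xs @ v # ys))"
      using L[of 1] by (simp add: multilinear_bound_def)
    from this[rule_format, of "[]" "[]"] show ?thesis by (simp add: f'_def[abs_def])
  qed
  have "norm (f' v) \<le> norm v * c 1" for v
  proof -
    have "norm (L 1 xs) \<le> c 1 * prod_list (map norm xs)" if "length xs = 1" for xs
      using L[of 1] that by (simp add: multilinear_bound_def)
    from this[of "[v]"] show ?thesis by (simp add: f'_def mult.commute)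
  qed
  with lin have bl: "bounded_linear f'"
    by (intro bounded_linear.intro bounded_linear_axioms.intro) auto
  define S where "S = (\<Sum>n. c (n + 2) * r ^ (n + 2))"
  have smS: "summable (\<lambda>n. c (n + 2) * r ^ (n + 2))"
    using summable_ignore_initial_segment[OF sm, of 2] .
  have S: "0 \<le> S" unfolding S_def
    by (rule suminf_nonneg[OF smS]) (use c r in auto)
  have key: "norm (f (x + h) - f (x + h') - f' (h - h')) \<le> \<rho> * (4 / r\<^sup>2) * S * norm (h - h')"
    if \<rho>: "norm h \<le> \<rho>" "norm h' \<le> \<rho>" "\<rho> \<le> r / 2" for h h' \<rho>
  proof -
    define a where "a n = L n (replicate n h) - L n (replicate n h')" for n
    have \<rho>0: "0 \<le> \<rho>" using \<rho> norm_ge_zero order_trans by blast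
    have "a sums (f (x + h) - f (x + h'))"
      unfolding a_def by (intro sums_diff f) (use \<rho> r in auto)
    then have "(\<lambda>n. a (n + 2)) sums (f (x + h) - f (x + h') - (\<Sum>i<2. a i))"
      by (rule sums_split_initial_segment)
    moreover have "(\<Sum>i<2. a i) = f' (h - h')"
      using linear_diff[OF lin, of h h'] by (simp add: a_def f'_def numeral_2_eq_2)
    ultimately have sums: "(\<lambda>n. a (n + 2)) sums (f (x + h) - f (x + h') - f' (h - h'))"
      by simp
    have bound: "norm (a (n + 2)) \<le> \<rho> * (4 / r\<^sup>2) * norm (h - h') * (c (n + 2) * r ^ (n + 2))" for n
    proof -
      have "norm (a (n + 2)) \<le> real (n + 2) * c (n + 2) * \<rho> ^ (n + 1) * norm (h - h')"
        unfolding a_def using multilinear_bound_power_diff[OF L \<rho>(1,2), of "n + 2"] by simp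
      also have "\<dots> = real (n + 2) * \<rho> ^ n * (c (n + 2) * \<rho> * norm (h - h'))"
        by simp
      also have "\<dots> \<le> 4 * r ^ n * (c (n + 2) * \<rho> * norm (h - h'))"
      proof (rule mult_right_mono)
        have "n + 2 \<le> 4 * 2 ^ n" by (induction n) auto
        then have "real (n + 2) \<le> 4 * 2 ^ n"
          by (metis (no_types, lifting) of_nat_le_iff of_nat_mult of_nat_numeral of_nat_power)
        moreover have "\<rho> ^ n \<le> (r / 2) ^ n" by (intro power_mono \<rho>0 \<rho>)
        ultimately have "real (n + 2) * \<rho> ^ n \<le> (4 * 2 ^ n) * (r / 2) ^ n"
          by (intro mult_mono) (use \<rho>0 in auto)
        also have "\<dots> = 4 * r ^ n" by (simp add: power_divide)
        finally show "real (n + 2) * \<rho> ^ n \<le> 4 * r ^ n" .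
      qed (use c \<rho>0 in auto)
      also have "\<dots> = \<rho> * (4 / r\<^sup>2) * norm (h - h') * (c (n + 2) * r ^ (n + 2))"
        using r by (simp add: power_add power2_eq_square)
      finally show ?thesis .
    qed
    have sms: "(\<lambda>n. \<rho> * (4 / r\<^sup>2) * norm (h - h') * (c (n + 2) * r ^ (n + 2))) sums
        (\<rho> * (4 / r\<^sup>2) * norm (h - h') * S)"
      unfolding S_def by (intro sums_mult summable_sums smS)
    have "norm (\<Sum>n. a (n + 2)) \<le> (\<Sum>n. \<rho> * (4 / r\<^sup>2) * norm (h - h') * (c (n + 2) * r ^ (n + 2)))"
      by (rule norm_suminf_le[OF bound sums_summable[OF sms]])
    then show ?thesis
      using sums_unique[OF sums] sums_unique[OF sms] by (simp add: mult_ac)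
  qed
  have "\<exists>r'>0. \<forall>h h'. norm h < r' \<longrightarrow> norm h' < r' \<longrightarrow>
           norm (f (x + h) - f (x + h') - f' (h - h')) \<le> \<eta> * norm (h - h')" if \<eta>: "0 < \<eta>" for \<eta>
  proof -
    define r' where "r' = min (r / 2) (\<eta> / (4 / r\<^sup>2 * (S + 1)))"
    have r': "0 < r'" "r' \<le> r / 2"
      using r S \<eta> by (simp_all add: r'_def del: divide_le_eq_numeral1 le_divide_eq_numeral1)
    have "r' * (4 / r\<^sup>2) * S \<le> \<eta>"
    proof -
      have "r' * (4 / r\<^sup>2) * S \<le> r' * (4 / r\<^sup>2 * (S + 1))"
        unfolding mult.assoc using r r' by (intro mult_left_mono) auto
      also have "\<dots> \<le> \<eta>"
        using S r by (subst pos_le_divide_eq[symmetric]) (auto simp: r'_def)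
      finally show ?thesis .
    qed
    then have "norm (f (x + h) - f (x + h') - f' (h - h')) \<le> \<eta> * norm (h - h')"
      if "norm h < r'" "norm h' < r'" for h h'
      using key[of h r' h'] that r' by (meson less_imp_le mult_right_mono norm_ge_zero order_trans)
    with r' show ?thesis by blast
  qed
  with bl show thesis by (rule that)
qed

lemma real_analytic_at_imp_has_derivative:
  fixes f :: "'e::real_normed_vector \<Rightarrow> 'f::banach"
  assumes "real_analytic_at f x"
  obtains f' where "(f has_derivative f') (at x)"
proof -
  obtain f' where bl: "bounded_linear f'"
    and f': "\<And>\<eta>. 0 < \<eta> \<Longrightarrow> \<exists>r>0. \<forall>h h'. norm h < r \<longrightarrow> norm h' < r \<longrightarrow>
           norm (f (x + h) - f (x + h') - f' (h - h')) \<le> \<eta> * norm (h - h')"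
    using real_analytic_at_imp_strict_derivative[OF assms] by blast
  have "(f has_derivative f') (at x)"
    unfolding has_derivative_at_alt
  proof (intro conjI bl allI impI)
    fix \<eta> :: real assume "0 < \<eta>"
    from f'[OF this] obtain r where r: "0 < r" and
      *: "\<And>h h'. norm h < r \<Longrightarrow> norm h' < r \<Longrightarrow>
           norm (f (x + h) - f (x + h') - f' (h - h')) \<le> \<eta> * norm (h - h')" by blast
    have "norm (f y - f x - f' (y - x)) \<le> \<eta> * norm (y - x)" if "norm (y - x) < r" for y
      using *[of "y - x" 0] that r by simp
    with r show "\<exists>d>0. \<forall>y. norm (y - x) < d \<longrightarrow> norm (f y - f x - f' (y - x)) \<le> \<eta> * norm (y - x)"
      by blast
  qed
  then show thesis by (rule that)
qed

section \<open>Almost invariant means on a group\<close>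

locale seminorm =
  fixes p :: "'v::real_vector \<Rightarrow> real"
  assumes triangle: "p (x + y) \<le> p x + p y"
    and scale: "p (c *\<^sub>R x) = \<bar>c\<bar> * p x"
begin

lemma zero [simp]: "p 0 = 0"
  using scale[of 0 0] by simp

lemma uminus: "p (- x) = p x"
  using scale[of "- 1" x] by simp

lemma triangle_le: "p x \<le> a \<Longrightarrow> p y \<le> b \<Longrightarrow> p (x + y) \<le> a + b"
  using triangle[of x y] by linarith

lemma triangle_le_diff: "p x \<le> a \<Longrightarrow> p y \<le> b \<Longrightarrow> p (x - y) \<le> a + b"
  using triangle_le[of x a "- y" b] by (simp add: uminus)

lemma sum_le: "(\<And>i. i \<in> I \<Longrightarrow> p (f i) \<le> a) \<Longrightarrow> p (sum f I) \<le> real (card I) * a"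
proof (induction I rule: infinite_finite_induct)
  case (insert i I)
  then have "p (f i + sum f I) \<le> a + real (card I) * a"
    by (intro triangle_le) auto
  with insert.hyps show ?case by (simp add: algebra_simps)
qed auto

lemma average_le:
  assumes "finite I" "I \<noteq> {}" "\<And>i. i \<in> I \<Longrightarrow> p (f i) \<le> a"
  shows "p ((1 / real (card I)) *\<^sub>R sum f I) \<le> a"
proof -
  have n: "0 < real (card I)" using assms by (simp add: card_gt_0_iff)
  have "p ((1 / real (card I)) *\<^sub>R sum f I) \<le> 1 / real (card I) * (real (card I) * a)"
    unfolding scale using mult_left_mono[OF sum_le[of I f a, OF assms(3)], of "1 / real (card I)"] n
    by simp
  with n show ?thesis by simp
qed

end

lemma seminorm_norm: "seminorm (norm :: 'v::real_normed_vector \<Rightarrow> real)"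
  by unfold_locales (auto simp: norm_triangle_ineq)

lemma infdist_approx:
  assumes "S \<noteq> {}" "0 < e" obtains y where "y \<in> S" "dist x y < infdist x S + e"
proof -
  have "Inf (dist x ` S) < infdist x S + e" using assms by (simp add: infdist_def)
  then show thesis using cInf_lessD[of "dist x ` S"] assms(1) that by blast
qed

lemma seminorm_infdist_subspace:
  fixes S :: "'v::real_normed_vector set"
  assumes S: "subspace S" shows "seminorm (\<lambda>x. infdist x S)"
proof
  have ne: "S \<noteq> {}" using subspace_0[OF S] by blast
  show "infdist (x + y) S \<le> infdist x S + infdist y S" for x y
  proof (rule field_le_epsilon)
    fix e :: real assume "0 < e"
    then have "0 < e / 2" by simp
    obtain a where a: "a \<in> S" "dist x a < infdist x S + e / 2" by (rule infdist_approx[OF ne \<open>0 < e / 2\<close>])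
    obtain b where b: "b \<in> S" "dist y b < infdist y S + e / 2" by (rule infdist_approx[OF ne \<open>0 < e / 2\<close>])
    have "infdist (x + y) S \<le> dist (x + y) (a + b)" by (rule infdist_le) (use subspace_add[OF S] a b in blast)
    also have "\<dots> \<le> dist x a + dist y b" by (rule dist_triangle_add)
    finally show "infdist (x + y) S \<le> infdist x S + infdist y S + e" using a b by linarith
  qed
  have le: "infdist (c *\<^sub>R x) S \<le> \<bar>c\<bar> * infdist x S" for c x
  proof (cases "c = 0")
    case True
    then show ?thesis using subspace_0[OF S] by simp
  next
    case False
    show ?thesis
    proof (rule field_le_epsilon)
      fix e :: real assume "0 < e"
      then have "0 < e / \<bar>c\<bar>" using False by simp
      then obtain a where a: "a \<in> S" "dist x a < infdist x S + e / \<bar>c\<bar>" by (rule infdist_approx[OF ne])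
      have "infdist (c *\<^sub>R x) S \<le> dist (c *\<^sub>R x) (c *\<^sub>R a)"
        by (rule infdist_le) (use subspace_scale[OF S] a in blast)
      also have "\<dots> = \<bar>c\<bar> * dist x a" by (simp add: dist_norm flip: scaleR_diff_right)
      also have "\<dots> \<le> \<bar>c\<bar> * (infdist x S + e / \<bar>c\<bar>)" by (rule mult_left_mono) (use a in auto)
      finally show "infdist (c *\<^sub>R x) S \<le> \<bar>c\<bar> * infdist x S + e" using False by (simp add: algebra_simps)
    qed
  qed
  show "infdist (c *\<^sub>R x) S = \<bar>c\<bar> * infdist x S" for c x
  proof (cases "c = 0")
    case True
    then show ?thesis using subspace_0[OF S] by simp
  next
    case False
    then have "infdist x S \<le> \<bar>inverse c\<bar> * infdist (c *\<^sub>R x) S"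
      using le[of "inverse c" "c *\<^sub>R x"] by simp
    then show ?thesis using le[of c x] False by (simp add: field_simps)
  qed
qed

context group
begin

lemma inv_mult_cancel: "x \<in> carrier G \<Longrightarrow> y \<in> carrier G \<Longrightarrow> inv x \<otimes> (x \<otimes> y) = y"
  by (simp add: m_assoc[symmetric])

lemma mult_inv_cancel: "x \<in> carrier G \<Longrightarrow> y \<in> carrier G \<Longrightarrow> x \<otimes> (inv x \<otimes> y) = y"
  by (simp add: m_assoc[symmetric])

lemmas group_normalize = m_assoc inv_mult_group inv_mult_cancel mult_inv_cancel

text \<open>Right translations are used because they commute with left translations, so that averaging
  preserves near-invariance of \<open>F\<close> under left translations.\<close>

definition right_average :: "'a set \<Rightarrow> ('a \<Rightarrow> 'v::real_vector) \<Rightarrow> 'a \<Rightarrow> 'v" where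
  "right_average C F x = (1 / real (card C)) *\<^sub>R (\<Sum>c\<in>C. F (x \<otimes> inv c))"

text \<open>Choose \<open>i\<close>, \<open>j\<close> with \<open>x i\<^sup>-\<^sup>1\<close> and \<open>y j\<^sup>-\<^sup>1\<close> in \<open>V\<close>.  The values of \<open>F\<close> at these two points are both
  within \<open>\<epsilon>\<close> of \<open>F \<one>\<close>.  The other terms of the two sums are paired by an arbitrary bijection, and each
  pair differs by at most the old oscillation.  So one term in \<open>card C\<close> loses the excess \<open>d\<close>.\<close>

lemma right_average_contracts:
  assumes p: "seminorm p" and K: "subgroup K G" and C: "finite C" "C \<subseteq> K"
    and cover: "\<And>x. x \<in> K \<Longrightarrow> \<exists>c\<in>C. x \<otimes> inv c \<in> V"
    and near: "\<And>v x. v \<in> V \<inter> K \<Longrightarrow> x \<in> K \<Longrightarrow> p (F (v \<otimes> x) - F x) \<le> \<epsilon>"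
    and osc: "\<And>x y. x \<in> K \<Longrightarrow> y \<in> K \<Longrightarrow> p (F x - F y) \<le> 2 * \<epsilon> + d"
    and xy: "x \<in> K" "y \<in> K"
  shows "p (right_average C F x - right_average C F y) \<le> 2 * \<epsilon> + (1 - 1 / real (card C)) * d"
proof -
  interpret seminorm p by (rule p)
  have KG: "\<And>k. k \<in> K \<Longrightarrow> k \<in> carrier G" using subgroup.subset[OF K] by blast
  have Kc: "a \<otimes> inv c \<in> K" if "a \<in> K" "c \<in> C" for a c
    using that C subgroup.m_closed[OF K] subgroup.m_inv_closed[OF K] by blast
  have at_one: "p (F v - F \<one>) \<le> \<epsilon>" if "v \<in> V \<inter> K" for v
    using near[OF that subgroup.one_closed[OF K]] that KG by simp
  obtain i where i: "i \<in> C" "x \<otimes> inv i \<in> V" using cover[OF xy(1)] by blast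
  obtain j where j: "j \<in> C" "y \<otimes> inv j \<in> V" using cover[OF xy(2)] by blast
  have "card (C - {i}) = card (C - {j})" using C i j by simp
  then obtain f where f: "bij_betw f (C - {i}) (C - {j})"
    using finite_same_card_bij[of "C - {i}" "C - {j}"] C(1) by blast
  have fC: "f c \<in> C" if "c \<in> C - {i}" for c using bij_betw_apply[OF f that] by blast
  let ?X = "\<lambda>c. F (x \<otimes> inv c)" and ?Y = "\<lambda>c. F (y \<otimes> inv c)"
  have "p ((?X i - F \<one>) - (?Y j - F \<one>)) \<le> \<epsilon> + \<epsilon>"
    by (intro triangle_le_diff at_one IntI i j Kc xy)
  then have 1: "p (?X i - ?Y j) \<le> 2 * \<epsilon>" by simp
  have "p (\<Sum>c\<in>C - {i}. ?X c - ?Y (f c)) \<le> real (card (C - {i})) * (2 * \<epsilon> + d)"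
    by (rule sum_le) (use osc Kc xy fC in auto)
  also have "real (card (C - {i})) = real (card C) - 1"
  proof -
    have "0 < card C" using C(1) i(1) by (auto simp: card_gt_0_iff)
    then show ?thesis using C(1) i(1) by simp
  qed
  finally have 2: "p (\<Sum>c\<in>C - {i}. ?X c - ?Y (f c)) \<le> (real (card C) - 1) * (2 * \<epsilon> + d)" .
  have n: "0 < real (card C)" using C(1) i(1) by (auto simp: card_gt_0_iff)
  have "(\<Sum>c\<in>C. ?X c) - (\<Sum>c\<in>C. ?Y c) = (?X i + (\<Sum>c\<in>C - {i}. ?X c)) - (?Y j + (\<Sum>c\<in>C - {j}. ?Y c))"
    using sum.remove[OF C(1) i(1), of ?X] sum.remove[OF C(1) j(1), of ?Y] by simp
  also have "(\<Sum>c\<in>C - {j}. ?Y c) = (\<Sum>c\<in>C - {i}. ?Y (f c))"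
    by (rule sum.reindex_bij_betw[OF f, symmetric])
  finally have "(\<Sum>c\<in>C. ?X c) - (\<Sum>c\<in>C. ?Y c) = (?X i - ?Y j) + (\<Sum>c\<in>C - {i}. ?X c - ?Y (f c))"
    by (simp add: sum_subtractf)
  then have le: "p ((\<Sum>c\<in>C. ?X c) - (\<Sum>c\<in>C. ?Y c)) \<le> 2 * \<epsilon> + (real (card C) - 1) * (2 * \<epsilon> + d)"
    using triangle_le[OF 1 2] by simp
  have "p (right_average C F x - right_average C F y) =
      1 / real (card C) * p ((\<Sum>c\<in>C. ?X c) - (\<Sum>c\<in>C. ?Y c))"
    using n by (simp add: right_average_def scale flip: scaleR_diff_right)
  also have "\<dots> \<le> 1 / real (card C) * (2 * \<epsilon> + (real (card C) - 1) * (2 * \<epsilon> + d))"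
    by (rule mult_left_mono[OF le]) simp
  also have "\<dots> = 2 * \<epsilon> + (1 - 1 / real (card C)) * d"
    using n by (simp add: field_simps)
  finally show ?thesis .
qed

text \<open>The set \<open>C\<close> and hence the contraction factor stay the same in every iteration, as near-invariance under
  left translation by \<open>V\<close> is inherited by averages.  The predicate \<open>Q\<close> transports to the final
  function whatever is preserved by averaging.\<close>

lemma almost_invariant_mean:
  assumes p: "seminorm p" and K: "subgroup K G" and C: "finite C" "C \<subseteq> K"
    and cover: "\<And>x. x \<in> K \<Longrightarrow> \<exists>c\<in>C. x \<otimes> inv c \<in> V"
    and near: "\<And>v x. v \<in> V \<inter> K \<Longrightarrow> x \<in> K \<Longrightarrow> p (F (v \<otimes> x) - F x) \<le> \<epsilon>"
    and osc: "\<And>x y. x \<in> K \<Longrightarrow> y \<in> K \<Longrightarrow> p (F x - F y) \<le> d"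
    and \<epsilon>: "0 < \<epsilon>"
    and Q: "Q F" "\<And>F. Q F \<Longrightarrow> Q (right_average C F)"
  obtains F' where "Q F'" "\<And>x y. x \<in> K \<Longrightarrow> y \<in> K \<Longrightarrow> p (F' x - F' y) \<le> 3 * \<epsilon>"
proof -
  interpret seminorm p by (rule p)
  have KG: "\<And>k. k \<in> K \<Longrightarrow> k \<in> carrier G" using subgroup.subset[OF K] by blast
  have Kc: "a \<otimes> inv c \<in> K" if "a \<in> K" "c \<in> C" for a c
    using that C subgroup.m_closed[OF K] subgroup.m_inv_closed[OF K] by blast
  define q where "q = 1 - 1 / real (card C)"
  have Cne: "C \<noteq> {}" using cover[OF subgroup.one_closed[OF K]] by blast
  then have n: "1 \<le> real (card C)" using C(1) by (simp add: Suc_le_eq card_gt_0_iff)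
  have q: "0 \<le> q" "q < 1" using n by (simp_all add: q_def field_simps)
  let ?F = "\<lambda>m. ((right_average C) ^^ m) F"
  have F: "Q (?F m) \<and> (\<forall>v\<in>V \<inter> K. \<forall>x\<in>K. p (?F m (v \<otimes> x) - ?F m x) \<le> \<epsilon>) \<and>
      (\<forall>x\<in>K. \<forall>y\<in>K. p (?F m x - ?F m y) \<le> 2 * \<epsilon> + q ^ m * d)" for m
  proof (induction m)
    case 0
    have "p (F x - F y) \<le> 2 * \<epsilon> + d" if "x \<in> K" "y \<in> K" for x y
      using osc[OF that] \<epsilon> by linarith
    then show ?case using Q near by simp
  next
    case (Suc m)
    then have IH: "Q (?F m)" "\<And>v x. v \<in> V \<inter> K \<Longrightarrow> x \<in> K \<Longrightarrow> p (?F m (v \<otimes> x) - ?F m x) \<le> \<epsilon>"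
      "\<And>x y. x \<in> K \<Longrightarrow> y \<in> K \<Longrightarrow> p (?F m x - ?F m y) \<le> 2 * \<epsilon> + q ^ m * d" by blast+
    have "p (?F (Suc m) (v \<otimes> x) - ?F (Suc m) x) \<le> \<epsilon>" if vx: "v \<in> V \<inter> K" "x \<in> K" for v x
    proof -
      have "?F (Suc m) (v \<otimes> x) - ?F (Suc m) x =
          (1 / real (card C)) *\<^sub>R (\<Sum>c\<in>C. ?F m (v \<otimes> x \<otimes> inv c) - ?F m (x \<otimes> inv c))"
        by (simp add: right_average_def sum_subtractf flip: scaleR_diff_right)
      also have "p \<dots> \<le> \<epsilon>"
      proof (rule average_le[OF C(1) Cne])
        fix c assume c: "c \<in> C"
        then have "c \<in> carrier G" "v \<in> carrier G" "x \<in> carrier G" using C vx KG by auto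
        then show "p (?F m (v \<otimes> x \<otimes> inv c) - ?F m (x \<otimes> inv c)) \<le> \<epsilon>"
          using IH(2)[OF vx(1) Kc[OF vx(2) c]] by (simp add: m_assoc)
      qed
      finally show ?thesis .
    qed
    moreover have "p (?F (Suc m) x - ?F (Suc m) y) \<le> 2 * \<epsilon> + q ^ Suc m * d" if "x \<in> K" "y \<in> K" for x y
      using right_average_contracts[OF p K C cover IH(2,3) that] by (simp add: q_def)
    moreover have "Q (?F (Suc m))" using Q(2)[OF IH(1)] by simp
    ultimately show ?case by blast
  qed
  have "(\<lambda>m. q ^ m * d) \<longlonglongrightarrow> 0 * d"
    by (intro tendsto_mult_right LIMSEQ_power_zero) (use q in simp)
  then have "eventually (\<lambda>m. q ^ m * d < \<epsilon>) sequentially"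
    using order_tendstoD(2)[of _ 0 sequentially \<epsilon>] \<epsilon> by simp
  then obtain m where m: "q ^ m * d < \<epsilon>"
    using eventually_happens'[OF sequentially_bot] by blast
  show thesis
  proof (rule that[of "?F m"])
    show "Q (?F m)" using F[of m] by blast
    show "p (?F m x - ?F m y) \<le> 3 * \<epsilon>" if "x \<in> K" "y \<in> K" for x y
    proof -
      have "p (?F m x - ?F m y) \<le> 2 * \<epsilon> + q ^ m * d" using F[of m] that by blast
      with m show ?thesis by linarith
    qed
  qed
qed

end


section \<open>Topological groups with a strictly differentiable chart at the identity\<close>

text \<open>Passage to a finite subcover, for properties of sets that are inherited by subsets and
  finite unions; it yields radii and constants that are uniform over a compact set.\<close>

lemma compactin_induct_open_cover:
  assumes G: "compactin T G"
    and empty: "Q {}" and un: "\<And>S S'. Q S \<Longrightarrow> Q S' \<Longrightarrow> Q (S \<union> S')"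
    and mono: "\<And>S S'. S \<subseteq> S' \<Longrightarrow> Q S' \<Longrightarrow> Q S"
    and loc: "\<And>g. g \<in> G \<Longrightarrow> \<exists>W. openin T W \<and> g \<in> W \<and> Q W"
  shows "Q G"
proof -
  obtain \<F> where \<F>: "finite \<F>" "\<F> \<subseteq> {W. openin T W \<and> Q W}" "G \<subseteq> \<Union>\<F>"
  proof -
    have "G \<subseteq> \<Union>{W. openin T W \<and> Q W}" using loc by blast
    then show thesis using compactinD[OF G, of "{W. openin T W \<and> Q W}"] that by auto
  qed
  from \<F>(1,2) have "Q (\<Union>\<F>)"
    by (induction rule: finite_induct) (auto intro: empty un)
  with \<F>(3) show ?thesis by (rule mono)
qed

text \<open>The part of a Lie group structure that the argument uses: a chart \<open>\<phi>\<close> that sends the identity to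
  \<open>0\<close>, in which the product is the sum up to an error that is small relative to each of the two
  factors, and in which conjugations are differentiable at the identity.\<close>

locale strictly_charted_group = group U for U :: "('a, 'm) monoid_scheme" (structure) +
  fixes T :: "'a topology" and D :: "'a set" and \<phi> :: "'a \<Rightarrow> 'e::banach"
  assumes topspace_carrier: "topspace T = carrier U"
    and Hausdorff: "Hausdorff_space T"
    and mult_continuous: "continuous_map (prod_topology T T) T (\<lambda>(x, y). x \<otimes> y)"
    and inv_continuous: "continuous_map T T (\<lambda>x. inv x)"
    and D_open: "openin T D" and one_D: "\<one> \<in> D" and chart_one: "\<phi> \<one> = 0"
    and chart_continuous: "continuous_map (subtopology T D) euclidean \<phi>"
    and chart_nhd:
      "\<lbrakk>openin T W; u \<in> W; u \<in> D\<rbrakk> \<Longrightarrow> \<exists>r>0. \<forall>v\<in>D. norm (\<phi> v - \<phi> u) < r \<longrightarrow> v \<in> W"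
    and chart_onto: "\<exists>r>0. \<forall>x. norm x < r \<longrightarrow> x \<in> \<phi> ` D"
    and mult_strict:
      "0 < \<eta> \<Longrightarrow> \<exists>r>0. \<forall>u\<in>D. \<forall>v\<in>D. norm (\<phi> u) < r \<longrightarrow> norm (\<phi> v) < r \<longrightarrow>
         u \<otimes> v \<in> D \<and> norm (\<phi> (u \<otimes> v) - \<phi> u - \<phi> v) \<le> \<eta> * min (norm (\<phi> u)) (norm (\<phi> v))"
    and conj_derivative:
      "g \<in> carrier U \<Longrightarrow> \<exists>L. bounded_linear L \<and> (\<forall>\<eta>>0. \<exists>r>0. \<forall>u\<in>D. norm (\<phi> u) < r \<longrightarrow>
         g \<otimes> u \<otimes> inv g \<in> D \<and> norm (\<phi> (g \<otimes> u \<otimes> inv g) - L (\<phi> u)) \<le> \<eta> * norm (\<phi> u))"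
begin

definition nhd :: "real \<Rightarrow> 'a set" where
  "nhd r = {u \<in> D. norm (\<phi> u) < r}"

lemma D_carrier: "u \<in> D \<Longrightarrow> u \<in> carrier U"
  using openin_subset[OF D_open] topspace_carrier by auto

lemma nhd_D: "u \<in> nhd r \<Longrightarrow> u \<in> D"
  by (simp add: nhd_def)

lemma nhd_carrier: "u \<in> nhd r \<Longrightarrow> u \<in> carrier U"
  by (simp add: nhd_def D_carrier)

lemma nhd_norm: "u \<in> nhd r \<Longrightarrow> norm (\<phi> u) < r"
  by (simp add: nhd_def)

lemma one_nhd: "0 < r \<Longrightarrow> \<one> \<in> nhd r"
  by (simp add: nhd_def one_D chart_one)

lemma nhd_mono: "r \<le> r' \<Longrightarrow> nhd r \<subseteq> nhd r'"
  by (auto simp: nhd_def)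

lemma openin_nhd: "openin T (nhd r)"
proof -
  have "openin (subtopology T D) {u \<in> topspace (subtopology T D). \<phi> u \<in> ball 0 r}"
    by (rule openin_continuous_map_preimage[OF chart_continuous]) simp
  moreover have "{u \<in> topspace (subtopology T D). \<phi> u \<in> ball 0 r} = nhd r"
    using D_carrier by (auto simp: nhd_def topspace_carrier)
  ultimately show ?thesis
    using openin_open_subtopology[OF D_open] by metis
qed

lemma nhd_basis:
  assumes "openin T W" "\<one> \<in> W" obtains r where "0 < r" "nhd r \<subseteq> W"
  using chart_nhd[OF assms one_D] by (auto simp: chart_one nhd_def)

lemma continuous_mult:
  assumes "continuous_map X T f" "continuous_map X T h"
  shows "continuous_map X T (\<lambda>x. f x \<otimes> h x)"
proof -
  have "continuous_map X T ((\<lambda>(x, y). x \<otimes> y) \<circ> (\<lambda>x. (f x, h x)))"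
    by (rule continuous_map_compose[OF _ mult_continuous]) (simp add: continuous_map_paired assms)
  then show ?thesis by (simp add: o_def)
qed

lemma continuous_inv:
  assumes "continuous_map X T f" shows "continuous_map X T (\<lambda>x. inv (f x))"
  using continuous_map_compose[OF assms inv_continuous] by (simp add: o_def)

lemma continuous_const: "a \<in> carrier U \<Longrightarrow> continuous_map X T (\<lambda>x. a)"
  by (simp add: topspace_carrier)

lemma openin_preimage:
  assumes "continuous_map T T f" "openin T W" shows "openin T {x \<in> carrier U. f x \<in> W}"
  using openin_continuous_map_preimage[OF assms] topspace_carrier by simp

lemma mult_nhd:
  assumes "0 < \<eta>"
  obtains r where "0 < r"
    and "\<And>u v. u \<in> nhd r \<Longrightarrow> v \<in> nhd r \<Longrightarrow> u \<otimes> v \<in> D"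
    and "\<And>u v. u \<in> nhd r \<Longrightarrow> v \<in> nhd r \<Longrightarrow> norm (\<phi> (u \<otimes> v) - \<phi> u - \<phi> v) \<le> \<eta> * norm (\<phi> u)"
    and "\<And>u v. u \<in> nhd r \<Longrightarrow> v \<in> nhd r \<Longrightarrow> norm (\<phi> (u \<otimes> v) - \<phi> u - \<phi> v) \<le> \<eta> * norm (\<phi> v)"
proof -
  obtain r where r: "0 < r" and *: "\<And>u v. \<lbrakk>u \<in> nhd r; v \<in> nhd r\<rbrakk> \<Longrightarrow> u \<otimes> v \<in> D \<and>
      norm (\<phi> (u \<otimes> v) - \<phi> u - \<phi> v) \<le> \<eta> * min (norm (\<phi> u)) (norm (\<phi> v))"
    using mult_strict[OF assms] by (auto simp: nhd_def)
  show thesis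
    by (rule that[OF r]) (use * assms in \<open>force intro: order_trans[OF _ mult_left_mono]\<close>)+
qed

text \<open>Apply the estimate for products to \<open>u u\<^sup>-\<^sup>1 = \<one>\<close>.\<close>

lemma inv_nhd:
  assumes "0 < \<eta>"
  obtains r where "0 < r" and "\<And>u. u \<in> nhd r \<Longrightarrow> inv u \<in> D"
    and "\<And>u. u \<in> nhd r \<Longrightarrow> norm (\<phi> (inv u) + \<phi> u) \<le> \<eta> * norm (\<phi> u)"
proof -
  obtain s where s: "0 < s"
    and m: "\<And>u v. u \<in> nhd s \<Longrightarrow> v \<in> nhd s \<Longrightarrow> norm (\<phi> (u \<otimes> v) - \<phi> u - \<phi> v) \<le> \<eta> * norm (\<phi> u)"
    using mult_nhd[OF assms] by metis
  obtain r where r: "0 < r" "nhd r \<subseteq> {x \<in> carrier U. inv x \<in> nhd s}"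
    using nhd_basis[OF openin_preimage[OF inv_continuous openin_nhd], of s] one_nhd[OF s] by auto
  show thesis
  proof (rule that[of "min r s"])
    fix u assume "u \<in> nhd (min r s)"
    then have u: "u \<in> nhd s" "inv u \<in> nhd s" "u \<in> carrier U"
      using r nhd_mono[of "min r s" s] nhd_mono[of "min r s" r] nhd_carrier by auto
    then show "inv u \<in> D" by (simp add: nhd_def)
    have "norm (0 - \<phi> u - \<phi> (inv u)) \<le> \<eta> * norm (\<phi> u)"
      using m[OF u(1,2)] u(3) by (simp add: chart_one)
    also have "0 - \<phi> u - \<phi> (inv u) = - (\<phi> (inv u) + \<phi> u)" by simp
    finally show "norm (\<phi> (inv u) + \<phi> u) \<le> \<eta> * norm (\<phi> u)" by (simp only: norm_minus_cancel)
  qed (use r s in auto)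
qed

text \<open>The element \<open>v u = (v u v\<^sup>-\<^sup>1) v\<close> is estimated as a product in two ways, relative to \<open>u\<close> and
  relative to its conjugate; the difference of the estimates compares \<open>u\<close> with its conjugate.\<close>

lemma conj_nhd:
  assumes "0 < \<eta>"
  obtains r where "0 < r" and "\<And>u v. u \<in> nhd r \<Longrightarrow> v \<in> nhd r \<Longrightarrow> v \<otimes> u \<otimes> inv v \<in> D"
    and "\<And>u v. u \<in> nhd r \<Longrightarrow> v \<in> nhd r \<Longrightarrow> norm (\<phi> (v \<otimes> u \<otimes> inv v) - \<phi> u) \<le> \<eta> * norm (\<phi> u)"
proof -
  define \<eta>' where "\<eta>' = min (1/2) (\<eta>/4)"
  have \<eta>': "0 < \<eta>'" "\<eta>' \<le> 1/2" "4 * \<eta>' \<le> \<eta>" using assms by (auto simp: \<eta>'_def)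
  obtain s where s: "0 < s"
    and ml: "\<And>u v. u \<in> nhd s \<Longrightarrow> v \<in> nhd s \<Longrightarrow> norm (\<phi> (u \<otimes> v) - \<phi> u - \<phi> v) \<le> \<eta>' * norm (\<phi> u)"
    and mr: "\<And>u v. u \<in> nhd s \<Longrightarrow> v \<in> nhd s \<Longrightarrow> norm (\<phi> (u \<otimes> v) - \<phi> u - \<phi> v) \<le> \<eta>' * norm (\<phi> v)"
    using mult_nhd[OF \<eta>'(1)] by metis
  have "continuous_map (prod_topology T T) T (\<lambda>p. snd p \<otimes> fst p \<otimes> inv (snd p))"
    by (intro continuous_mult continuous_inv continuous_map_fst continuous_map_snd)
  from openin_continuous_map_preimage[OF this openin_nhd, of s]
  have "openin (prod_topology T T)
      {p \<in> carrier U \<times> carrier U. snd p \<otimes> fst p \<otimes> inv (snd p) \<in> nhd s}"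
    by (simp add: topspace_carrier)
  moreover have "(\<one>, \<one>) \<in> {p \<in> carrier U \<times> carrier U. snd p \<otimes> fst p \<otimes> inv (snd p) \<in> nhd s}"
    using one_nhd[OF s] by simp
  ultimately have "\<exists>W W'. openin T W \<and> openin T W' \<and> \<one> \<in> W \<and> \<one> \<in> W' \<and>
      W \<times> W' \<subseteq> {p \<in> carrier U \<times> carrier U. snd p \<otimes> fst p \<otimes> inv (snd p) \<in> nhd s}"
    unfolding openin_prod_topology_alt by (elim allE impE)
  then obtain W W' where W: "openin T W" "\<one> \<in> W" "openin T W'" "\<one> \<in> W'" and
    WW': "W \<times> W' \<subseteq> {p \<in> carrier U \<times> carrier U. snd p \<otimes> fst p \<otimes> inv (snd p) \<in> nhd s}"
    by (elim exE conjE)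
  obtain a where a: "0 < a" "nhd a \<subseteq> W" using nhd_basis[OF W(1,2)] .
  obtain b where b: "0 < b" "nhd b \<subseteq> W'" using nhd_basis[OF W(3,4)] .
  define r where "r = min s (min a b)"
  have r: "0 < r" "r \<le> s" "r \<le> a" "r \<le> b" using s a b by (auto simp: r_def)
  have main: "v \<otimes> u \<otimes> inv v \<in> nhd s \<and> norm (\<phi> (v \<otimes> u \<otimes> inv v) - \<phi> u) \<le> \<eta> * norm (\<phi> u)"
    if "u \<in> nhd r" "v \<in> nhd r" for u v
  proof -
    define c where "c = v \<otimes> u \<otimes> inv v"
    have uv: "u \<in> nhd s" "v \<in> nhd s" "u \<in> carrier U" "v \<in> carrier U" "u \<in> W" "v \<in> W'"
      using that nhd_mono[OF r(2)] nhd_mono[OF r(3)] nhd_mono[OF r(4)] a(2) b(2) nhd_carrier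
      by auto
    have c: "c \<in> nhd s" using uv(5,6) WW' by (auto simp: c_def)
    have "c \<otimes> v = v \<otimes> u" using uv by (simp add: c_def m_assoc)
    then have "norm (\<phi> (v \<otimes> u) - \<phi> c - \<phi> v) \<le> \<eta>' * norm (\<phi> c)"
      using ml[OF c uv(2)] by simp
    moreover have "norm (\<phi> (v \<otimes> u) - \<phi> v - \<phi> u) \<le> \<eta>' * norm (\<phi> u)"
      by (rule mr[OF uv(2,1)])
    moreover have "norm (\<phi> c - \<phi> u) \<le>
        norm (\<phi> (v \<otimes> u) - \<phi> v - \<phi> u) + norm (\<phi> (v \<otimes> u) - \<phi> c - \<phi> v)"
      using norm_triangle_ineq4[of "\<phi> (v \<otimes> u) - \<phi> v - \<phi> u" "\<phi> (v \<otimes> u) - \<phi> c - \<phi> v"]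
      by simp
    ultimately have "norm (\<phi> c - \<phi> u) \<le> \<eta>' * norm (\<phi> u) + \<eta>' * norm (\<phi> c)"
      by linarith
    also have "norm (\<phi> c) \<le> norm (\<phi> u) + norm (\<phi> c - \<phi> u)"
      by (rule norm_triangle_sub)
    finally have "norm (\<phi> c - \<phi> u) \<le> \<eta>' * (2 * norm (\<phi> u)) + \<eta>' * norm (\<phi> c - \<phi> u)"
      using \<eta>' by (simp add: algebra_simps)
    also have "\<eta>' * norm (\<phi> c - \<phi> u) \<le> (1/2) * norm (\<phi> c - \<phi> u)"
      by (rule mult_right_mono[OF \<eta>'(2)]) simp
    finally have "norm (\<phi> c - \<phi> u) \<le> (4 * \<eta>') * norm (\<phi> u)" by simp
    also have "\<dots> \<le> \<eta> * norm (\<phi> u)" by (rule mult_right_mono[OF \<eta>'(3)]) simp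
    finally show ?thesis using c by (simp add: c_def)
  qed
  show thesis by (rule that[OF r(1)]) (use main nhd_D in blast)+
qed

text \<open>Each of the \<open>m\<close> multiplications costs an error of \<open>\<eta> \<parallel>\<phi> g\<parallel>\<close> as long as the powers stay in the
  ball where the estimate for products holds; for \<open>\<eta> \<le> 1\<close> they do.\<close>

lemma power_nhd:
  assumes "0 < \<eta>"
  obtains r where "0 < r"
    and "\<And>g m. g \<in> D \<Longrightarrow> real m * norm (\<phi> g) < r \<Longrightarrow> g [^] m \<in> D"
    and "\<And>g m. g \<in> D \<Longrightarrow> real m * norm (\<phi> g) < r \<Longrightarrow>
           norm (\<phi> (g [^] m) - real m *\<^sub>R \<phi> g) \<le> \<eta> * (real m * norm (\<phi> g))"
proof -
  define \<eta>' where "\<eta>' = min 1 \<eta>"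
  have \<eta>': "0 < \<eta>'" "\<eta>' \<le> 1" "\<eta>' \<le> \<eta>" using assms by (auto simp: \<eta>'_def)
  obtain s where s: "0 < s"
    and mD: "\<And>u v. u \<in> nhd s \<Longrightarrow> v \<in> nhd s \<Longrightarrow> u \<otimes> v \<in> D"
    and mr: "\<And>u v. u \<in> nhd s \<Longrightarrow> v \<in> nhd s \<Longrightarrow> norm (\<phi> (u \<otimes> v) - \<phi> u - \<phi> v) \<le> \<eta>' * norm (\<phi> v)"
    using mult_nhd[OF \<eta>'(1)] by metis
  have main: "g [^] m \<in> D \<and> norm (\<phi> (g [^] m) - real m *\<^sub>R \<phi> g) \<le> \<eta>' * (real m * norm (\<phi> g))"
    if g: "g \<in> D" "real m * norm (\<phi> g) < s / 2" for g m
    using g(2)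
  proof (induction m)
    case 0
    then show ?case using one_D chart_one by simp
  next
    case (Suc m)
    have le: "real m * norm (\<phi> g) < s / 2" "norm (\<phi> g) < s / 2"
      using Suc.prems mult_right_mono[of 1 "real (Suc m)" "norm (\<phi> g)"]
        mult_right_mono[of "real m" "real (Suc m)" "norm (\<phi> g)"] by simp_all
    have IH: "g [^] m \<in> D" "norm (\<phi> (g [^] m) - real m *\<^sub>R \<phi> g) \<le> \<eta>' * (real m * norm (\<phi> g))"
      using Suc.IH[OF le(1)] by auto
    have "norm (\<phi> (g [^] m)) \<le> norm (real m *\<^sub>R \<phi> g) + norm (\<phi> (g [^] m) - real m *\<^sub>R \<phi> g)"
      by (rule norm_triangle_sub)
    also have "\<dots> \<le> real m * norm (\<phi> g) + 1 * (real m * norm (\<phi> g))"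
      using IH(2) mult_right_mono[OF \<eta>'(2), of "real m * norm (\<phi> g)"] by simp
    also have "\<dots> < s" using le by simp
    finally have "g [^] m \<in> nhd s" using IH by (simp add: nhd_def)
    moreover have "g \<in> nhd s" using g le(2) s by (simp add: nhd_def)
    ultimately have "g [^] Suc m \<in> D"
      and b: "norm (\<phi> (g [^] Suc m) - \<phi> (g [^] m) - \<phi> g) \<le> \<eta>' * norm (\<phi> g)"
      using mD mr by (simp_all add: nat_pow_Suc)
    moreover have "norm (\<phi> (g [^] Suc m) - real (Suc m) *\<^sub>R \<phi> g) \<le> \<eta>' * (real (Suc m) * norm (\<phi> g))"
    proof -
      have "\<phi> (g [^] Suc m) - real (Suc m) *\<^sub>R \<phi> g =
          (\<phi> (g [^] Suc m) - \<phi> (g [^] m) - \<phi> g) + (\<phi> (g [^] m) - real m *\<^sub>R \<phi> g)"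
        by (simp add: algebra_simps del: nat_pow_Suc)
      also have "norm \<dots> \<le> \<eta>' * norm (\<phi> g) + \<eta>' * (real m * norm (\<phi> g))"
        by (intro norm_triangle_le add_mono b IH(2))
      finally show ?thesis by (simp add: algebra_simps del: nat_pow_Suc)
    qed
    ultimately show ?case by blast
  qed
  show thesis
  proof (rule that[of "s / 2"])
    fix g and m :: nat assume "g \<in> D" "real m * norm (\<phi> g) < s / 2"
    from main[OF this] show "g [^] m \<in> D"
        "norm (\<phi> (g [^] m) - real m *\<^sub>R \<phi> g) \<le> \<eta> * (real m * norm (\<phi> g))"
      using mult_right_mono[OF \<eta>'(3), of "real m * norm (\<phi> g)"] by auto
  qed (use s in simp)
qed

text \<open>An element near \<open>g\<^sub>0\<close> is \<open>g\<^sub>0 v\<close> with \<open>v\<close> near the identity, and conjugation by \<open>v\<close> is the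
  identity up to a small relative error.  So the derivative at \<open>g\<^sub>0\<close> serves for the whole neighbourhood.\<close>

lemma conj_locally_uniform_derivative:
  assumes g0: "g0 \<in> carrier U" and \<eta>: "0 < \<eta>"
  shows "\<exists>L W r. bounded_linear L \<and> openin T W \<and> g0 \<in> W \<and> 0 < r \<and> (\<forall>g\<in>W. \<forall>u\<in>nhd r.
    g \<otimes> u \<otimes> inv g \<in> D \<and> norm (\<phi> (g \<otimes> u \<otimes> inv g) - L (\<phi> u)) \<le> \<eta> * norm (\<phi> u))"
proof -
  obtain L where L: "bounded_linear L" and L': "\<And>\<eta>. 0 < \<eta> \<Longrightarrow> \<exists>r>0. \<forall>u\<in>D. norm (\<phi> u) < r \<longrightarrow>
         g0 \<otimes> u \<otimes> inv g0 \<in> D \<and> norm (\<phi> (g0 \<otimes> u \<otimes> inv g0) - L (\<phi> u)) \<le> \<eta> * norm (\<phi> u)"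
    using conj_derivative[OF g0] by blast
  obtain B where B: "0 < B" "\<And>x. norm (L x) \<le> norm x * B"
    using bounded_linear.pos_bounded[OF L] by blast
  obtain s where s: "0 < s" and gs: "\<And>u. u \<in> nhd s \<Longrightarrow> g0 \<otimes> u \<otimes> inv g0 \<in> D"
    "\<And>u. u \<in> nhd s \<Longrightarrow> norm (\<phi> (g0 \<otimes> u \<otimes> inv g0) - L (\<phi> u)) \<le> (\<eta> / 4) * norm (\<phi> u)"
    using L'[of "\<eta> / 4"] \<eta> by (auto simp: nhd_def)
  define \<epsilon> where "\<epsilon> = min 1 (\<eta> / (2 * B))"
  have \<epsilon>: "0 < \<epsilon>" "\<epsilon> \<le> 1" "\<epsilon> * B \<le> \<eta> / 2"
    using \<eta> B by (auto simp: \<epsilon>_def min_def field_simps)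
  obtain r where r: "0 < r" and vu: "\<And>u v. u \<in> nhd r \<Longrightarrow> v \<in> nhd r \<Longrightarrow> v \<otimes> u \<otimes> inv v \<in> D"
    "\<And>u v. u \<in> nhd r \<Longrightarrow> v \<in> nhd r \<Longrightarrow> norm (\<phi> (v \<otimes> u \<otimes> inv v) - \<phi> u) \<le> \<epsilon> * norm (\<phi> u)"
    using conj_nhd[OF \<epsilon>(1)] by metis
  define W where "W = {g \<in> carrier U. inv g0 \<otimes> g \<in> nhd r}"
  have "openin T W" unfolding W_def
    by (intro openin_preimage openin_nhd continuous_mult continuous_const continuous_map_id[unfolded id_def])
      (use g0 in simp)
  moreover have "g0 \<in> W" using g0 one_nhd[OF r] by (simp add: W_def)
  moreover have "g \<otimes> u \<otimes> inv g \<in> D \<and> norm (\<phi> (g \<otimes> u \<otimes> inv g) - L (\<phi> u)) \<le> \<eta> * norm (\<phi> u)"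
    if g: "g \<in> W" and u: "u \<in> nhd (min r (s / 2))" for g u
  proof -
    define v where "v = inv g0 \<otimes> g"
    define c where "c = v \<otimes> u \<otimes> inv v"
    have v: "v \<in> nhd r" "v \<in> carrier U" "g \<in> carrier U"
      using g nhd_carrier by (auto simp: W_def v_def)
    have ur: "u \<in> nhd r" "u \<in> carrier U" "norm (\<phi> u) < s / 2"
      using u nhd_carrier by (auto simp: nhd_def)
    have gv: "g = g0 \<otimes> v" using v g0 by (simp add: v_def m_assoc[symmetric])
    have conj: "g \<otimes> u \<otimes> inv g = g0 \<otimes> c \<otimes> inv g0"
      using v g0 ur by (simp add: gv c_def inv_mult_group m_assoc)
    have cu: "norm (\<phi> c - \<phi> u) \<le> \<epsilon> * norm (\<phi> u)" and cD: "c \<in> D"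
      unfolding c_def using vu[OF ur(1) v(1)] by simp_all
    have "norm (\<phi> c) \<le> norm (\<phi> u) + norm (\<phi> c - \<phi> u)" by (rule norm_triangle_sub)
    also have "\<dots> \<le> norm (\<phi> u) + 1 * norm (\<phi> u)"
      using cu mult_right_mono[OF \<epsilon>(2), of "norm (\<phi> u)"] by simp
    finally have c2: "norm (\<phi> c) \<le> 2 * norm (\<phi> u)" by simp
    then have cs: "c \<in> nhd s" using cD ur by (simp add: nhd_def)
    have "norm (\<phi> (g \<otimes> u \<otimes> inv g) - L (\<phi> u)) \<le>
        norm (\<phi> (g0 \<otimes> c \<otimes> inv g0) - L (\<phi> c)) + norm (L (\<phi> c) - L (\<phi> u))"
      unfolding conj
      using norm_triangle_ineq[of "\<phi> (g0 \<otimes> c \<otimes> inv g0) - L (\<phi> c)" "L (\<phi> c) - L (\<phi> u)"] by simp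
    also have "norm (L (\<phi> c) - L (\<phi> u)) \<le> norm (\<phi> c - \<phi> u) * B"
      using B(2)[of "\<phi> c - \<phi> u"] by (simp add: linear_diff[OF bounded_linear.linear[OF L]])
    also have "\<dots> \<le> \<epsilon> * norm (\<phi> u) * B"
      by (rule mult_right_mono[OF cu]) (use B in simp)
    also have "\<dots> = (\<epsilon> * B) * norm (\<phi> u)" by simp
    also have "\<dots> \<le> \<eta> / 2 * norm (\<phi> u)" by (rule mult_right_mono[OF \<epsilon>(3)]) simp
    also have "norm (\<phi> (g0 \<otimes> c \<otimes> inv g0) - L (\<phi> c)) \<le> (\<eta> / 4) * norm (\<phi> c)"
      by (rule gs(2)[OF cs])
    also have "\<dots> \<le> (\<eta> / 4) * (2 * norm (\<phi> u))" by (rule mult_left_mono[OF c2]) (use \<eta> in simp)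
    finally show ?thesis using gs(1)[OF cs] unfolding conj by simp
  qed
  ultimately show ?thesis using L r s
    by (intro exI[of _ L] exI[of _ W] exI[of _ "min r (s / 2)"]) auto
qed

lemma conj_uniform_derivative:
  assumes G: "compactin T G" and \<eta>: "0 < \<eta>"
  obtains r M where "0 < r" "0 \<le> M"
    and "\<And>g u. g \<in> G \<Longrightarrow> u \<in> nhd r \<Longrightarrow> g \<otimes> u \<otimes> inv g \<in> D"
    and "\<And>g. g \<in> G \<Longrightarrow> \<exists>L. bounded_linear L \<and> (\<forall>x. norm (L x) \<le> M * norm x) \<and>
      (\<forall>u\<in>nhd r. norm (\<phi> (g \<otimes> u \<otimes> inv g) - L (\<phi> u)) \<le> \<eta> * norm (\<phi> u))"
proof -
  let ?P = "\<lambda>g L r M. bounded_linear L \<and> (\<forall>x. norm (L x) \<le> M * norm x) \<and> (\<forall>u\<in>nhd r. 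
      g \<otimes> u \<otimes> inv g \<in> D \<and> norm (\<phi> (g \<otimes> u \<otimes> inv g) - L (\<phi> u)) \<le> \<eta> * norm (\<phi> u))"
  have P_mono: "?P g L r' M'" if "?P g L r M" "r' \<le> r" "M \<le> M'" for g L r r' M M'
    using that nhd_mono[OF that(2)] by (meson mult_right_mono norm_ge_zero order_trans subsetD)
  have "\<exists>r>0. \<exists>M\<ge>0. \<forall>g\<in>G. \<exists>L. ?P g L r M"
  proof (rule compactin_induct_open_cover[OF G, where Q = "\<lambda>S. \<exists>r>0. \<exists>M\<ge>0. \<forall>g\<in>S. \<exists>L. ?P g L r M"])
    show "\<exists>r>0. \<exists>M\<ge>0. \<forall>g\<in>{}. \<exists>L. ?P g L r M"
      by (intro exI[of _ "1::real"]) auto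
  next
    fix S S' :: "'a set"
    assume "\<exists>r>0. \<exists>M\<ge>0. \<forall>g\<in>S. \<exists>L. ?P g L r M"
    then obtain r M where 1: "r > 0" "M \<ge> 0" "\<forall>g\<in>S. \<exists>L. ?P g L r M" by blast
    assume "\<exists>r>0. \<exists>M\<ge>0. \<forall>g\<in>S'. \<exists>L. ?P g L r M"
    then obtain r' M' where 2: "r' > 0" "M' \<ge> 0" "\<forall>g\<in>S'. \<exists>L. ?P g L r' M'" by blast
    have "\<exists>L. ?P g L (min r r') (max M M')" if "g \<in> S \<union> S'" for g
      using that
    proof
      assume "g \<in> S"
      then obtain L where "?P g L r M" using 1 by blast
      from P_mono[OF this, of "min r r'" "max M M'"] show ?thesis by auto
    next
      assume "g \<in> S'"
      then obtain L where "?P g L r' M'" using 2 by blast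
      from P_mono[OF this, of "min r r'" "max M M'"] show ?thesis by auto
    qed
    with 1(1,2) 2(1,2) show "\<exists>r>0. \<exists>M\<ge>0. \<forall>g\<in>S \<union> S'. \<exists>L. ?P g L r M"
      by (intro exI[of _ "min r r'"] conjI exI[of _ "max M M'"]) auto
  next
    fix S S' :: "'a set"
    assume "S \<subseteq> S'" "\<exists>r>0. \<exists>M\<ge>0. \<forall>g\<in>S'. \<exists>L. ?P g L r M"
    then show "\<exists>r>0. \<exists>M\<ge>0. \<forall>g\<in>S. \<exists>L. ?P g L r M" by blast
  next
    fix g0 assume "g0 \<in> G"
    then have "g0 \<in> carrier U"
      using compactin_subset_topspace[OF G] topspace_carrier by auto
    from conj_locally_uniform_derivative[OF this \<eta>] obtain L W r where
      L: "bounded_linear L" "openin T W" "g0 \<in> W" "0 < r" "\<forall>g\<in>W. \<forall>u\<in>nhd r.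
        g \<otimes> u \<otimes> inv g \<in> D \<and> norm (\<phi> (g \<otimes> u \<otimes> inv g) - L (\<phi> u)) \<le> \<eta> * norm (\<phi> u)" by blast
    obtain B where B: "0 \<le> B" "\<forall>x. norm (L x) \<le> B * norm x"
      using bounded_linear.nonneg_bounded[OF L(1)] by (metis mult.commute)
    have "\<forall>g\<in>W. ?P g L r B" using L B by blast
    then show "\<exists>W. openin T W \<and> g0 \<in> W \<and> (\<exists>r>0. \<exists>M\<ge>0. \<forall>g\<in>W. \<exists>L. ?P g L r M)"
      by (intro exI[of _ W] exI[of _ r] exI[of _ B] conjI L B(1) ballI exI[of _ L]) auto
  qed
  then obtain r M where rM: "r > 0" "M \<ge> 0" "\<forall>g\<in>G. \<exists>L. ?P g L r M" by blast
  show thesis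
  proof (rule that[OF rM(1,2)])
    fix g assume "g \<in> G"
    then obtain L where L: "?P g L r M" using rM(3) by blast
    show "g \<otimes> u \<otimes> inv g \<in> D" if "u \<in> nhd r" for u using L that by simp
    show "\<exists>L. bounded_linear L \<and> (\<forall>x. norm (L x) \<le> M * norm x) \<and>
      (\<forall>u\<in>nhd r. norm (\<phi> (g \<otimes> u \<otimes> inv g) - L (\<phi> u)) \<le> \<eta> * norm (\<phi> u))"
      using L by (intro exI[of _ L]) simp
  qed
qed

end

text \<open>The finite cover of a compact subgroup by translates that finite averages require.\<close>

lemma (in strictly_charted_group) finite_net:
  assumes K: "compactin T K" and r: "0 < r"
  obtains C where "finite C" "C \<subseteq> K" "\<And>x. x \<in> K \<Longrightarrow> \<exists>c\<in>C. x \<otimes> inv c \<in> nhd r"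
proof -
  let ?Q = "\<lambda>S. \<exists>C. finite C \<and> C \<subseteq> K \<and> (\<forall>x\<in>S. \<exists>c\<in>C. x \<otimes> inv c \<in> nhd r)"
  have "?Q K"
  proof (rule compactin_induct_open_cover[OF K, where Q = ?Q])
    fix S S'
    assume "?Q S" then obtain C where C: "finite C" "C \<subseteq> K" "\<forall>x\<in>S. \<exists>c\<in>C. x \<otimes> inv c \<in> nhd r" by blast
    assume "?Q S'" then obtain C' where C': "finite C'" "C' \<subseteq> K" "\<forall>x\<in>S'. \<exists>c\<in>C'. x \<otimes> inv c \<in> nhd r"
      by blast
    show "?Q (S \<union> S')" using C C' by (intro exI[of _ "C \<union> C'"]) blast
  next
    fix c assume c: "c \<in> K"
    then have cU: "c \<in> carrier U" using compactin_subset_topspace[OF K] topspace_carrier by auto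
    have "openin T {x \<in> carrier U. x \<otimes> inv c \<in> nhd r}"
      using cU by (intro openin_preimage openin_nhd continuous_mult continuous_const) auto
    then show "\<exists>W. openin T W \<and> c \<in> W \<and> ?Q W"
      using c cU one_nhd[OF r] by (intro exI[of _ "{x \<in> carrier U. x \<otimes> inv c \<in> nhd r}"] conjI exI[of _ "{c}"]) auto
  qed blast+
  then show thesis using that by blast
qed


section \<open>The tangent space of a compact subgroup\<close>

locale charted_group_with_compact_subgroup = strictly_charted_group +
  fixes G
  assumes subgroup_G: "subgroup G U" and compact_G: "compactin T G"
begin

lemma G_carrier: "g \<in> G \<Longrightarrow> g \<in> carrier U"
  using subgroup.subset[OF subgroup_G] by auto

lemma G_power: "g \<in> G \<Longrightarrow> g [^] (n::nat) \<in> G"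
  by (induction n) (simp_all add: subgroup.one_closed[OF subgroup_G] subgroup.m_closed[OF subgroup_G])

text \<open>First-order approximability is required for all small \<open>s\<close>, not only along a sequence, so that
  approximating elements for two vectors exist at the same scale and can be multiplied.\<close>

definition tangent :: "'c set" where
  "tangent = {X. \<forall>\<epsilon>>0. \<exists>r>0. \<forall>s. 0 < s \<longrightarrow> s < r \<longrightarrow>
     (\<exists>g\<in>G \<inter> D. norm (\<phi> g - s *\<^sub>R X) \<le> \<epsilon> * s)}"

lemma tangentE:
  assumes "X \<in> tangent" "0 < \<epsilon>"
  obtains r where "0 < r" "\<And>s. 0 < s \<Longrightarrow> s < r \<Longrightarrow> \<exists>g\<in>G \<inter> D. norm (\<phi> g - s *\<^sub>R X) \<le> \<epsilon> * s"
  using assms unfolding tangent_def by blast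

lemma zero_tangent: "0 \<in> tangent"
proof -
  have "\<exists>g\<in>G \<inter> D. norm (\<phi> g - s *\<^sub>R 0) \<le> \<epsilon> * s" if "0 < \<epsilon>" "0 < s" for s \<epsilon> :: real
    using that one_D subgroup.one_closed[OF subgroup_G] by (intro bexI[of _ \<one>]) (auto simp: chart_one)
  then show ?thesis unfolding tangent_def by (auto intro!: exI[of _ "1::real"])
qed

lemma norm_approx:
  assumes "norm (x - s *\<^sub>R X) \<le> \<epsilon> * s" "\<epsilon> \<le> 1" "0 < s"
  shows "norm x \<le> s * (norm X + 1)"
proof -
  have "norm x \<le> norm (s *\<^sub>R X) + norm (x - s *\<^sub>R X)" by (rule norm_triangle_sub)
  also have "\<dots> \<le> s * norm X + 1 * s"
    using order_trans[OF assms(1) mult_right_mono[OF assms(2), of s]] assms(3) by simp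
  finally show ?thesis by (simp add: algebra_simps)
qed

lemma add_tangent:
  assumes X: "X \<in> tangent" and Y: "Y \<in> tangent" shows "X + Y \<in> tangent"
  unfolding tangent_def mem_Collect_eq
proof (intro allI impI)
  fix \<epsilon> :: real assume \<epsilon>: "0 < \<epsilon>"
  define \<epsilon>' where "\<epsilon>' = min 1 (\<epsilon> / 4)"
  have \<epsilon>': "0 < \<epsilon>'" "\<epsilon>' \<le> 1" "\<epsilon>' \<le> \<epsilon> / 4" using \<epsilon> by (auto simp: \<epsilon>'_def)
  define \<eta> where "\<eta> = \<epsilon> / (2 * (norm X + 1))"
  have nX: "0 < norm X + 1" "0 < norm Y + 1" using norm_ge_zero[of X] norm_ge_zero[of Y] by linarith+
  have \<eta>: "0 < \<eta>" "\<eta> * (norm X + 1) = \<epsilon> / 2"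
    using \<epsilon> nX unfolding \<eta>_def by (simp_all add: field_simps)
  obtain r where r: "0 < r"
    and mD: "\<And>u v. u \<in> nhd r \<Longrightarrow> v \<in> nhd r \<Longrightarrow> u \<otimes> v \<in> D"
    and ml: "\<And>u v. u \<in> nhd r \<Longrightarrow> v \<in> nhd r \<Longrightarrow> norm (\<phi> (u \<otimes> v) - \<phi> u - \<phi> v) \<le> \<eta> * norm (\<phi> u)"
    using mult_nhd[OF \<eta>(1)] by metis
  obtain a where a: "0 < a" "\<And>s. 0 < s \<Longrightarrow> s < a \<Longrightarrow> \<exists>g\<in>G \<inter> D. norm (\<phi> g - s *\<^sub>R X) \<le> \<epsilon>' * s"
    using tangentE[OF X \<epsilon>'(1)] by blast
  obtain b where b: "0 < b" "\<And>s. 0 < s \<Longrightarrow> s < b \<Longrightarrow> \<exists>g\<in>G \<inter> D. norm (\<phi> g - s *\<^sub>R Y) \<le> \<epsilon>' * s"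
    using tangentE[OF Y \<epsilon>'(1)] by blast
  define c where "c = min (min a b) (min (r / (norm X + 1)) (r / (norm Y + 1)))"
  have c: "0 < c" using a b r nX by (simp add: c_def)
  have "\<exists>g\<in>G \<inter> D. norm (\<phi> g - s *\<^sub>R (X + Y)) \<le> \<epsilon> * s" if s: "0 < s" "s < c" for s
  proof -
    obtain g where g: "g \<in> G" "g \<in> D" "norm (\<phi> g - s *\<^sub>R X) \<le> \<epsilon>' * s"
      using a(2)[of s] s by (auto simp: c_def)
    obtain h where h: "h \<in> G" "h \<in> D" "norm (\<phi> h - s *\<^sub>R Y) \<le> \<epsilon>' * s"
      using b(2)[of s] s by (auto simp: c_def)
    have ng: "norm (\<phi> g) \<le> s * (norm X + 1)" and nh: "norm (\<phi> h) \<le> s * (norm Y + 1)"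
      using norm_approx g(3) h(3) \<epsilon>'(2) s(1) by blast+
    have "s < r / (norm X + 1)" "s < r / (norm Y + 1)" using s(2) by (auto simp: c_def)
    then have "s * (norm X + 1) < r" "s * (norm Y + 1) < r"
      using nX by (simp_all add: pos_less_divide_eq)
    then have gh: "g \<in> nhd r" "h \<in> nhd r" using g h ng nh by (auto simp: nhd_def)
    have 1: "norm (\<phi> (g \<otimes> h) - \<phi> g - \<phi> h) \<le> \<epsilon> / 2 * s"
    proof -
      have "norm (\<phi> (g \<otimes> h) - \<phi> g - \<phi> h) \<le> \<eta> * norm (\<phi> g)" by (rule ml[OF gh])
      also have "\<dots> \<le> \<eta> * (s * (norm X + 1))" by (rule mult_left_mono[OF ng]) (use \<eta> in simp)
      also have "\<dots> = (\<eta> * (norm X + 1)) * s" by (simp only: ac_simps)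
      finally show ?thesis by (simp only: \<eta>(2))
    qed
    have "\<epsilon>' * s \<le> \<epsilon> / 4 * s" using \<epsilon>'(3) s by (simp add: mult_right_mono)
    then have 2: "norm (\<phi> g - s *\<^sub>R X) \<le> \<epsilon> / 4 * s" "norm (\<phi> h - s *\<^sub>R Y) \<le> \<epsilon> / 4 * s"
      using g(3) h(3) by linarith+
    have "\<phi> (g \<otimes> h) - s *\<^sub>R (X + Y) = (\<phi> (g \<otimes> h) - \<phi> g - \<phi> h) + ((\<phi> g - s *\<^sub>R X) + (\<phi> h - s *\<^sub>R Y))"
      by (simp add: algebra_simps)
    also have "norm \<dots> \<le> \<epsilon> / 2 * s + (\<epsilon> / 4 * s + \<epsilon> / 4 * s)"
      by (intro norm_triangle_le add_mono 1 2)
    finally have "norm (\<phi> (g \<otimes> h) - s *\<^sub>R (X + Y)) \<le> \<epsilon> * s" by simp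
    then show ?thesis using mD[OF gh] g h subgroup.m_closed[OF subgroup_G] by blast
  qed
  then show "\<exists>r>0. \<forall>s. 0 < s \<longrightarrow> s < r \<longrightarrow> (\<exists>g\<in>G \<inter> D. norm (\<phi> g - s *\<^sub>R (X + Y)) \<le> \<epsilon> * s)"
    using c by blast
qed

lemma uminus_tangent:
  assumes X: "X \<in> tangent" shows "- X \<in> tangent"
  unfolding tangent_def mem_Collect_eq
proof (intro allI impI)
  fix \<epsilon> :: real assume \<epsilon>: "0 < \<epsilon>"
  define \<epsilon>' where "\<epsilon>' = min 1 (\<epsilon> / 2)"
  have \<epsilon>': "0 < \<epsilon>'" "\<epsilon>' \<le> 1" "\<epsilon>' \<le> \<epsilon> / 2" using \<epsilon> by (auto simp: \<epsilon>'_def)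
  define \<eta> where "\<eta> = \<epsilon> / (2 * (norm X + 1))"
  have nX: "0 < norm X + 1" using norm_ge_zero[of X] by linarith
  have \<eta>: "0 < \<eta>" "\<eta> * (norm X + 1) = \<epsilon> / 2"
    using \<epsilon> nX unfolding \<eta>_def by (simp_all add: field_simps)
  obtain r where r: "0 < r"
    and iD: "\<And>u. u \<in> nhd r \<Longrightarrow> inv u \<in> D"
    and i: "\<And>u. u \<in> nhd r \<Longrightarrow> norm (\<phi> (inv u) + \<phi> u) \<le> \<eta> * norm (\<phi> u)"
    using inv_nhd[OF \<eta>(1)] by metis
  obtain a where a: "0 < a" "\<And>s. 0 < s \<Longrightarrow> s < a \<Longrightarrow> \<exists>g\<in>G \<inter> D. norm (\<phi> g - s *\<^sub>R X) \<le> \<epsilon>' * s"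
    using tangentE[OF X \<epsilon>'(1)] by blast
  define c where "c = min a (r / (norm X + 1))"
  have c: "0 < c" using a r nX by (simp add: c_def)
  have "\<exists>g\<in>G \<inter> D. norm (\<phi> g - s *\<^sub>R (- X)) \<le> \<epsilon> * s" if s: "0 < s" "s < c" for s
  proof -
    obtain g where g: "g \<in> G" "g \<in> D" "norm (\<phi> g - s *\<^sub>R X) \<le> \<epsilon>' * s"
      using a(2)[of s] s by (auto simp: c_def)
    have ng: "norm (\<phi> g) \<le> s * (norm X + 1)"
      by (rule norm_approx[OF g(3) \<epsilon>'(2) s(1)])
    have "s < r / (norm X + 1)" using s(2) by (auto simp: c_def)
    then have "s * (norm X + 1) < r" using nX by (simp add: pos_less_divide_eq)
    then have gr: "g \<in> nhd r" using g ng by (auto simp: nhd_def)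
    have 1: "norm (\<phi> (inv g) + \<phi> g) \<le> \<epsilon> / 2 * s"
    proof -
      have "norm (\<phi> (inv g) + \<phi> g) \<le> \<eta> * norm (\<phi> g)" by (rule i[OF gr])
      also have "\<dots> \<le> \<eta> * (s * (norm X + 1))" by (rule mult_left_mono[OF ng]) (use \<eta> in simp)
      also have "\<dots> = (\<eta> * (norm X + 1)) * s" by (simp only: ac_simps)
      finally show ?thesis by (simp only: \<eta>(2))
    qed
    have "\<epsilon>' * s \<le> \<epsilon> / 2 * s" using \<epsilon>'(3) s by (simp add: mult_right_mono)
    then have 2: "norm (\<phi> g - s *\<^sub>R X) \<le> \<epsilon> / 2 * s" using g(3) by linarith
    have "\<phi> (inv g) - s *\<^sub>R (- X) = (\<phi> (inv g) + \<phi> g) - (\<phi> g - s *\<^sub>R X)"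
      by (simp add: algebra_simps)
    also have "norm \<dots> \<le> \<epsilon> / 2 * s + \<epsilon> / 2 * s"
      using norm_triangle_ineq4[of "\<phi> (inv g) + \<phi> g" "\<phi> g - s *\<^sub>R X"] 1 2 by linarith
    finally have "norm (\<phi> (inv g) - s *\<^sub>R (- X)) \<le> \<epsilon> * s" by simp
    then show ?thesis using iD[OF gr] g subgroup.m_inv_closed[OF subgroup_G] by blast
  qed
  then show "\<exists>r>0. \<forall>s. 0 < s \<longrightarrow> s < r \<longrightarrow> (\<exists>g\<in>G \<inter> D. norm (\<phi> g - s *\<^sub>R (- X)) \<le> \<epsilon> * s)"
    using c by blast
qed

lemma scaleR_pos_tangent:
  assumes X: "X \<in> tangent" and c: "0 < c" shows "c *\<^sub>R X \<in> tangent"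
  unfolding tangent_def mem_Collect_eq
proof (intro allI impI)
  fix \<epsilon> :: real assume \<epsilon>: "0 < \<epsilon>"
  then have "0 < \<epsilon> / c" using c by simp
  from tangentE[OF X this] obtain a where a: "0 < a"
    "\<And>s. 0 < s \<Longrightarrow> s < a \<Longrightarrow> \<exists>g\<in>G \<inter> D. norm (\<phi> g - s *\<^sub>R X) \<le> \<epsilon> / c * s" by blast
  have "\<exists>g\<in>G \<inter> D. norm (\<phi> g - s *\<^sub>R (c *\<^sub>R X)) \<le> \<epsilon> * s" if s: "0 < s" "s < a / c" for s
    using a(2)[of "s * c"] s c by (simp add: pos_less_divide_eq)
  then show "\<exists>r>0. \<forall>s. 0 < s \<longrightarrow> s < r \<longrightarrow> (\<exists>g\<in>G \<inter> D. norm (\<phi> g - s *\<^sub>R (c *\<^sub>R X)) \<le> \<epsilon> * s)"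
    using a(1) c by (intro exI[of _ "a / c"]) auto
qed

lemma subspace_tangent: "subspace tangent"
proof (rule subspaceI)
  fix c :: real and X assume X: "X \<in> tangent"
  consider "c = 0" | "0 < c" | "c < 0" by linarith
  then show "c *\<^sub>R X \<in> tangent"
  proof cases
    case 3
    then have "(- c) *\<^sub>R (- X) \<in> tangent"
      by (intro scaleR_pos_tangent uminus_tangent X) simp
    then show ?thesis by simp
  qed (use zero_tangent scaleR_pos_tangent X in auto)
qed (use zero_tangent add_tangent in auto)

text \<open>The definition of the tangent space gives a scale that depends on the vector.  Taking an
  approximating element for \<open>Y/n\<close> with \<open>n\<close> large and raising it to the power \<open>n\<close>
  gives a radius that is uniform in \<open>Y\<close>.\<close>

lemma tangent_approximates_subgroup:
  assumes \<eta>: "0 < \<eta>"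
  obtains r where "0 < r"
    and "\<And>Y. Y \<in> tangent \<Longrightarrow> norm Y < r \<Longrightarrow> \<exists>g\<in>G \<inter> D. norm (\<phi> g - Y) \<le> \<eta> * norm Y"
proof -
  define \<eta>' where "\<eta>' = min 1 (\<eta> / 3)"
  have \<eta>': "0 < \<eta>'" "\<eta>' \<le> 1" "3 * \<eta>' \<le> \<eta>" using \<eta> by (auto simp: \<eta>'_def)
  obtain r where r: "0 < r"
    and pD: "\<And>g m. g \<in> D \<Longrightarrow> real m * norm (\<phi> g) < r \<Longrightarrow> g [^] m \<in> D"
    and p: "\<And>g m. g \<in> D \<Longrightarrow> real m * norm (\<phi> g) < r \<Longrightarrow>
           norm (\<phi> (g [^] m) - real m *\<^sub>R \<phi> g) \<le> \<eta>' * (real m * norm (\<phi> g))"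
    using power_nhd[OF \<eta>'(1)] by metis
  show thesis
  proof (rule that[of "r / 2"])
    fix Y assume Y: "Y \<in> tangent" "norm Y < r / 2"
    show "\<exists>g\<in>G \<inter> D. norm (\<phi> g - Y) \<le> \<eta> * norm Y"
    proof (cases "Y = 0")
      case True
      then show ?thesis
        using one_D subgroup.one_closed[OF subgroup_G] by (intro bexI[of _ \<one>]) (auto simp: chart_one)
    next
      case False
      then have "0 < \<eta>' * norm Y" using \<eta>' by simp
      from tangentE[OF Y(1) this] obtain a where a: "0 < a"
        "\<And>s. 0 < s \<Longrightarrow> s < a \<Longrightarrow> \<exists>g\<in>G \<inter> D. norm (\<phi> g - s *\<^sub>R Y) \<le> \<eta>' * norm Y * s" by blast
      obtain n :: nat where n: "n \<noteq> 0" "inverse (real n) < a"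
        using ex_inverse_of_nat_less[OF a(1)] by auto
      then obtain g where g: "g \<in> G" "g \<in> D"
        "norm (\<phi> g - inverse (real n) *\<^sub>R Y) \<le> \<eta>' * norm Y * inverse (real n)"
        using a(2)[of "inverse (real n)"] by auto
      have "norm (real n *\<^sub>R \<phi> g - Y) = real n * norm (\<phi> g - inverse (real n) *\<^sub>R Y)"
      proof -
        have "real n *\<^sub>R \<phi> g - Y = real n *\<^sub>R (\<phi> g - inverse (real n) *\<^sub>R Y)"
          using n(1) by (simp add: scaleR_diff_right)
        then show ?thesis by simp
      qed
      also have "\<dots> \<le> real n * (\<eta>' * norm Y * inverse (real n))"
        by (rule mult_left_mono[OF g(3)]) simp
      also have "\<dots> = \<eta>' * norm Y" using n(1) by simp
      finally have 1: "norm (real n *\<^sub>R \<phi> g - Y) \<le> \<eta>' * norm Y" .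
      have "real n * norm (\<phi> g) = norm (real n *\<^sub>R \<phi> g)" by simp
      also have "\<dots> \<le> norm Y + norm (real n *\<^sub>R \<phi> g - Y)" by (rule norm_triangle_sub)
      also have "\<dots> \<le> 2 * norm Y"
        using 1 mult_right_mono[OF \<eta>'(2), of "norm Y"] by simp
      finally have ng: "real n * norm (\<phi> g) \<le> 2 * norm Y" .
      then have ng': "real n * norm (\<phi> g) < r" using Y(2) by simp
      have "norm (\<phi> (g [^] n) - real n *\<^sub>R \<phi> g) \<le> \<eta>' * (real n * norm (\<phi> g))"
        by (rule p[OF g(2) ng'])
      also have "\<dots> \<le> \<eta>' * (2 * norm Y)" by (rule mult_left_mono[OF ng]) (use \<eta>' in simp)
      finally have 2: "norm (\<phi> (g [^] n) - real n *\<^sub>R \<phi> g) \<le> \<eta>' * (2 * norm Y)" .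
      have "\<phi> (g [^] n) - Y = (\<phi> (g [^] n) - real n *\<^sub>R \<phi> g) + (real n *\<^sub>R \<phi> g - Y)" by simp
      also have "norm \<dots> \<le> \<eta>' * (2 * norm Y) + \<eta>' * norm Y"
        by (intro norm_triangle_le add_mono 1 2)
      also have "\<dots> = (3 * \<eta>') * norm Y" by simp
      also have "\<dots> \<le> \<eta> * norm Y" by (rule mult_right_mono[OF \<eta>'(3)]) simp
      finally show ?thesis using pD[OF g(2) ng'] G_power[OF g(1)] by blast
    qed
  qed (use r in simp)
qed

text \<open>Elements \<open>h\<^sub>0\<close>, \<open>h\<close> of a small translate of a neighbourhood of the identity differ by a small factor
  \<open>h\<^sub>0\<^sup>-\<^sup>1 h\<close>, so their coordinates are close.  Finitely many such translates cover \<open>G\<close>.\<close>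

lemma totally_bounded_chart:
  obtains r where "0 < r"
    and "\<And>e. 0 < e \<Longrightarrow> \<exists>F. finite F \<and> (\<forall>h\<in>G \<inter> nhd r. \<exists>y\<in>F. norm (\<phi> h - y) \<le> e)"
proof -
  obtain r where r: "0 < r"
    and mr: "\<And>u v. u \<in> nhd r \<Longrightarrow> v \<in> nhd r \<Longrightarrow> norm (\<phi> (u \<otimes> v) - \<phi> u - \<phi> v) \<le> 1 * norm (\<phi> v)"
    using mult_nhd[of 1] by (metis zero_less_one)
  show thesis
  proof (rule that[OF r])
    fix e :: real assume e: "0 < e"
    define t where "t = min r (e / 2)"
    have t: "0 < t" using e r by (simp add: t_def)
    let ?Q = "\<lambda>S. \<exists>F. finite F \<and> (\<forall>h\<in>S \<inter> nhd r. \<exists>y\<in>F. norm (\<phi> h - y) \<le> e)"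
    show "?Q G"
    proof (rule compactin_induct_open_cover[OF compact_G, where Q = ?Q])
      fix S S' :: "'a set"
      assume "?Q S"
      then obtain F where F: "finite F" "\<forall>h\<in>S \<inter> nhd r. \<exists>y\<in>F. norm (\<phi> h - y) \<le> e" by blast
      assume "?Q S'"
      then obtain F' where F': "finite F'" "\<forall>h\<in>S' \<inter> nhd r. \<exists>y\<in>F'. norm (\<phi> h - y) \<le> e" by blast
      show "?Q (S \<union> S')" using F F' by (intro exI[of _ "F \<union> F'"]) blast
    next
      fix g0 assume "g0 \<in> G"
      then have g0: "g0 \<in> carrier U" by (rule G_carrier)
      have "continuous_map (prod_topology T T) T (\<lambda>p. inv (inv g0 \<otimes> fst p) \<otimes> (inv g0 \<otimes> snd p))"
        using g0 by (intro continuous_mult continuous_inv continuous_map_fst continuous_map_snd continuous_const) auto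
      from openin_continuous_map_preimage[OF this openin_nhd, of t]
      have "openin (prod_topology T T)
          {p \<in> carrier U \<times> carrier U. inv (inv g0 \<otimes> fst p) \<otimes> (inv g0 \<otimes> snd p) \<in> nhd t}" (is "openin _ ?Z")
        by (simp add: topspace_carrier)
      moreover have "(g0, g0) \<in> ?Z"
        using one_nhd[OF t] g0 by simp
      ultimately have "\<exists>W W'. openin T W \<and> openin T W' \<and> g0 \<in> W \<and> g0 \<in> W' \<and> W \<times> W' \<subseteq> ?Z"
        unfolding openin_prod_topology_alt by (elim allE impE)
      then obtain W W' where W: "openin T W" "openin T W'" "g0 \<in> W" "g0 \<in> W'" and WW': "W \<times> W' \<subseteq> ?Z"
        by (elim exE conjE)
      have close: "norm (\<phi> h - \<phi> h0) \<le> e" if "h0 \<in> W \<inter> W' \<inter> nhd r" "h \<in> W \<inter> W' \<inter> nhd r" for h h0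
      proof -
        define c where "c = inv h0 \<otimes> h"
        have hc: "h0 \<in> carrier U" "h \<in> carrier U" using that nhd_carrier by auto
        have "g0 \<otimes> (inv g0 \<otimes> h) = h" using g0 hc by (simp add: m_assoc[symmetric])
        have "inv (inv g0 \<otimes> h0) \<otimes> (inv g0 \<otimes> h) \<in> nhd t" using WW' that by auto
        also have "inv (inv g0 \<otimes> h0) \<otimes> (inv g0 \<otimes> h) = c"
          using g0 hc \<open>g0 \<otimes> (inv g0 \<otimes> h) = h\<close> by (simp add: c_def inv_mult_group m_assoc)
        finally have c: "c \<in> nhd t" .
        have "h0 \<otimes> c = h" using hc by (simp add: c_def m_assoc[symmetric])
        with mr[of h0 c] that c nhd_mono[of t r]
        have "norm (\<phi> h - \<phi> h0 - \<phi> c) \<le> norm (\<phi> c)" by (auto simp: t_def)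
        then have "norm (\<phi> h - \<phi> h0) \<le> 2 * norm (\<phi> c)"
          using norm_triangle_sub[of "\<phi> h - \<phi> h0" "\<phi> c"] by linarith
        also have "\<dots> \<le> e" using nhd_norm[OF c] by (simp add: t_def)
        finally show ?thesis .
      qed
      have "?Q (W \<inter> W')"
      proof (cases "W \<inter> W' \<inter> nhd r = {}")
        case True
        then show ?thesis by (intro exI[of _ "{}"]) auto
      next
        case False
        then obtain h0 where "h0 \<in> W \<inter> W' \<inter> nhd r" by blast
        from close[OF this] show ?thesis by (intro exI[of _ "{\<phi> h0}"]) auto
      qed
      with W show "\<exists>W. openin T W \<and> g0 \<in> W \<and> ?Q W"
        by (intro exI[of _ "W \<inter> W'"]) auto
    qed blast+
  qed
qed

text \<open>The power with exponent \<open>\<lfloor>t / \<parallel>\<phi> g\<parallel>\<rfloor>\<close> of a very small \<open>g\<close> has the direction of \<open>g\<close> and size about \<open>t\<close>.\<close>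

lemma subgroup_contains_multiples:
  assumes \<epsilon>: "0 < \<epsilon>"
  obtains r where "0 < r"
    and "\<And>g t. g \<in> G \<inter> D \<Longrightarrow> \<phi> g \<noteq> 0 \<Longrightarrow> 0 < t \<Longrightarrow> t < r \<Longrightarrow> norm (\<phi> g) \<le> \<epsilon> / 2 * t \<Longrightarrow>
           \<exists>h\<in>G \<inter> D. norm (\<phi> h - (t / norm (\<phi> g)) *\<^sub>R \<phi> g) \<le> \<epsilon> * t"
proof -
  have "0 < \<epsilon> / 2" using \<epsilon> by simp
  from power_nhd[OF this] obtain r where r: "0 < r"
    and pD: "\<And>g m. g \<in> D \<Longrightarrow> real m * norm (\<phi> g) < r \<Longrightarrow> g [^] m \<in> D"
    and p: "\<And>g m. g \<in> D \<Longrightarrow> real m * norm (\<phi> g) < r \<Longrightarrow>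
           norm (\<phi> (g [^] m) - real m *\<^sub>R \<phi> g) \<le> \<epsilon> / 2 * (real m * norm (\<phi> g))"
    by metis
  show thesis
  proof (rule that[OF r])
    fix g and t :: real
    assume g: "g \<in> G \<inter> D" "\<phi> g \<noteq> 0" and t: "0 < t" "t < r" and small: "norm (\<phi> g) \<le> \<epsilon> / 2 * t"
    define s where "s = norm (\<phi> g)"
    have s: "0 < s" using g by (simp add: s_def)
    define m where "m = nat \<lfloor>t / s\<rfloor>"
    have "real m \<le> t / s" "t / s \<le> real m + 1"
      using s t by (simp_all add: m_def)
    then have m: "real m * s \<le> t" "t - real m * s \<le> s"
      using s by (simp_all add: field_simps)
    have ms: "real m * norm (\<phi> g) < r" using m t by (simp add: s_def)
    have "norm (\<phi> (g [^] m) - real m *\<^sub>R \<phi> g) \<le> \<epsilon> / 2 * (real m * norm (\<phi> g))"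
      by (rule p[OF _ ms]) (use g in simp)
    also have "\<dots> \<le> \<epsilon> / 2 * t" by (rule mult_left_mono) (use m \<epsilon> in \<open>auto simp: s_def\<close>)
    finally have 1: "norm (\<phi> (g [^] m) - real m *\<^sub>R \<phi> g) \<le> \<epsilon> / 2 * t" .
    have "norm (real m *\<^sub>R \<phi> g - (t / s) *\<^sub>R \<phi> g) = \<bar>real m - t / s\<bar> * s"
      by (simp add: s_def flip: scaleR_diff_left)
    also have "\<dots> = t - real m * s"
      using s m(1) \<open>real m \<le> t / s\<close> by (simp add: abs_if field_simps)
    finally have 2: "norm (real m *\<^sub>R \<phi> g - (t / s) *\<^sub>R \<phi> g) \<le> \<epsilon> / 2 * t"
      using m(2) small by (simp add: s_def)
    have "\<phi> (g [^] m) - (t / s) *\<^sub>R \<phi> g =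
        (\<phi> (g [^] m) - real m *\<^sub>R \<phi> g) + (real m *\<^sub>R \<phi> g - (t / s) *\<^sub>R \<phi> g)" by simp
    also have "norm \<dots> \<le> \<epsilon> / 2 * t + \<epsilon> / 2 * t" by (intro norm_triangle_le add_mono 1 2)
    finally have "norm (\<phi> (g [^] m) - (t / s) *\<^sub>R \<phi> g) \<le> \<epsilon> * t" by simp
    then show "\<exists>h\<in>G \<inter> D. norm (\<phi> h - (t / norm (\<phi> g)) *\<^sub>R \<phi> g) \<le> \<epsilon> * t"
      using pD[OF _ ms] g G_power[of g m] unfolding s_def by blast
  qed
qed

text \<open>This replaces the compactness of the unit sphere of a finite-dimensional space.  Rescaled to
  size \<open>t\<close>, all but finitely many of the directions are coordinates of elements of \<open>G\<close>, up to a
  relative error \<open>\<epsilon>\<close>.  As \<open>G\<close> is compact, the directions form a totally bounded set.  A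
  limit of directions is tangent because its multiples are limits of coordinates of powers.\<close>

lemma directions_accumulate:
  fixes g :: "nat \<Rightarrow> 'a"
  assumes g: "\<And>n. g n \<in> G \<inter> D" "\<And>n. \<phi> (g n) \<noteq> 0" and lim: "(\<lambda>n. \<phi> (g n)) \<longlonglongrightarrow> 0"
  obtains X and \<sigma> :: "nat \<Rightarrow> nat"
  where "strict_mono \<sigma>" "X \<in> tangent" "(\<lambda>n. \<phi> (g (\<sigma> n)) /\<^sub>R norm (\<phi> (g (\<sigma> n)))) \<longlonglongrightarrow> X"
proof -
  define Z where "Z n = \<phi> (g n) /\<^sub>R norm (\<phi> (g n))" for n
  have nZ: "norm (Z n) = 1" for n using g(2) by (simp add: Z_def)
  have tZ: "t *\<^sub>R Z n = (t / norm (\<phi> (g n))) *\<^sub>R \<phi> (g n)" for t n by (simp add: Z_def divide_inverse)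
  have lim0: "(\<lambda>n. norm (\<phi> (g n))) \<longlonglongrightarrow> 0" using tendsto_norm[OF lim] by simp
  have small: "eventually (\<lambda>n. norm (\<phi> (g n)) \<le> c) sequentially" if "0 < c" for c
    using order_tendstoD(2)[OF lim0 that] by eventually_elim simp
  obtain r where r: "0 < r"
    and tb: "\<And>e. 0 < e \<Longrightarrow> \<exists>F. finite F \<and> (\<forall>h\<in>G \<inter> nhd r. \<exists>y\<in>F. norm (\<phi> h - y) \<le> e)"
    using totally_bounded_chart by metis
  have cover: "\<exists>K. finite K \<and> range Z \<subseteq> (\<Union>x\<in>K. cball x e)" if e: "0 < e" for e
  proof -
    define \<epsilon> where "\<epsilon> = min 1 (e / 2)"
    have \<epsilon>: "0 < \<epsilon>" "\<epsilon> \<le> 1" "\<epsilon> \<le> e / 2" using e by (auto simp: \<epsilon>_def)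
    obtain a where a: "0 < a" and mult: "\<And>g t. g \<in> G \<inter> D \<Longrightarrow> \<phi> g \<noteq> 0 \<Longrightarrow> 0 < t \<Longrightarrow> t < a \<Longrightarrow>
        norm (\<phi> g) \<le> \<epsilon> / 2 * t \<Longrightarrow> \<exists>h\<in>G \<inter> D. norm (\<phi> h - (t / norm (\<phi> g)) *\<^sub>R \<phi> g) \<le> \<epsilon> * t"
      using subgroup_contains_multiples[OF \<epsilon>(1)] by metis
    define t where "t = min (a / 2) (r / 3)"
    have t: "0 < t" "t < a" "2 * t < r" using a r by (auto simp: t_def)
    obtain F where F: "finite F" "\<forall>h\<in>G \<inter> nhd r. \<exists>y\<in>F. norm (\<phi> h - y) \<le> e / 2 * t"
      using tb[of "e / 2 * t"] e t by auto
    obtain n0 where n0: "\<And>n. n \<ge> n0 \<Longrightarrow> norm (\<phi> (g n)) \<le> \<epsilon> / 2 * t"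
      using small[of "\<epsilon> / 2 * t"] \<epsilon> t by (auto simp: eventually_sequentially)
    have "\<exists>y\<in>F. Z n \<in> cball (y /\<^sub>R t) e" if n: "n \<ge> n0" for n
    proof -
      obtain h where h: "h \<in> G" "h \<in> D" "norm (\<phi> h - t *\<^sub>R Z n) \<le> \<epsilon> * t"
        using mult[OF g t(1,2) n0[OF n]] unfolding tZ by blast
      have "norm (\<phi> h) \<le> norm (t *\<^sub>R Z n) + norm (\<phi> h - t *\<^sub>R Z n)" by (rule norm_triangle_sub)
      also have "\<dots> \<le> t + 1 * t"
        using order_trans[OF h(3) mult_right_mono[OF \<epsilon>(2), of t]] t nZ by simp
      finally have "h \<in> nhd r" using h t by (simp add: nhd_def)
      then obtain y where y: "y \<in> F" "norm (\<phi> h - y) \<le> e / 2 * t" using F h by blast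
      have "t * norm (y /\<^sub>R t - Z n) = norm (y - t *\<^sub>R Z n)"
      proof -
        have "y - t *\<^sub>R Z n = t *\<^sub>R (y /\<^sub>R t - Z n)" using t by (simp add: scaleR_diff_right)
        then show ?thesis using t by simp
      qed
      also have "y - t *\<^sub>R Z n = (\<phi> h - t *\<^sub>R Z n) - (\<phi> h - y)" by simp
      also have "norm \<dots> \<le> \<epsilon> * t + e / 2 * t"
        using norm_triangle_ineq4[of "\<phi> h - t *\<^sub>R Z n" "\<phi> h - y"] h(3) y(2) by linarith
      also have "\<dots> \<le> e / 2 * t + e / 2 * t" by (intro add_right_mono mult_right_mono[OF \<epsilon>(3)]) (use t in simp)
      also have "\<dots> = t * e" by simp
      finally have "norm (y /\<^sub>R t - Z n) \<le> e" using t by simp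
      then show ?thesis using y by (auto simp: dist_norm)
    qed
    then have "range Z \<subseteq> (\<Union>x\<in>(\<lambda>y. y /\<^sub>R t) ` F \<union> Z ` {..<n0}. cball x e)"
    proof (intro subsetI)
      fix x assume "x \<in> range Z"
      then obtain n where x: "x = Z n" by blast
      show "x \<in> (\<Union>x\<in>(\<lambda>y. y /\<^sub>R t) ` F \<union> Z ` {..<n0}. cball x e)"
      proof (cases "n < n0")
        case True
        then show ?thesis using x e by (intro UN_I[of "Z n"]) auto
      next
        case False
        then show ?thesis using \<open>n \<ge> n0 \<Longrightarrow> \<exists>y\<in>F. Z n \<in> cball (y /\<^sub>R t) e\<close> x by auto
      qed
    qed
    with F(1) show ?thesis by (intro exI[of _ "(\<lambda>y. y /\<^sub>R t) ` F \<union> Z ` {..<n0}"]) auto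
  qed
  have "compact (closure (range Z))"
    unfolding compact_eq_totally_bounded
  proof (intro conjI allI impI)
    show "complete (closure (range Z))" by (simp add: complete_eq_closed)
    fix e :: real assume e: "0 < e"
    then obtain K where K: "finite K" "range Z \<subseteq> (\<Union>x\<in>K. cball x (e / 2))"
      using cover[of "e / 2"] by auto
    have "closure (range Z) \<subseteq> (\<Union>x\<in>K. cball x (e / 2))"
      by (rule closure_minimal[OF K(2)]) (use K(1) in \<open>simp add: closed_UN\<close>)
    also have "\<dots> \<subseteq> (\<Union>x\<in>K. ball x e)" using e by force
    finally show "\<exists>k. finite k \<and> closure (range Z) \<subseteq> (\<Union>x\<in>k. ball x e)" using K(1) by blast
  qed
  moreover have "\<forall>n. Z n \<in> closure (range Z)" using closure_subset[of "range Z"] by (simp add: image_subset_iff)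
  ultimately obtain X \<sigma> where X: "strict_mono (\<sigma> :: nat \<Rightarrow> nat)" "(Z \<circ> \<sigma>) \<longlonglongrightarrow> X"
    unfolding compact_eq_seq_compact_metric by (rule seq_compactE[of _ Z]) auto
  have "X \<in> tangent"
    unfolding tangent_def mem_Collect_eq
  proof (intro allI impI)
    fix \<epsilon> :: real assume "0 < \<epsilon>"
    then have \<epsilon>: "0 < \<epsilon> / 2" by simp
    obtain a where a: "0 < a" and mult: "\<And>g t. g \<in> G \<inter> D \<Longrightarrow> \<phi> g \<noteq> 0 \<Longrightarrow> 0 < t \<Longrightarrow> t < a \<Longrightarrow>
        norm (\<phi> g) \<le> \<epsilon> / 2 / 2 * t \<Longrightarrow> \<exists>h\<in>G \<inter> D. norm (\<phi> h - (t / norm (\<phi> g)) *\<^sub>R \<phi> g) \<le> \<epsilon> / 2 * t"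
      using subgroup_contains_multiples[OF \<epsilon>] by metis
    have "\<exists>h\<in>G \<inter> D. norm (\<phi> h - t *\<^sub>R X) \<le> \<epsilon> * t" if t: "0 < t" "t < a" for t
    proof -
      have "eventually (\<lambda>n. norm (\<phi> (g (\<sigma> n))) \<le> \<epsilon> / 2 / 2 * t) sequentially"
        by (rule eventually_subseq[OF X(1) small]) (use \<epsilon> t in simp)
      moreover have "eventually (\<lambda>n. dist (Z (\<sigma> n)) X < \<epsilon> / 2) sequentially"
        using tendstoD[OF X(2) \<epsilon>] by (simp add: o_def)
      ultimately have "eventually (\<lambda>n. norm (\<phi> (g (\<sigma> n))) \<le> \<epsilon> / 2 / 2 * t \<and> dist (Z (\<sigma> n)) X < \<epsilon> / 2) sequentially"
        by (rule eventually_conj)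
      then obtain n where n: "norm (\<phi> (g (\<sigma> n))) \<le> \<epsilon> / 2 / 2 * t" "dist (Z (\<sigma> n)) X < \<epsilon> / 2"
        using eventually_happens'[OF sequentially_bot] by blast
      obtain h where h: "h \<in> G \<inter> D" "norm (\<phi> h - t *\<^sub>R Z (\<sigma> n)) \<le> \<epsilon> / 2 * t"
        using mult[OF g t n(1)] unfolding tZ by blast
      have "norm (t *\<^sub>R Z (\<sigma> n) - t *\<^sub>R X) = t * dist (Z (\<sigma> n)) X"
        using t by (simp add: dist_norm flip: scaleR_diff_right)
      also have "\<dots> \<le> \<epsilon> / 2 * t" using n(2) t by simp
      finally have 2: "norm (t *\<^sub>R Z (\<sigma> n) - t *\<^sub>R X) \<le> \<epsilon> / 2 * t" .
      have "\<phi> h - t *\<^sub>R X = (\<phi> h - t *\<^sub>R Z (\<sigma> n)) + (t *\<^sub>R Z (\<sigma> n) - t *\<^sub>R X)" by simp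
      also have "norm \<dots> \<le> \<epsilon> / 2 * t + \<epsilon> / 2 * t" by (intro norm_triangle_le add_mono h(2) 2)
      finally show ?thesis using h(1) by (intro bexI[of _ h]) auto
    qed
    then show "\<exists>r>0. \<forall>s. 0 < s \<longrightarrow> s < r \<longrightarrow> (\<exists>g\<in>G \<inter> D. norm (\<phi> g - s *\<^sub>R X) \<le> \<epsilon> * s)"
      using a by blast
  qed
  with X show thesis by (intro that) (auto simp: o_def Z_def)
qed

text \<open>If elements of \<open>G\<close> tending to the identity stayed away from the tangent space, relative to their size,
  then so would an accumulation point of their directions.\<close>

lemma subgroup_approximated_by_tangent:
  assumes \<eta>: "0 < \<eta>"
  shows "\<exists>r>0. \<forall>g\<in>G \<inter> nhd r. \<exists>Y\<in>tangent. norm (\<phi> g - Y) \<le> \<eta> * norm (\<phi> g)"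
proof (rule ccontr)
  assume contra: "\<not> ?thesis"
  have "\<exists>g. g \<in> G \<inter> nhd (inverse (Suc n)) \<and> (\<forall>Y\<in>tangent. \<eta> * norm (\<phi> g) < norm (\<phi> g - Y))" for n
  proof -
    have "0 < inverse (real (Suc n))" by simp
    with contra show ?thesis by (meson not_le)
  qed
  then obtain g where g: "\<And>n. g n \<in> G \<inter> nhd (inverse (Suc n))"
    and far: "\<And>n Y. Y \<in> tangent \<Longrightarrow> \<eta> * norm (\<phi> (g n)) < norm (\<phi> (g n) - Y)"
    by metis
  have gD: "g n \<in> G \<inter> D" for n using g nhd_D by blast
  have ne: "\<phi> (g n) \<noteq> 0" for n using far[OF zero_tangent, of n] by auto
  have lim: "(\<lambda>n. \<phi> (g n)) \<longlonglongrightarrow> 0"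
  proof (rule tendsto_norm_zero_cancel, rule tendsto_sandwich[OF _ _ tendsto_const LIMSEQ_inverse_real_of_nat])
    show "eventually (\<lambda>n. norm (\<phi> (g n)) \<le> inverse (real (Suc n))) sequentially"
      using g nhd_norm by (intro always_eventually allI) (meson IntE less_imp_le)
  qed simp
  obtain X and \<sigma> :: "nat \<Rightarrow> nat" where X: "X \<in> tangent"
    "(\<lambda>n. \<phi> (g (\<sigma> n)) /\<^sub>R norm (\<phi> (g (\<sigma> n)))) \<longlonglongrightarrow> X"
    using directions_accumulate[OF gD ne lim] by metis
  from tendstoD[OF X(2) \<eta>] obtain n where
    n: "dist (\<phi> (g (\<sigma> n)) /\<^sub>R norm (\<phi> (g (\<sigma> n)))) X < \<eta>"
    using eventually_happens'[OF sequentially_bot] by blast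
  define s where "s = norm (\<phi> (g (\<sigma> n)))"
  have s: "0 < s" using ne by (simp add: s_def)
  have "\<phi> (g (\<sigma> n)) - s *\<^sub>R X = s *\<^sub>R (\<phi> (g (\<sigma> n)) /\<^sub>R s - X)"
    using s by (simp add: scaleR_diff_right)
  then have "norm (\<phi> (g (\<sigma> n)) - s *\<^sub>R X) = s * norm (\<phi> (g (\<sigma> n)) /\<^sub>R s - X)" using s by simp
  also have "\<dots> \<le> s * \<eta>" using n s by (simp add: s_def dist_norm)
  finally have "norm (\<phi> (g (\<sigma> n)) - s *\<^sub>R X) \<le> \<eta> * norm (\<phi> (g (\<sigma> n)))" by (simp add: s_def mult.commute)
  with far[OF subspace_scale[OF subspace_tangent X(1)], of "\<sigma> n" s] show False by simp
qed

end

section \<open>Conjugation towards the compact subgroup\<close>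

context charted_group_with_compact_subgroup
begin

text \<open>The norm of the quotient of the model space by the tangent space, pulled back to the model space.
  This quotient plays the part of the tangent space of the space of cosets of \<open>G\<close>.\<close>

definition normal_size :: "'c \<Rightarrow> real" where
  "normal_size x = infdist x tangent"

lemma seminorm_normal_size: "seminorm normal_size"
  unfolding normal_size_def[abs_def] by (rule seminorm_infdist_subspace[OF subspace_tangent])

sublocale ns: seminorm normal_size
  by (rule seminorm_normal_size)

lemma normal_size_le: "Y \<in> tangent \<Longrightarrow> norm (x - Y) \<le> a \<Longrightarrow> normal_size x \<le> a"
  unfolding normal_size_def using infdist_le[of Y tangent x] by (simp add: dist_norm)

lemma normal_size_le_norm: "norm x \<le> a \<Longrightarrow> normal_size x \<le> a"
  using normal_size_le[OF zero_tangent] by simp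

text \<open>The factor \<open>\<gamma> = w\<^sup>-\<^sup>1 v v'\<close> is a small element of \<open>G\<close>, so its coordinate, which is about
  \<open>\<phi> v + \<phi> v' - \<phi> w\<close>, is nearly tangent to \<open>G\<close>.\<close>

lemma normal_size_cocycle:
  assumes \<eta>: "0 < \<eta>"
  obtains r where "0 < r"
    and "\<And>v v' w \<gamma>. \<lbrakk>v \<in> nhd r; v' \<in> nhd r; w \<in> nhd r; \<gamma> \<in> G; v \<otimes> v' = w \<otimes> \<gamma>\<rbrakk> \<Longrightarrow>
      normal_size (\<phi> v + \<phi> v' - \<phi> w) \<le> \<eta> * (norm (\<phi> v) + norm (\<phi> v') + norm (\<phi> w))"
proof -
  define \<eta>' where "\<eta>' = min 1 (\<eta> / 5)"
  have \<eta>': "0 < \<eta>'" "\<eta>' \<le> 1" "5 * \<eta>' \<le> \<eta>" using \<eta> by (auto simp: \<eta>'_def)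
  obtain a where a: "0 < a"
    and mD: "\<And>u v. u \<in> nhd a \<Longrightarrow> v \<in> nhd a \<Longrightarrow> u \<otimes> v \<in> D"
    and ml: "\<And>u v. u \<in> nhd a \<Longrightarrow> v \<in> nhd a \<Longrightarrow> norm (\<phi> (u \<otimes> v) - \<phi> u - \<phi> v) \<le> \<eta>' * norm (\<phi> u)"
    using mult_nhd[OF \<eta>'(1)] by metis
  obtain b where b: "0 < b" and iD: "\<And>u. u \<in> nhd b \<Longrightarrow> inv u \<in> D"
    and i: "\<And>u. u \<in> nhd b \<Longrightarrow> norm (\<phi> (inv u) + \<phi> u) \<le> \<eta>' * norm (\<phi> u)"
    using inv_nhd[OF \<eta>'(1)] by metis
  obtain c where c: "0 < c" and tan: "\<And>g. g \<in> G \<inter> nhd c \<Longrightarrow> \<exists>Y\<in>tangent. norm (\<phi> g - Y) \<le> \<eta>' * norm (\<phi> g)"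
    using subgroup_approximated_by_tangent[OF \<eta>'(1)] by blast
  define r where "r = min b (min a c / 12)"
  have r: "0 < r" "r \<le> b" "12 * r \<le> a" "12 * r \<le> c" using a b c by (auto simp: r_def)
  have le1: "\<eta>' * t \<le> t" if "0 \<le> t" for t
    using mult_right_mono[OF \<eta>'(2) that] by simp
  show thesis
  proof (rule that[OF r(1)])
    fix v v' w \<gamma>
    assume v: "v \<in> nhd r" and v': "v' \<in> nhd r" and w: "w \<in> nhd r" and \<gamma>: "\<gamma> \<in> G" and eq: "v \<otimes> v' = w \<otimes> \<gamma>"
    note car = nhd_carrier[OF v] nhd_carrier[OF v'] nhd_carrier[OF w] G_carrier[OF \<gamma>]
    note lt = nhd_norm[OF v] nhd_norm[OF v'] nhd_norm[OF w]
    define S where "S = norm (\<phi> v) + norm (\<phi> v') + norm (\<phi> w)"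
    have S: "4 * S < 12 * r" using lt by (simp add: S_def)
    have ina: "v \<in> nhd a" "v' \<in> nhd a" "w \<in> nhd a" and inb: "w \<in> nhd b"
      using v v' w r nhd_mono[of r a] nhd_mono[of r b] by auto
    have 1: "norm (\<phi> (v \<otimes> v') - \<phi> v - \<phi> v') \<le> \<eta>' * norm (\<phi> v)" by (rule ml[OF ina(1,2)])
    have "norm (\<phi> (v \<otimes> v')) \<le> norm (\<phi> v + \<phi> v') + norm (\<phi> (v \<otimes> v') - (\<phi> v + \<phi> v'))"
      by (rule norm_triangle_sub)
    also have "\<dots> \<le> norm (\<phi> v) + norm (\<phi> v') + norm (\<phi> v)"
      by (intro add_mono norm_triangle_ineq) (use 1 le1[of "norm (\<phi> v)"] in \<open>simp add: diff_diff_eq\<close>)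
    finally have n1: "norm (\<phi> (v \<otimes> v')) \<le> 2 * norm (\<phi> v) + norm (\<phi> v')" by simp
    have "norm (\<phi> (inv w)) \<le> norm (\<phi> w) + norm (\<phi> (inv w) + \<phi> w)"
      using norm_triangle_ineq4[of "\<phi> (inv w) + \<phi> w" "\<phi> w"] by simp
    then have n2: "norm (\<phi> (inv w)) \<le> 2 * norm (\<phi> w)"
      using i[OF inb] le1[of "norm (\<phi> w)"] by simp
    have in2: "inv w \<in> nhd a" "v \<otimes> v' \<in> nhd a"
      using iD[OF inb] n2 mD[OF ina(1,2)] n1 lt r by (auto simp: nhd_def)
    have \<gamma>eq: "inv w \<otimes> (v \<otimes> v') = \<gamma>" unfolding eq using car by (simp add: inv_mult_cancel)
    have \<gamma>D: "\<gamma> \<in> D" using mD[OF in2] \<gamma>eq by simp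
    have 2: "norm (\<phi> \<gamma> - \<phi> (inv w) - \<phi> (v \<otimes> v')) \<le> \<eta>' * norm (\<phi> (inv w))"
      using ml[OF in2] \<gamma>eq by simp
    have "norm (\<phi> \<gamma>) \<le> norm (\<phi> (inv w) + \<phi> (v \<otimes> v')) + norm (\<phi> \<gamma> - (\<phi> (inv w) + \<phi> (v \<otimes> v')))"
      by (rule norm_triangle_sub)
    also have "\<dots> \<le> norm (\<phi> (inv w)) + norm (\<phi> (v \<otimes> v')) + norm (\<phi> (inv w))"
      by (intro add_mono norm_triangle_ineq) (use 2 le1[of "norm (\<phi> (inv w))"] in \<open>simp add: diff_diff_eq\<close>)
    also have "\<dots> \<le> 4 * S"
    proof -
      have "norm (\<phi> (inv w)) + norm (\<phi> (v \<otimes> v')) + norm (\<phi> (inv w)) \<le>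
          2 * norm (\<phi> w) + (2 * norm (\<phi> v) + norm (\<phi> v')) + 2 * norm (\<phi> w)"
        by (intro add_mono n1 n2)
      then show ?thesis unfolding S_def using norm_ge_zero[of "\<phi> v"] norm_ge_zero[of "\<phi> v'"] by argo
    qed
    finally have n\<gamma>: "norm (\<phi> \<gamma>) \<le> 4 * S" .
    then have "\<gamma> \<in> nhd a" "\<gamma> \<in> nhd c" using \<gamma>D S r by (auto simp: nhd_def)
    then obtain Y where Y: "Y \<in> tangent" "norm (\<phi> \<gamma> - Y) \<le> \<eta>' * norm (\<phi> \<gamma>)" using tan \<gamma> by blast
    have "\<eta>' * norm (\<phi> \<gamma>) \<le> \<eta>' * (4 * S)" by (rule mult_left_mono[OF n\<gamma>]) (use \<eta>' in simp)
    with Y have p\<gamma>: "normal_size (\<phi> \<gamma>) \<le> \<eta>' * (4 * S)" by (intro normal_size_le[of Y]) auto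
    have 3: "norm (\<phi> (w \<otimes> \<gamma>) - \<phi> w - \<phi> \<gamma>) \<le> \<eta>' * norm (\<phi> w)"
      by (rule ml[OF ina(3) \<open>\<gamma> \<in> nhd a\<close>])
    have "\<phi> v + \<phi> v' - \<phi> w =
        (\<phi> \<gamma> - (\<phi> (v \<otimes> v') - \<phi> v - \<phi> v')) + (\<phi> (w \<otimes> \<gamma>) - \<phi> w - \<phi> \<gamma>)" by (simp add: eq)
    also have "normal_size \<dots> \<le> (\<eta>' * (4 * S) + \<eta>' * norm (\<phi> v)) + \<eta>' * norm (\<phi> w)"
      by (intro ns.triangle_le ns.triangle_le_diff p\<gamma> normal_size_le_norm 1 3)
    also have "\<dots> = \<eta>' * (4 * S + norm (\<phi> v) + norm (\<phi> w))" by (simp add: algebra_simps)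
    also have "\<dots> \<le> \<eta>' * (5 * S)" by (rule mult_left_mono) (use \<eta>' in \<open>auto simp: S_def\<close>)
    also have "\<dots> = (5 * \<eta>') * S" by simp
    also have "\<dots> \<le> \<eta> * S" by (rule mult_right_mono[OF \<eta>'(3)]) (simp add: S_def)
    finally show "normal_size (\<phi> v + \<phi> v' - \<phi> w) \<le> \<eta> * (norm (\<phi> v) + norm (\<phi> v') + norm (\<phi> w))"
      by (simp add: S_def)
  qed
qed

text \<open>Approximate \<open>\<phi> z\<close> by a tangent vector, and that by the coordinate of some \<open>\<gamma> \<in> G\<close>; then
  \<open>z \<gamma>\<^sup>-\<^sup>1\<close> has about the size of the normal part of \<open>\<phi> z\<close>.\<close>

lemma strip_tangential_part:
  assumes \<eta>: "0 < \<eta>"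
  obtains r where "0 < r"
    and "\<And>z. z \<in> nhd r \<Longrightarrow> \<exists>\<gamma>\<in>G. z \<otimes> inv \<gamma> \<in> D \<and>
      norm (\<phi> (z \<otimes> inv \<gamma>)) \<le> 2 * normal_size (\<phi> z) + \<eta> * norm (\<phi> z)"
proof -
  define \<eta>' where "\<eta>' = min (1/2) (\<eta> / 8)"
  have \<eta>': "0 < \<eta>'" "\<eta>' \<le> 1/2" "8 * \<eta>' \<le> \<eta>" using \<eta> by (auto simp: \<eta>'_def)
  have half: "\<eta>' * t \<le> t / 2" if "0 \<le> t" for t
    using mult_right_mono[OF \<eta>'(2) that] by simp
  obtain a where a: "0 < a"
    and mD: "\<And>u v. u \<in> nhd a \<Longrightarrow> v \<in> nhd a \<Longrightarrow> u \<otimes> v \<in> D"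
    and ml: "\<And>u v. u \<in> nhd a \<Longrightarrow> v \<in> nhd a \<Longrightarrow> norm (\<phi> (u \<otimes> v) - \<phi> u - \<phi> v) \<le> \<eta>' * norm (\<phi> u)"
    using mult_nhd[OF \<eta>'(1)] by metis
  obtain b where b: "0 < b" and iD: "\<And>u. u \<in> nhd b \<Longrightarrow> inv u \<in> D"
    and i: "\<And>u. u \<in> nhd b \<Longrightarrow> norm (\<phi> (inv u) + \<phi> u) \<le> \<eta>' * norm (\<phi> u)"
    using inv_nhd[OF \<eta>'(1)] by metis
  obtain c where c: "0 < c"
    and sub: "\<And>Y. Y \<in> tangent \<Longrightarrow> norm Y < c \<Longrightarrow> \<exists>g\<in>G \<inter> D. norm (\<phi> g - Y) \<le> \<eta>' * norm Y"
    using tangent_approximates_subgroup[OF \<eta>'(1)] by metis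
  define r where "r = min (a / 14) (min (b / 6) (c / 3))"
  have r: "0 < r" "14 * r \<le> a" "6 * r \<le> b" "3 * r \<le> c" using a b c by (auto simp: r_def)
  show thesis
  proof (rule that[OF r(1)])
    fix z assume z: "z \<in> nhd r"
    define N where "N = norm (\<phi> z)"
    define P where "P = normal_size (\<phi> z)"
    have N: "N < r" "0 \<le> N" using nhd_norm[OF z] by (simp_all add: N_def)
    have P: "P \<le> N" unfolding P_def N_def by (rule normal_size_le_norm) simp
    obtain Y where Y: "Y \<in> tangent" "norm (\<phi> z - Y) \<le> P + \<eta>' * N"
    proof (cases "\<phi> z = 0")
      case True
      then show thesis using that[OF zero_tangent] by (simp add: P_def N_def)
    next
      case False
      then have "0 < \<eta>' * N" using \<eta>' by (simp add: N_def)
      then obtain Y where "Y \<in> tangent" "dist (\<phi> z) Y < infdist (\<phi> z) tangent + \<eta>' * N"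
        using infdist_approx[of tangent "\<eta>' * N" "\<phi> z"] zero_tangent by blast
      then show thesis using that[of Y] by (simp add: P_def normal_size_def dist_norm)
    qed
    have "norm Y \<le> norm (\<phi> z) + norm (Y - \<phi> z)" by (rule norm_triangle_sub)
    then have nY: "norm Y \<le> 3 * N"
      using Y(2) P half[of N] N norm_minus_commute[of Y "\<phi> z"] unfolding N_def by linarith
    then obtain \<gamma> where \<gamma>: "\<gamma> \<in> G" "\<gamma> \<in> D" "norm (\<phi> \<gamma> - Y) \<le> \<eta>' * norm Y"
      using sub[OF Y(1)] N r by auto
    have "\<eta>' * norm Y \<le> \<eta>' * (3 * N)" by (rule mult_left_mono[OF nY]) (use \<eta>' in simp)
    then have \<gamma>Y: "norm (\<phi> \<gamma> - Y) \<le> 3 * (\<eta>' * N)" using \<gamma>(3) by simp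
    have "norm (\<phi> \<gamma>) \<le> norm Y + norm (\<phi> \<gamma> - Y)" by (rule norm_triangle_sub)
    then have n\<gamma>: "norm (\<phi> \<gamma>) \<le> 6 * N" using nY \<gamma>Y half[of N] N by simp
    have \<gamma>in: "\<gamma> \<in> nhd a" "\<gamma> \<in> nhd b" using \<gamma> n\<gamma> N r by (auto simp: nhd_def)
    have "norm (\<phi> (inv \<gamma>)) \<le> norm (\<phi> \<gamma>) + norm (\<phi> (inv \<gamma>) + \<phi> \<gamma>)"
      using norm_triangle_ineq4[of "\<phi> (inv \<gamma>) + \<phi> \<gamma>" "\<phi> \<gamma>"] by simp
    then have ni: "norm (\<phi> (inv \<gamma>)) \<le> 12 * N"
      using i[OF \<gamma>in(2)] half[of "norm (\<phi> \<gamma>)"] n\<gamma> N norm_ge_zero[of "\<phi> \<gamma>"] by linarith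
    have in2: "z \<in> nhd a" "inv \<gamma> \<in> nhd a"
      using z iD[OF \<gamma>in(2)] ni N r by (auto simp: nhd_def)
    define q where "q = z \<otimes> inv \<gamma>"
    have qD: "q \<in> D" unfolding q_def by (rule mD[OF in2])
    have "norm (\<phi> q - \<phi> z - \<phi> (inv \<gamma>)) \<le> \<eta>' * norm (\<phi> z)" unfolding q_def by (rule ml[OF in2])
    moreover have "norm (\<phi> q) \<le> norm (\<phi> z + \<phi> (inv \<gamma>)) + norm (\<phi> q - (\<phi> z + \<phi> (inv \<gamma>)))"
      by (rule norm_triangle_sub)
    ultimately have "norm (\<phi> q) \<le> N + 12 * N + \<eta>' * N"
      using norm_triangle_ineq[of "\<phi> z" "\<phi> (inv \<gamma>)"] ni by (simp add: N_def diff_diff_eq)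
    then have qa: "q \<in> nhd a" using qD half[of N] N r by (auto simp: nhd_def)
    have q\<gamma>: "q \<otimes> \<gamma> = z"
      using nhd_carrier[OF z] G_carrier[OF \<gamma>(1)] by (simp add: q_def m_assoc)
    have "norm (\<phi> z - \<phi> q - \<phi> \<gamma>) \<le> \<eta>' * norm (\<phi> q)" using ml[OF qa \<gamma>in(1)] q\<gamma> by simp
    also have "\<dots> \<le> norm (\<phi> q) / 2" by (rule half) simp
    finally have 1: "norm (\<phi> z - \<phi> q - \<phi> \<gamma>) \<le> norm (\<phi> q) / 2" .
    have "\<phi> q = ((\<phi> z - Y) - (\<phi> \<gamma> - Y)) - (\<phi> z - \<phi> q - \<phi> \<gamma>)" by simp
    also have "norm \<dots> \<le> norm (\<phi> z - Y) + norm (\<phi> \<gamma> - Y) + norm (\<phi> z - \<phi> q - \<phi> \<gamma>)"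
      by (intro order_trans[OF norm_triangle_ineq4] add_mono norm_triangle_ineq4 order_refl)
    finally have "norm (\<phi> q) \<le> norm (\<phi> z - Y) + norm (\<phi> \<gamma> - Y) + norm (\<phi> z - \<phi> q - \<phi> \<gamma>)" .
    then have "norm (\<phi> q) \<le> 2 * P + 8 * \<eta>' * N" using 1 Y(2) \<gamma>Y by simp
    also have "\<dots> \<le> 2 * P + \<eta> * N" using mult_right_mono[OF \<eta>'(3) N(2)] by simp
    finally show "\<exists>\<gamma>\<in>G. z \<otimes> inv \<gamma> \<in> D \<and>
        norm (\<phi> (z \<otimes> inv \<gamma>)) \<le> 2 * normal_size (\<phi> z) + \<eta> * norm (\<phi> z)"
      using \<gamma>(1) qD by (auto simp: q_def P_def N_def)
  qed
qed

end

context charted_group_with_compact_subgroup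
begin

definition near_G :: "'a set \<Rightarrow> real \<Rightarrow> bool" where
  "near_G K \<delta> \<longleftrightarrow> (\<forall>k\<in>K. \<exists>g\<in>G. k \<otimes> inv g \<in> D \<and> norm (\<phi> (k \<otimes> inv g)) \<le> \<delta>)"

text \<open>The Newton step.  The coordinates \<open>x\<close> of the deviation of \<open>K\<close> from \<open>G\<close> form an approximate
  cocycle modulo the tangent space; the conjugator \<open>w\<close> has the mean of \<open>x\<close> as its coordinate.\<close>

lemma halve_defect:
  obtains \<delta>0 where "0 < \<delta>0"
    and "\<And>K \<delta>. \<lbrakk>subgroup K U; compactin T K; 0 < \<delta>; \<delta> \<le> \<delta>0; near_G K \<delta>\<rbrakk> \<Longrightarrow>
      \<exists>w\<in>D. norm (\<phi> w) \<le> \<delta> \<and> near_G ((\<lambda>k. inv w \<otimes> k \<otimes> w) ` K) (\<delta> / 2)"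
proof -
  obtain rM M0 where rM: "0 < rM" "0 \<le> M0"
    and conjD: "\<And>g u. g \<in> G \<Longrightarrow> u \<in> nhd rM \<Longrightarrow> g \<otimes> u \<otimes> inv g \<in> D"
    and conjM: "\<And>g. g \<in> G \<Longrightarrow> \<exists>L. bounded_linear L \<and> (\<forall>x. norm (L x) \<le> M0 * norm x) \<and>
      (\<forall>u\<in>nhd rM. norm (\<phi> (g \<otimes> u \<otimes> inv g) - L (\<phi> u)) \<le> 1 * norm (\<phi> u))"
    using conj_uniform_derivative[OF compact_G, of 1] by (metis zero_less_one)
  define M where "M = M0 + 1"
  have M: "1 \<le> M" using rM by (simp add: M_def)
  have conj_bound: "norm (\<phi> (g \<otimes> u \<otimes> inv g)) \<le> M * norm (\<phi> u)" if g: "g \<in> G" and u: "u \<in> nhd rM" for g u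
  proof -
    obtain L where "norm (L (\<phi> u)) \<le> M0 * norm (\<phi> u)"
      "norm (\<phi> (g \<otimes> u \<otimes> inv g) - L (\<phi> u)) \<le> 1 * norm (\<phi> u)"
      using conjM[OF g] u by blast
    then show ?thesis
      using norm_triangle_sub[of "\<phi> (g \<otimes> u \<otimes> inv g)" "L (\<phi> u)"] by (simp add: M_def algebra_simps)
  qed
  \<comment> \<open>In units of \<open>\<delta>/100\<close>, the normal part of the new deviation is at most \<open>21\<close>; stripping the tangential
  part yields \<open>2 * 21 + 7 = 49\<close>, which is below \<open>50\<close>.\<close>
  define \<eta> where "\<eta> = 1 / (100 * M)"
  have \<eta>: "0 < \<eta>" "\<eta> \<le> 1 / 100" "M * \<eta> = 1 / 100" using M by (simp_all add: \<eta>_def field_simps)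
  have le1: "\<eta> * t \<le> t" if "0 \<le> t" for t
    using mult_right_mono[OF _ that, of \<eta> 1] \<eta> by simp
  obtain r1 where r1: "0 < r1"
    and mD: "\<And>u v. u \<in> nhd r1 \<Longrightarrow> v \<in> nhd r1 \<Longrightarrow> u \<otimes> v \<in> D"
    and ml: "\<And>u v. u \<in> nhd r1 \<Longrightarrow> v \<in> nhd r1 \<Longrightarrow> norm (\<phi> (u \<otimes> v) - \<phi> u - \<phi> v) \<le> \<eta> * norm (\<phi> u)"
    using mult_nhd[OF \<eta>(1)] by metis
  obtain r2 where r2: "0 < r2" and iD: "\<And>u. u \<in> nhd r2 \<Longrightarrow> inv u \<in> D"
    and i: "\<And>u. u \<in> nhd r2 \<Longrightarrow> norm (\<phi> (inv u) + \<phi> u) \<le> \<eta> * norm (\<phi> u)"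
    using inv_nhd[OF \<eta>(1)] by metis
  obtain r3 where r3: "0 < r3"
    and conjL: "\<And>g. g \<in> G \<Longrightarrow> \<exists>L. bounded_linear L \<and>
      (\<forall>u\<in>nhd r3. norm (\<phi> (g \<otimes> u \<otimes> inv g) - L (\<phi> u)) \<le> \<eta> * norm (\<phi> u))"
    using conj_uniform_derivative[OF compact_G \<eta>(1)] by metis
  obtain r4 where r4: "0 < r4"
    and cocycle: "\<And>v v' w \<gamma>. \<lbrakk>v \<in> nhd r4; v' \<in> nhd r4; w \<in> nhd r4; \<gamma> \<in> G; v \<otimes> v' = w \<otimes> \<gamma>\<rbrakk> \<Longrightarrow>
      normal_size (\<phi> v + \<phi> v' - \<phi> w) \<le> \<eta> * (norm (\<phi> v) + norm (\<phi> v') + norm (\<phi> w))"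
    using normal_size_cocycle[OF \<eta>(1)] by metis
  obtain r5 where r5: "0 < r5"
    and strip: "\<And>z. z \<in> nhd r5 \<Longrightarrow> \<exists>\<gamma>\<in>G. z \<otimes> inv \<gamma> \<in> D \<and>
      norm (\<phi> (z \<otimes> inv \<gamma>)) \<le> 2 * normal_size (\<phi> z) + \<eta> * norm (\<phi> z)"
    using strip_tangential_part[OF \<eta>(1)] by metis
  obtain r6 where r6: "0 < r6" and onto: "\<And>x. norm x < r6 \<Longrightarrow> x \<in> \<phi> ` D"
    using chart_onto by blast
  define R where "R = {rM, r1, r2, r3, r4, r5, r6}"
  define r where "r = Min R"
  have R: "finite R" "R \<noteq> {}" by (simp_all add: R_def)
  have "0 < r"
    unfolding r_def Min_gr_iff[OF R] using rM r1 r2 r3 r4 r5 r6 by (simp add: R_def)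
  moreover have "r \<le> s" if "s \<in> R" for s
    unfolding r_def by (rule Min_le[OF R(1) that])
  ultimately have r: "0 < r" "r \<le> rM" "r \<le> r1" "r \<le> r2" "r \<le> r3" "r \<le> r4" "r \<le> r5" "r \<le> r6"
    by (simp_all add: R_def)
  note sub = nhd_mono[OF r(2), THEN subsetD] nhd_mono[OF r(3), THEN subsetD] nhd_mono[OF r(4), THEN subsetD]
    nhd_mono[OF r(5), THEN subsetD] nhd_mono[OF r(6), THEN subsetD] nhd_mono[OF r(7), THEN subsetD]
  show thesis
  proof (rule that[of "r / (8 * M)"])
    show "0 < r / (8 * M)" using r M by simp
    fix K \<delta>
    assume K: "subgroup K U" and cK: "compactin T K" and \<delta>: "0 < \<delta>" "\<delta> \<le> r / (8 * M)" and cl: "near_G K \<delta>"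
    have KU: "\<And>k. k \<in> K \<Longrightarrow> k \<in> carrier U" using subgroup.subset[OF K] by blast
    have Km: "\<And>k h. k \<in> K \<Longrightarrow> h \<in> K \<Longrightarrow> k \<otimes> h \<in> K" by (rule subgroup.m_closed[OF K])
    note Gm = subgroup.m_closed[OF subgroup_G] and Gi = subgroup.m_inv_closed[OF subgroup_G]
    have Mr: "8 * (M * \<delta>) \<le> r" using \<delta>(2) M by (simp add: field_simps)
    have \<delta>M: "\<delta> \<le> M * \<delta>" using M \<delta> by simp
    have \<delta>r: "8 * \<delta> \<le> r" using Mr \<delta>M by simp
    have Mlt: "M * \<delta> < r" "3 * (M * \<delta>) < r" "7 * (M * \<delta>) < r"
      using Mr \<delta>M \<delta>(1) by linarith+
    have \<eta>\<delta>: "0 < \<eta> * \<delta>" "\<eta> * \<delta> \<le> \<delta>" using \<eta> \<delta> le1[of \<delta>] by auto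
    have \<eta>\<delta>r: "\<eta> * \<delta> < r" using \<eta>\<delta>(2) \<delta>r \<delta>(1) by linarith
    \<comment> \<open>The decomposition \<open>k = v k \<otimes> g k\<close>.\<close>
    obtain g where g: "\<And>k. k \<in> K \<Longrightarrow> g k \<in> G" and gD: "\<And>k. k \<in> K \<Longrightarrow> k \<otimes> inv (g k) \<in> D"
      and g\<delta>: "\<And>k. k \<in> K \<Longrightarrow> norm (\<phi> (k \<otimes> inv (g k))) \<le> \<delta>"
      using cl unfolding near_G_def by metis
    define v where "v k = k \<otimes> inv (g k)" for k
    define x where "x k = \<phi> (v k)" for k
    have gU: "\<And>k. k \<in> K \<Longrightarrow> g k \<in> carrier U" using g G_carrier by blast
    have nx: "norm (x k) \<le> \<delta>" if "k \<in> K" for k using g\<delta>[OF that] by (simp add: x_def v_def)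
    have v: "v k \<in> nhd r" if "k \<in> K" for k
      using gD[OF that] g\<delta>[OF that] \<delta> \<delta>r by (simp add: v_def nhd_def)
    have "\<forall>k\<in>K. \<exists>L. bounded_linear L \<and>
        (\<forall>u\<in>nhd r. norm (\<phi> (g k \<otimes> u \<otimes> inv (g k)) - L (\<phi> u)) \<le> \<eta> * norm (\<phi> u))"
      using conjL g sub by meson
    then obtain L where bl: "\<And>k. k \<in> K \<Longrightarrow> bounded_linear (L k)"
      and L: "\<And>k u. k \<in> K \<Longrightarrow> u \<in> nhd r \<Longrightarrow>
        norm (\<phi> (g k \<otimes> u \<otimes> inv (g k)) - L k (\<phi> u)) \<le> \<eta> * norm (\<phi> u)"
      by metis
    have small_conj: "g k \<otimes> u \<otimes> inv (g k) \<in> nhd r \<and> norm (\<phi> (g k \<otimes> u \<otimes> inv (g k))) \<le> M * \<delta> \<and>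
        norm (\<phi> (g k \<otimes> u \<otimes> inv (g k)) - L k (\<phi> u)) \<le> \<eta> * \<delta>"
      if k: "k \<in> K" and u: "u \<in> D" "norm (\<phi> u) \<le> \<delta>" for k u
    proof -
      have ur: "u \<in> nhd r" using u \<delta> \<delta>r by (simp add: nhd_def)
      have 1: "norm (\<phi> (g k \<otimes> u \<otimes> inv (g k))) \<le> M * norm (\<phi> u)"
        by (rule conj_bound[OF g[OF k] sub(1)[OF ur]])
      also have "\<dots> \<le> M * \<delta>" by (rule mult_left_mono[OF u(2)]) (use M in simp)
      finally have 1: "norm (\<phi> (g k \<otimes> u \<otimes> inv (g k))) \<le> M * \<delta>" .
      have "norm (\<phi> (g k \<otimes> u \<otimes> inv (g k)) - L k (\<phi> u)) \<le> \<eta> * norm (\<phi> u)" by (rule L[OF k ur])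
      also have "\<dots> \<le> \<eta> * \<delta>" by (rule mult_left_mono[OF u(2)]) (use \<eta> in simp)
      finally show ?thesis using 1 conjD[OF g[OF k] sub(1)[OF ur]] Mlt by (simp add: nhd_def)
    qed
    have M\<delta>: "\<eta> * (M * \<delta>) = \<delta> / 100" using \<eta>(3) by (metis mult.assoc mult.commute mult.left_neutral times_divide_eq_left)
    have \<eta>\<delta>M: "\<eta> * \<delta> \<le> \<delta> / 100" using mult_left_mono[OF \<delta>M, of \<eta>] \<eta> M\<delta> by simp
    define e where "e = 4 * (\<delta> / 100)"
    \<comment> \<open>Compare \<open>k h = v\<^sub>k (g\<^sub>k v\<^sub>h g\<^sub>k\<^sup>-\<^sup>1) g\<^sub>k g\<^sub>h\<close> with \<open>k h = v\<^sub>k\<^sub>h g\<^sub>k\<^sub>h\<close>.\<close>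
    have cyc: "normal_size (x k + L k (x h) - x (k \<otimes> h)) \<le> e" if k: "k \<in> K" and h: "h \<in> K" for k h
    proof -
      define v' where "v' = g k \<otimes> v h \<otimes> inv (g k)"
      have v': "v' \<in> nhd r" "norm (\<phi> v') \<le> M * \<delta>" "norm (\<phi> v' - L k (x h)) \<le> \<eta> * \<delta>"
        using small_conj[OF k nhd_D[OF v[OF h]]] nx[OF h] by (simp_all add: v'_def x_def)
      define \<gamma> where "\<gamma> = g (k \<otimes> h) \<otimes> inv (g k \<otimes> g h)"
      have \<gamma>: "\<gamma> \<in> G" unfolding \<gamma>_def by (intro Gm Gi g Km k h)
      have "v k \<otimes> v' = v (k \<otimes> h) \<otimes> \<gamma>"
        using KU[OF k] KU[OF h] gU[OF k] gU[OF h] gU[OF Km[OF k h]]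
        by (simp add: v_def v'_def \<gamma>_def group_normalize)
      from cocycle[OF sub(5)[OF v[OF k]] sub(5)[OF v'(1)] sub(5)[OF v[OF Km[OF k h]]] \<gamma> this]
      have "normal_size (x k + \<phi> v' - x (k \<otimes> h)) \<le> \<eta> * (norm (x k) + norm (\<phi> v') + norm (x (k \<otimes> h)))"
        by (simp add: x_def)
      also have "\<dots> \<le> \<eta> * (M * \<delta> + M * \<delta> + M * \<delta>)"
        by (intro mult_left_mono add_mono v'(2) order_trans[OF nx \<delta>M] k Km h) (use \<eta> in simp)
      also have "\<dots> = 3 * (\<delta> / 100)" using M\<delta> by (simp add: algebra_simps)
      finally have 1: "normal_size (x k + \<phi> v' - x (k \<otimes> h)) \<le> 3 * (\<delta> / 100)" .
      have "normal_size ((x k + \<phi> v' - x (k \<otimes> h)) - (\<phi> v' - L k (x h))) \<le> 3 * (\<delta> / 100) + \<delta> / 100"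
        by (rule ns.triangle_le_diff[OF 1 normal_size_le_norm]) (use v'(3) \<eta>\<delta>M in linarith)
      also have "(x k + \<phi> v' - x (k \<otimes> h)) - (\<phi> v' - L k (x h)) = x k + L k (x h) - x (k \<otimes> h)" by simp
      finally show ?thesis by (simp add: e_def)
    qed
    \<comment> \<open>The choice of \<open>g\<close> need not be continuous, but jumps of \<open>x\<close> are nearly tangential.\<close>
    have near: "normal_size (x (\<kappa> \<otimes> h) - x h) \<le> e" if \<kappa>: "\<kappa> \<in> nhd (\<eta> * \<delta>) \<inter> K" and h: "h \<in> K" for \<kappa> h
    proof -
      have \<kappa>K: "\<kappa> \<in> K" and n\<kappa>: "norm (\<phi> \<kappa>) \<le> \<eta> * \<delta>" and \<kappa>r: "\<kappa> \<in> nhd r"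
        using \<kappa> \<eta>\<delta>r by (auto simp: nhd_def)
      define \<gamma> where "\<gamma> = g (\<kappa> \<otimes> h) \<otimes> inv (g h)"
      have \<gamma>: "\<gamma> \<in> G" unfolding \<gamma>_def by (intro Gm Gi g Km \<kappa>K h)
      have "\<kappa> \<otimes> v h = v (\<kappa> \<otimes> h) \<otimes> \<gamma>"
        using KU[OF \<kappa>K] KU[OF h] gU[OF h] gU[OF Km[OF \<kappa>K h]]
        by (simp add: v_def \<gamma>_def group_normalize)
      from cocycle[OF sub(5)[OF \<kappa>r] sub(5)[OF v[OF h]] sub(5)[OF v[OF Km[OF \<kappa>K h]]] \<gamma> this]
      have "normal_size (\<phi> \<kappa> + x h - x (\<kappa> \<otimes> h)) \<le> \<eta> * (norm (\<phi> \<kappa>) + norm (x h) + norm (x (\<kappa> \<otimes> h)))"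
        by (simp add: x_def)
      also have "\<dots> \<le> \<eta> * (\<delta> + \<delta> + \<delta>)"
        by (intro mult_left_mono add_mono order_trans[OF n\<kappa> \<eta>\<delta>(2)] nx Km \<kappa>K h) (use \<eta> in simp)
      also have "\<dots> \<le> 3 * (\<delta> / 100)" using \<eta>\<delta>M by (simp only: distrib_left)
      finally have 1: "normal_size (\<phi> \<kappa> + x h - x (\<kappa> \<otimes> h)) \<le> 3 * (\<delta> / 100)" .
      have "normal_size (\<phi> \<kappa> - (\<phi> \<kappa> + x h - x (\<kappa> \<otimes> h))) \<le> \<delta> / 100 + 3 * (\<delta> / 100)"
        by (rule ns.triangle_le_diff[OF normal_size_le_norm 1]) (use n\<kappa> \<eta>\<delta>M in linarith)
      also have "\<phi> \<kappa> - (\<phi> \<kappa> + x h - x (\<kappa> \<otimes> h)) = x (\<kappa> \<otimes> h) - x h" by simp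
      finally show ?thesis by (simp add: e_def)
    qed
    obtain C where C: "finite C" "C \<subseteq> K" and cover: "\<And>y. y \<in> K \<Longrightarrow> \<exists>c\<in>C. y \<otimes> inv c \<in> nhd (\<eta> * \<delta>)"
      using finite_net[OF cK \<eta>\<delta>(1)] by metis
    have Cne: "C \<noteq> {}" using cover[OF subgroup.one_closed[OF K]] by blast
    \<comment> \<open>The cocycle identity is affine in the function of \<open>h\<close>, so it survives averaging over \<open>h\<close>.\<close>
    define Q where "Q F \<longleftrightarrow> (\<forall>h\<in>K. norm (F h) \<le> \<delta>) \<and>
        (\<forall>k\<in>K. \<forall>h\<in>K. normal_size (x k + L k (F h) - F (k \<otimes> h)) \<le> e)" for F
    have Qx: "Q x" using nx cyc by (simp add: Q_def)
    have QA: "Q (right_average C F)" if F: "Q F" for F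
      unfolding Q_def
    proof (intro conjI ballI)
      have Kc: "h \<otimes> inv c \<in> K" if "h \<in> K" "c \<in> C" for h c
        using that C Km subgroup.m_inv_closed[OF K] by blast
      fix h assume h: "h \<in> K"
      show "norm (right_average C F h) \<le> \<delta>"
        unfolding right_average_def
        by (rule seminorm.average_le[OF seminorm_norm C(1) Cne]) (use F Kc h in \<open>auto simp: Q_def\<close>)
      fix k assume k: "k \<in> K"
      have n: "real (card C) \<noteq> 0" using C(1) Cne by simp
      have "(1 / real (card C)) *\<^sub>R (\<Sum>c\<in>C. x k + L k (F (h \<otimes> inv c)) - F (k \<otimes> (h \<otimes> inv c))) =
          x k + L k (right_average C F h) - right_average C F (k \<otimes> h)"
      proof -
        have "(\<Sum>c\<in>C. F (k \<otimes> (h \<otimes> inv c))) = (\<Sum>c\<in>C. F (k \<otimes> h \<otimes> inv c))"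
          using C KU k h by (intro sum.cong) (auto simp: m_assoc subset_iff)
        then show ?thesis
          using n linear_sum[OF bounded_linear.linear[OF bl[OF k]], of "\<lambda>c. F (h \<otimes> inv c)" C]
          by (simp add: right_average_def sum.distrib sum_subtractf scaleR_add_right scaleR_diff_right
              linear_cmul[OF bounded_linear.linear[OF bl[OF k]]] sum_constant_scaleR)
      qed
      moreover have "normal_size ((1 / real (card C)) *\<^sub>R
          (\<Sum>c\<in>C. x k + L k (F (h \<otimes> inv c)) - F (k \<otimes> (h \<otimes> inv c)))) \<le> e"
        by (rule ns.average_le[OF C(1) Cne]) (use F Kc h k in \<open>auto simp: Q_def\<close>)
      ultimately show "normal_size (x k + L k (right_average C F h) - right_average C F (k \<otimes> h)) \<le> e"
        by simp
    qed
    have osc: "normal_size (x a - x b) \<le> 2 * \<delta>" if "a \<in> K" "b \<in> K" for a b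
      using ns.triangle_le_diff[OF normal_size_le_norm[OF nx[OF that(1)]] normal_size_le_norm[OF nx[OF that(2)]]]
      by simp
    have e0: "0 < e" using \<delta> by (simp add: e_def)
    obtain F where QF: "Q F" and inv: "\<And>a b. a \<in> K \<Longrightarrow> b \<in> K \<Longrightarrow> normal_size (F a - F b) \<le> 3 * e"
      using almost_invariant_mean[where Q = Q, OF seminorm_normal_size K C cover near osc e0 Qx QA] by metis
    define xm where "xm = F \<one>"
    have one: "\<one> \<in> K" by (rule subgroup.one_closed[OF K])
    have nxm: "norm xm \<le> \<delta>" using QF one by (simp add: Q_def xm_def)
    \<comment> \<open>By near-invariance of the mean, the averaged cocycle identity makes \<open>x\<close> a coboundary.\<close>
    have fixed: "normal_size (x k + L k xm - xm) \<le> 4 * e" if k: "k \<in> K" for k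
    proof -
      have "normal_size (x k + L k (F \<one>) - F (k \<otimes> \<one>)) \<le> e" using QF k one unfolding Q_def by blast
      then have 1: "normal_size (x k + L k xm - F k) \<le> e" using KU[OF k] by (simp add: xm_def)
      have "normal_size ((x k + L k xm - F k) + (F k - xm)) \<le> e + 3 * e"
        unfolding xm_def by (rule ns.triangle_le[OF 1[unfolded xm_def] inv[OF k one]])
      then show ?thesis by simp
    qed
    have "norm xm < r6" using nxm \<delta>r \<delta> r by linarith
    then obtain w where w: "w \<in> D" "\<phi> w = xm" using onto by blast
    have wr: "w \<in> nhd r" using w nxm \<delta>r \<delta> by (simp add: nhd_def)
    note wU = nhd_carrier[OF wr]
    have iw: "norm (\<phi> (inv w) + xm) \<le> \<delta> / 100"
    proof -
      have "\<eta> * norm xm \<le> \<eta> * \<delta>" by (rule mult_left_mono[OF nxm]) (use \<eta> in simp)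
      then show ?thesis using i[OF sub(3)[OF wr]] \<eta>\<delta>M unfolding w(2) by linarith
    qed
    have niw: "norm (\<phi> (inv w)) \<le> 2 * \<delta>"
      using norm_triangle_ineq4[of "\<phi> (inv w) + xm" xm] iw nxm \<delta> by simp
    have iwr: "inv w \<in> nhd r" using iD[OF sub(3)[OF wr]] niw \<delta> \<delta>r by (simp add: nhd_def)
    have "\<exists>\<gamma>\<in>G. inv w \<otimes> k \<otimes> w \<otimes> inv \<gamma> \<in> D \<and> norm (\<phi> (inv w \<otimes> k \<otimes> w \<otimes> inv \<gamma>)) \<le> \<delta> / 2"
      if k: "k \<in> K" for k
    proof -
      define w' where "w' = g k \<otimes> w \<otimes> inv (g k)"
      have w': "w' \<in> nhd r" "norm (\<phi> w') \<le> M * \<delta>" "norm (\<phi> w' - L k xm) \<le> \<eta> * \<delta>"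
        using small_conj[OF k w(1)] w(2) nxm by (simp_all add: w'_def)
      define y where "y = v k \<otimes> w'"
      define z where "z = inv w \<otimes> y"
      have yD: "y \<in> D" unfolding y_def by (rule mD[OF sub(2)[OF v[OF k]] sub(2)[OF w'(1)]])
      have "norm (\<phi> y - \<phi> (v k) - \<phi> w') \<le> \<eta> * norm (\<phi> (v k))"
        unfolding y_def by (rule ml[OF sub(2)[OF v[OF k]] sub(2)[OF w'(1)]])
      also have "\<dots> \<le> \<eta> * \<delta>" by (rule mult_left_mono) (use nx[OF k] \<eta> in \<open>auto simp: x_def\<close>)
      finally have y: "norm (\<phi> y - x k - \<phi> w') \<le> \<delta> / 100" using \<eta>\<delta>M by (simp add: x_def)
      have "norm (\<phi> y) \<le> norm (x k + \<phi> w') + norm (\<phi> y - (x k + \<phi> w'))" by (rule norm_triangle_sub)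
      also have "\<dots> \<le> (\<delta> + M * \<delta>) + \<delta>"
        by (intro add_mono norm_triangle_le nx k w') (use y \<delta> in \<open>simp add: diff_diff_eq\<close>)
      finally have ny: "norm (\<phi> y) \<le> 3 * (M * \<delta>)" using \<delta>M by linarith
      have yr: "y \<in> nhd r" using yD ny Mlt by (simp add: nhd_def)
      have zD: "z \<in> D" unfolding z_def by (rule mD[OF sub(2)[OF iwr] sub(2)[OF yr]])
      have "norm (\<phi> z - \<phi> (inv w) - \<phi> y) \<le> \<eta> * norm (\<phi> (inv w))"
        unfolding z_def by (rule ml[OF sub(2)[OF iwr] sub(2)[OF yr]])
      also have "\<dots> \<le> \<eta> * (2 * \<delta>)" by (rule mult_left_mono[OF niw]) (use \<eta> in simp)
      finally have z: "norm (\<phi> z - \<phi> (inv w) - \<phi> y) \<le> 2 * (\<delta> / 100)" using \<eta>\<delta>M by linarith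
      have "norm (\<phi> z) \<le> norm (\<phi> (inv w) + \<phi> y) + norm (\<phi> z - (\<phi> (inv w) + \<phi> y))" by (rule norm_triangle_sub)
      also have "\<dots> \<le> (2 * \<delta> + 3 * (M * \<delta>)) + 2 * \<delta>"
        by (intro add_mono norm_triangle_le niw ny) (use z \<delta> in \<open>simp add: diff_diff_eq\<close>)
      finally have nz: "norm (\<phi> z) \<le> 7 * (M * \<delta>)" using \<delta>M by linarith
      have zr: "z \<in> nhd r" using zD nz Mlt by (simp add: nhd_def)
      have "\<phi> z = (\<phi> z - \<phi> (inv w) - \<phi> y) + ((\<phi> (inv w) + xm) + ((\<phi> y - x k - \<phi> w') +
          ((\<phi> w' - L k xm) + (x k + L k xm - xm))))" by simp
      also have "normal_size \<dots> \<le> 2 * (\<delta> / 100) + (\<delta> / 100 + (\<delta> / 100 + (\<delta> / 100 + 4 * e)))"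
        by (intro ns.triangle_le normal_size_le_norm z iw y fixed k order_trans[OF w'(3) \<eta>\<delta>M])
      finally have pz: "normal_size (\<phi> z) \<le> 21 * (\<delta> / 100)" by (simp add: e_def)
      obtain \<gamma> where \<gamma>: "\<gamma> \<in> G" "z \<otimes> inv \<gamma> \<in> D"
        "norm (\<phi> (z \<otimes> inv \<gamma>)) \<le> 2 * normal_size (\<phi> z) + \<eta> * norm (\<phi> z)"
        using strip[OF sub(6)[OF zr]] by blast
      have "\<eta> * norm (\<phi> z) \<le> \<eta> * (7 * (M * \<delta>))" by (rule mult_left_mono[OF nz]) (use \<eta> in simp)
      also have "\<dots> = 7 * (\<eta> * (M * \<delta>))" by (simp only: ac_simps)
      also have "\<dots> = 7 * (\<delta> / 100)" by (simp only: M\<delta>)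
      finally have q: "norm (\<phi> (z \<otimes> inv \<gamma>)) \<le> \<delta> / 2" using \<gamma>(3) pz \<delta> by simp
      have "inv w \<otimes> k \<otimes> w \<otimes> inv (\<gamma> \<otimes> g k) = z \<otimes> inv \<gamma>"
        using wU KU[OF k] gU[OF k] G_carrier[OF \<gamma>(1)]
        by (simp add: z_def y_def w'_def v_def group_normalize)
      then show ?thesis using q \<gamma>(2) Gm[OF \<gamma>(1) g[OF k]] by metis
    qed
    then have "near_G ((\<lambda>k. inv w \<otimes> k \<otimes> w) ` K) (\<delta> / 2)" unfolding near_G_def by blast
    then show "\<exists>w\<in>D. norm (\<phi> w) \<le> \<delta> \<and> near_G ((\<lambda>k. inv w \<otimes> k \<otimes> w) ` K) (\<delta> / 2)"
      using w nxm by blast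
  qed
qed

end

section \<open>Convergence of the corrections and choice of the conjugator\<close>

context strictly_charted_group
begin

lemma subgroup_conjugate:
  assumes "subgroup K U" "w \<in> carrier U"
  shows "subgroup ((\<lambda>k. inv w \<otimes> k \<otimes> w) ` K) U"
proof (rule subgroupI)
  have KU: "\<And>k. k \<in> K \<Longrightarrow> k \<in> carrier U" using subgroup.subset[OF assms(1)] by blast
  show "(\<lambda>k. inv w \<otimes> k \<otimes> w) ` K \<subseteq> carrier U" using KU assms(2) by auto
  show "(\<lambda>k. inv w \<otimes> k \<otimes> w) ` K \<noteq> {}" using subgroup.one_closed[OF assms(1)] by blast
  fix a assume "a \<in> (\<lambda>k. inv w \<otimes> k \<otimes> w) ` K"
  then obtain k where k: "k \<in> K" "a = inv w \<otimes> k \<otimes> w" by blast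
  have "inv a = inv w \<otimes> inv k \<otimes> w" using k KU assms(2) by (simp add: group_normalize)
  then show "inv a \<in> (\<lambda>k. inv w \<otimes> k \<otimes> w) ` K" using subgroup.m_inv_closed[OF assms(1) k(1)] by blast
  fix b assume "b \<in> (\<lambda>k. inv w \<otimes> k \<otimes> w) ` K"
  then obtain h where h: "h \<in> K" "b = inv w \<otimes> h \<otimes> w" by blast
  have "a \<otimes> b = inv w \<otimes> (k \<otimes> h) \<otimes> w" using k h KU assms(2) by (simp add: group_normalize)
  then show "a \<otimes> b \<in> (\<lambda>k. inv w \<otimes> k \<otimes> w) ` K" using subgroup.m_closed[OF assms(1) k(1) h(1)] by blast
qed

lemma compactin_conjugate:
  assumes "compactin T K" "w \<in> carrier U"
  shows "compactin T ((\<lambda>k. inv w \<otimes> k \<otimes> w) ` K)"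
  by (rule image_compactin[OF assms(1)])
    (intro continuous_mult continuous_const continuous_map_id[unfolded id_def] inv_closed assms(2))

text \<open>Convergence of coordinates is convergence in the group.\<close>

lemma limitin_of_chart:
  assumes "\<And>n. q n \<in> D" "(\<lambda>n. \<phi> (q n)) \<longlonglongrightarrow> \<phi> w" "w \<in> D"
  shows "limitin T q w sequentially"
  unfolding limitin_def
proof (intro conjI allI impI)
  show "w \<in> topspace T" using D_carrier[OF assms(3)] topspace_carrier by simp
  fix W assume "openin T W \<and> w \<in> W"
  then obtain r where r: "0 < r" "\<forall>v\<in>D. norm (\<phi> v - \<phi> w) < r \<longrightarrow> v \<in> W"
    using chart_nhd assms(3) by blast
  have "eventually (\<lambda>n. dist (\<phi> (q n)) (\<phi> w) < r) sequentially"
    by (rule tendstoD[OF assms(2) r(1)])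
  then show "eventually (\<lambda>n. q n \<in> W) sequentially"
    by eventually_elim (use r(2) assms(1) in \<open>auto simp: dist_norm\<close>)
qed

end

context charted_group_with_compact_subgroup
begin

lemma closedin_G: "closedin T G"
  by (rule compactin_imp_closedin[OF Hausdorff compact_G])

text \<open>The corrections are at most \<open>\<delta>, \<delta>/2, \<delta>/4, \<dots>\<close>, and multiplying by one of them from the right moves a
  coordinate by at most twice its size, so the products \<open>W n\<close> converge.  The conjugates of
  \<open>k \<in> K\<close> by \<open>W n\<close> are products of \<open>q n\<close> tending to the identity and \<open>g n \<in> G\<close>; since \<open>G\<close>
  is closed, their limit is in \<open>G\<close>.\<close>

lemma conjugate_into_G_of_near_G:
  assumes \<rho>: "0 < \<rho>"
  obtains \<delta> where "0 < \<delta>"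
    and "\<And>K. \<lbrakk>subgroup K U; compactin T K; near_G K \<delta>\<rbrakk> \<Longrightarrow>
           \<exists>u\<in>nhd \<rho>. \<forall>k\<in>K. u \<otimes> k \<otimes> inv u \<in> G"
proof -
  obtain \<delta>0 where \<delta>0: "0 < \<delta>0"
    and halve: "\<And>K \<delta>. \<lbrakk>subgroup K U; compactin T K; 0 < \<delta>; \<delta> \<le> \<delta>0; near_G K \<delta>\<rbrakk> \<Longrightarrow>
      \<exists>w\<in>D. norm (\<phi> w) \<le> \<delta> \<and> near_G ((\<lambda>k. inv w \<otimes> k \<otimes> w) ` K) (\<delta> / 2)"
    using halve_defect by metis
  obtain r1 where r1: "0 < r1"
    and mD: "\<And>u v. u \<in> nhd r1 \<Longrightarrow> v \<in> nhd r1 \<Longrightarrow> u \<otimes> v \<in> D"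
    and mr: "\<And>u v. u \<in> nhd r1 \<Longrightarrow> v \<in> nhd r1 \<Longrightarrow> norm (\<phi> (u \<otimes> v) - \<phi> u - \<phi> v) \<le> 1 * norm (\<phi> v)"
    using mult_nhd[of 1] by (metis zero_less_one)
  obtain r2 where r2: "0 < r2" and iD: "\<And>u. u \<in> nhd r2 \<Longrightarrow> inv u \<in> D"
    and i: "\<And>u. u \<in> nhd r2 \<Longrightarrow> norm (\<phi> (inv u) + \<phi> u) \<le> 1 * norm (\<phi> u)"
    using inv_nhd[of 1] by (metis zero_less_one)
  obtain r3 where r3: "0 < r3" and onto: "\<And>x. norm x < r3 \<Longrightarrow> x \<in> \<phi> ` D"
    using chart_onto by blast
  define \<delta> where "\<delta> = min \<delta>0 (min (min r1 r2) (min r3 \<rho>) / 9)"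
  have \<delta>: "0 < \<delta>" "\<delta> \<le> \<delta>0" "4 * \<delta> < r1" "4 * \<delta> < r2" "4 * \<delta> < r3" "8 * \<delta> < \<rho>"
    using \<delta>0 r1 r2 r3 \<rho> by (auto simp: \<delta>_def)
  show thesis
  proof (rule that[OF \<delta>(1)])
    fix K assume K: "subgroup K U" and cK: "compactin T K" and cl: "near_G K \<delta>"
    have KU: "\<And>k. k \<in> K \<Longrightarrow> k \<in> carrier U" using subgroup.subset[OF K] by blast
    let ?c = "\<lambda>w. (\<lambda>k. inv w \<otimes> k \<otimes> w) ` K"
    have "\<exists>W. \<forall>n. (W n \<in> D \<and> (n = 0 \<longrightarrow> W n = \<one>) \<and>
          norm (\<phi> (W n)) \<le> 4 * \<delta> * (1 - (1/2) ^ n) \<and> near_G (?c (W n)) (\<delta> * (1/2) ^ n)) \<and>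
        norm (\<phi> (W (Suc n)) - \<phi> (W n)) \<le> 2 * \<delta> * (1/2) ^ n"
    proof (rule dependent_nat_choice[where P = "\<lambda>n w. w \<in> D \<and> (n = 0 \<longrightarrow> w = \<one>) \<and>
          norm (\<phi> w) \<le> 4 * \<delta> * (1 - (1/2) ^ n) \<and> near_G (?c w) (\<delta> * (1/2) ^ n)"
        and Q = "\<lambda>n w w'. norm (\<phi> w' - \<phi> w) \<le> 2 * \<delta> * (1/2) ^ n"])
      have "?c \<one> = K" using KU by force
      then show "\<exists>w. w \<in> D \<and> (0 = 0 \<longrightarrow> w = \<one>) \<and> norm (\<phi> w) \<le> 4 * \<delta> * (1 - (1/2) ^ 0) \<and>
          near_G (?c w) (\<delta> * (1/2) ^ 0)"
        using cl one_D chart_one by (intro exI[of _ \<one>]) simp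
    next
      fix W n
      assume W: "W \<in> D \<and> (n = 0 \<longrightarrow> W = \<one>) \<and> norm (\<phi> W) \<le> 4 * \<delta> * (1 - (1/2) ^ n) \<and>
          near_G (?c W) (\<delta> * (1/2) ^ n)"
      define \<epsilon> where "\<epsilon> = \<delta> * (1/2) ^ n"
      have \<epsilon>: "0 < \<epsilon>" "\<epsilon> \<le> \<delta>"
        using \<delta> by (simp_all add: \<epsilon>_def power_le_one)
      have nW: "norm (\<phi> W) \<le> 4 * \<delta> - 4 * \<epsilon>" using W by (simp add: \<epsilon>_def algebra_simps)
      have WU: "W \<in> carrier U" using W D_carrier by blast
      obtain w where w: "w \<in> D" "norm (\<phi> w) \<le> \<epsilon>"
        and cw: "near_G ((\<lambda>k. inv w \<otimes> k \<otimes> w) ` ?c W) (\<epsilon> / 2)"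
        using halve[OF subgroup_conjugate[OF K WU] compactin_conjugate[OF cK WU] \<epsilon>(1)] \<epsilon>(2) \<delta>(2) W
        unfolding \<epsilon>_def by auto
      have wU: "w \<in> carrier U" using w D_carrier by blast
      have Wr: "W \<in> nhd r1" and wr: "w \<in> nhd r1"
        using W w nW \<epsilon> \<delta> by (auto simp: nhd_def)
      have "norm (\<phi> (W \<otimes> w) - \<phi> W - \<phi> w) \<le> 1 * norm (\<phi> w)" by (rule mr[OF Wr wr])
      then have d: "norm (\<phi> (W \<otimes> w) - \<phi> W) \<le> 2 * \<epsilon>"
        using norm_triangle_sub[of "\<phi> (W \<otimes> w) - \<phi> W" "\<phi> w"] w(2) by linarith
      then have "norm (\<phi> (W \<otimes> w)) \<le> 4 * \<delta> - 2 * \<epsilon>"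
        using norm_triangle_sub[of "\<phi> (W \<otimes> w)" "\<phi> W"] nW by linarith
      moreover have "(\<lambda>k. inv w \<otimes> k \<otimes> w) ` ?c W = ?c (W \<otimes> w)"
        unfolding image_image using WU wU KU by (intro image_cong) (auto simp: group_normalize)
      ultimately show "\<exists>w'. (w' \<in> D \<and> (Suc n = 0 \<longrightarrow> w' = \<one>) \<and>
            norm (\<phi> w') \<le> 4 * \<delta> * (1 - (1/2) ^ Suc n) \<and> near_G (?c w') (\<delta> * (1/2) ^ Suc n)) \<and>
          norm (\<phi> w' - \<phi> W) \<le> 2 * \<delta> * (1/2) ^ n"
        using mD[OF Wr wr] d cw by (intro exI[of _ "W \<otimes> w"]) (simp add: \<epsilon>_def algebra_simps)
    qed
    then obtain W where WD: "\<And>n. W n \<in> D" and nW: "\<And>n. norm (\<phi> (W n)) \<le> 4 * \<delta> * (1 - (1/2) ^ n)"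
      and cW: "\<And>n. near_G (?c (W n)) (\<delta> * (1/2) ^ n)"
      and dW: "\<And>n. norm (\<phi> (W (Suc n)) - \<phi> (W n)) \<le> 2 * \<delta> * (1/2) ^ n" by blast
    have "summable (\<lambda>n. \<phi> (W (Suc n)) - \<phi> (W n))"
    proof (rule summable_comparison_test')
      show "summable (\<lambda>n. 2 * \<delta> * (1/2) ^ n)" by (intro summable_mult summable_geometric) simp
    qed (use dW in blast)
    from summable_LIMSEQ[OF this]
    have "(\<lambda>n. \<phi> (W n) - \<phi> (W 0)) \<longlonglongrightarrow> (\<Sum>n. \<phi> (W (Suc n)) - \<phi> (W n))"
      by (simp add: sum_lessThan_telescope[of "\<lambda>n. \<phi> (W n)"])
    from tendsto_add[OF this tendsto_const[of "\<phi> (W 0)"]] obtain x where x: "(\<lambda>n. \<phi> (W n)) \<longlonglongrightarrow> x"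
      by auto
    have "norm (\<phi> (W n)) \<le> 4 * \<delta>" for n
    proof -
      have "4 * \<delta> * (1 - (1/2) ^ n) \<le> 4 * \<delta> * 1" by (rule mult_left_mono) (use \<delta> in auto)
      with nW[of n] show ?thesis by simp
    qed
    then have nx: "norm x \<le> 4 * \<delta>"
      by (intro LIMSEQ_le_const2[OF tendsto_norm[OF x]]) blast
    then obtain w where w: "w \<in> D" "\<phi> w = x" using onto[of x] \<delta> by auto
    have wr: "w \<in> nhd r2" using w nx \<delta> by (simp add: nhd_def)
    have wU: "w \<in> carrier U" using w D_carrier by blast
    have limW: "limitin T W w sequentially" by (rule limitin_of_chart[OF WD _ w(1)]) (simp add: x w)
    have "inv w \<otimes> k \<otimes> w \<in> G" if k: "k \<in> K" for k
    proof -
      have "\<exists>g\<in>G. inv (W n) \<otimes> k \<otimes> W n \<otimes> inv g \<in> D \<and>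
          norm (\<phi> (inv (W n) \<otimes> k \<otimes> W n \<otimes> inv g)) \<le> \<delta> * (1/2) ^ n" for n
        using cW[of n] k unfolding near_G_def by blast
      then obtain g where g: "\<And>n. g n \<in> G" and qD: "\<And>n. inv (W n) \<otimes> k \<otimes> W n \<otimes> inv (g n) \<in> D"
        and q: "\<And>n. norm (\<phi> (inv (W n) \<otimes> k \<otimes> W n \<otimes> inv (g n))) \<le> \<delta> * (1/2) ^ n" by metis
      define q where "q n = inv (W n) \<otimes> k \<otimes> W n \<otimes> inv (g n)" for n
      have "(\<lambda>n. \<delta> * (1/2) ^ n) \<longlonglongrightarrow> \<delta> * 0"
        by (intro tendsto_mult_left LIMSEQ_power_zero) simp
      then have "(\<lambda>n. \<phi> (q n)) \<longlonglongrightarrow> 0"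
        by (intro Lim_null_comparison[of "\<lambda>n. \<phi> (q n)" "\<lambda>n. \<delta> * (1/2) ^ n"])
          (use q in \<open>simp_all add: q_def\<close>)
      then have limq: "limitin T q \<one> sequentially"
        using qD by (intro limitin_of_chart one_D) (simp_all add: chart_one q_def)
      let ?f = "\<lambda>p. inv (fst p) \<otimes> (inv (snd p) \<otimes> k \<otimes> snd p)"
      have "continuous_map (prod_topology T T) T ?f"
        using KU[OF k]
        by (intro continuous_mult continuous_inv continuous_map_fst continuous_map_snd continuous_const)
      moreover have "limitin (prod_topology T T) (\<lambda>n. (q n, W n)) (\<one>, w) sequentially"
        using limq limW by (simp add: limitin_pairwise o_def)
      ultimately have "limitin T (?f \<circ> (\<lambda>n. (q n, W n))) (?f (\<one>, w)) sequentially"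
        by (rule continuous_map_limit)
      moreover have "(?f \<circ> (\<lambda>n. (q n, W n))) n = g n" for n
        using D_carrier[OF WD[of n]] KU[OF k] G_carrier[OF g[of n]] by (simp add: q_def group_normalize)
      ultimately have "?f (\<one>, w) \<in> G"
        using g by (intro limitin_closedin[OF _ closedin_G]) auto
      then show ?thesis using wU KU[OF k] by simp
    qed
    moreover have "inv w \<in> nhd \<rho>"
      using iD[OF wr] i[OF wr] norm_triangle_ineq4[of "\<phi> (inv w) + \<phi> w" "\<phi> w"] nx w(2) \<delta>
      by (simp add: nhd_def)
    ultimately show "\<exists>u\<in>nhd \<rho>. \<forall>k\<in>K. u \<otimes> k \<otimes> inv u \<in> G"
      using wU by (intro bexI[of _ "inv w"]) auto
  qed
qed

definition tube :: "real \<Rightarrow> 'a set" where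
  "tube r = {x \<in> carrier U. \<exists>g\<in>G. x \<otimes> inv g \<in> nhd r}"

lemma openin_tube: "openin T (tube r)"
proof -
  have "tube r = (\<Union>g\<in>G. {x \<in> carrier U. x \<otimes> inv g \<in> nhd r})" by (auto simp: tube_def)
  moreover have "openin T {x \<in> carrier U. x \<otimes> inv g \<in> nhd r}" if "g \<in> G" for g
    using G_carrier[OF that]
    by (intro openin_preimage openin_nhd continuous_mult continuous_const) auto
  ultimately show ?thesis by auto
qed

lemma G_subset_tube: "0 < r \<Longrightarrow> G \<subseteq> tube r"
  using one_nhd[of r] G_carrier by (force simp: tube_def)

lemma near_G_of_subset_tube: "K \<subseteq> tube r \<Longrightarrow> near_G K r"
  unfolding near_G_def tube_def nhd_def by (fastforce intro: less_imp_le)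

definition conjugates_into_G :: "'a set \<Rightarrow> 'a \<Rightarrow> bool" where
  "conjugates_into_G K u \<longleftrightarrow> u \<in> D \<and> (\<forall>k\<in>K. u \<otimes> k \<otimes> inv u \<in> G)"

text \<open>If \<open>K\<close> is not contained in \<open>G\<close>, then conjugation by elements near the identity keeps it outside the
  closed set \<open>G\<close>.  So the infimum of the norms of the conjugators is positive, and some
  conjugator has norm below twice the infimum.\<close>

lemma near_optimal_conjugator:
  assumes K: "K \<subseteq> carrier U" and ex: "conjugates_into_G K u0"
  shows "\<exists>u. conjugates_into_G K u \<and> (\<forall>u'. conjugates_into_G K u' \<longrightarrow> norm (\<phi> u) \<le> 2 * norm (\<phi> u')) \<and>
    (K \<subseteq> G \<longrightarrow> u = \<one>)"
proof (cases "K \<subseteq> G")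
  case True
  then have "conjugates_into_G K \<one>"
    using G_carrier one_D by (auto simp: conjugates_into_G_def subset_iff)
  then show ?thesis by (intro exI[of _ \<one>]) (simp add: chart_one)
next
  case False
  then obtain k where k: "k \<in> K" "k \<notin> G" by blast
  then have kU: "k \<in> carrier U" using K by blast
  define W where "W = {u \<in> carrier U. u \<otimes> k \<otimes> inv u \<in> carrier U - G}"
  have "openin T (carrier U - G)" using closedin_G topspace_carrier by (auto simp: closedin_def)
  then have "openin T W" unfolding W_def
    by (intro openin_preimage continuous_mult continuous_inv continuous_const continuous_map_id[unfolded id_def] kU)
  moreover have "\<one> \<in> W" using k kU by (simp add: W_def)
  ultimately obtain \<rho> where \<rho>: "0 < \<rho>" "nhd \<rho> \<subseteq> W" by (rule nhd_basis)
  have low: "\<rho> \<le> norm (\<phi> u)" if "conjugates_into_G K u" for u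
  proof (rule ccontr)
    assume "\<not> \<rho> \<le> norm (\<phi> u)"
    then have "u \<in> W" using that \<rho> by (auto simp: conjugates_into_G_def nhd_def)
    then show False using that k by (auto simp: conjugates_into_G_def W_def)
  qed
  define N where "N = (\<lambda>u. norm (\<phi> u)) ` Collect (conjugates_into_G K)"
  have N: "N \<noteq> {}" using ex by (auto simp: N_def)
  have bdd: "bdd_below N" unfolding N_def by (rule bdd_belowI[of _ 0]) auto
  have "\<rho> \<le> Inf N" by (rule cInf_greatest[OF N]) (auto simp: N_def low)
  then have "Inf N < 2 * Inf N" using \<rho> by simp
  then obtain t where "t \<in> N" "t < 2 * Inf N" using cInf_lessD[OF N] by blast
  then obtain u where u: "conjugates_into_G K u" "norm (\<phi> u) < 2 * Inf N" unfolding N_def by blast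
  have "norm (\<phi> u) \<le> 2 * norm (\<phi> u')" if "conjugates_into_G K u'" for u'
    using cInf_lower[OF _ bdd, of "norm (\<phi> u')"] that u(2) by (simp add: N_def)
  then show ?thesis using u(1) False by blast
qed

text \<open>Continuity at \<open>G\<close>: the tube in which \<open>K\<close> has some conjugator of norm below \<open>\<rho>/2\<close> is a
  neighbourhood of \<open>G\<close>, and there the chosen conjugator has norm below \<open>\<rho>\<close>.\<close>

theorem continuous_conjugation_into_G:
  "\<exists>V u. openin T V \<and> G \<subseteq> V \<and>
     u \<in> compact_subgroups_in U T V \<rightarrow> carrier U \<and>
     topcontinuous_at (weak_0_topology T (compact_subgroups_in U T V)) T u G \<and>
     u G = \<one> \<and>
     (\<forall>K \<in> compact_subgroups_in U T V. (\<lambda>k. u K \<otimes> k \<otimes> inv (u K)) ` K \<subseteq> G)"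
proof -
  have "\<exists>\<delta>>0. \<forall>K. subgroup K U \<longrightarrow> compactin T K \<longrightarrow> K \<subseteq> tube \<delta> \<longrightarrow>
      (\<exists>u\<in>nhd \<rho>. conjugates_into_G K u)" if \<rho>: "0 < \<rho>" for \<rho>
  proof -
    obtain \<delta> where "0 < \<delta>" "\<And>K. \<lbrakk>subgroup K U; compactin T K; near_G K \<delta>\<rbrakk> \<Longrightarrow>
           \<exists>u\<in>nhd \<rho>. \<forall>k\<in>K. u \<otimes> k \<otimes> inv u \<in> G"
      using conjugate_into_G_of_near_G[OF \<rho>] by metis
    then show ?thesis
      using near_G_of_subset_tube nhd_D unfolding conjugates_into_G_def by meson
  qed
  then obtain \<delta> where \<delta>: "\<And>\<rho>. 0 < \<rho> \<Longrightarrow> 0 < \<delta> \<rho>"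
    and conj: "\<And>\<rho> K. \<lbrakk>0 < \<rho>; subgroup K U; compactin T K; K \<subseteq> tube (\<delta> \<rho>)\<rbrakk> \<Longrightarrow> \<exists>u\<in>nhd \<rho>. conjugates_into_G K u"
    by metis
  define V where "V = tube (\<delta> 1)"
  let ?S = "compact_subgroups_in U T V"
  have S: "subgroup K U" "compactin T K" "K \<subseteq> tube (\<delta> 1)" "K \<subseteq> carrier U" if "K \<in> ?S" for K
    using that subgroup.subset[of K U] by (auto simp: compact_subgroups_in_def V_def)
  have GV: "G \<subseteq> V" unfolding V_def by (rule G_subset_tube) (simp add: \<delta>)
  have GS: "G \<in> ?S" using GV subgroup_G compact_G by (simp add: compact_subgroups_in_def)
  have "\<forall>K\<in>?S. \<exists>u. conjugates_into_G K u \<and>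
      (\<forall>u'. conjugates_into_G K u' \<longrightarrow> norm (\<phi> u) \<le> 2 * norm (\<phi> u')) \<and> (K \<subseteq> G \<longrightarrow> u = \<one>)"
    using conj[OF zero_less_one S(1-3)] near_optimal_conjugator[OF S(4)] by blast
  then obtain u where u: "\<And>K. K \<in> ?S \<Longrightarrow> conjugates_into_G K (u K)"
    and opt: "\<And>K u'. K \<in> ?S \<Longrightarrow> conjugates_into_G K u' \<Longrightarrow> norm (\<phi> (u K)) \<le> 2 * norm (\<phi> u')"
    and triv: "\<And>K. K \<in> ?S \<Longrightarrow> K \<subseteq> G \<Longrightarrow> u K = \<one>"
    by metis
  have uD: "u K \<in> D" if "K \<in> ?S" for K using u[OF that] by (simp add: conjugates_into_G_def)
  have uU: "u \<in> ?S \<rightarrow> carrier U" using uD D_carrier by blast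
  have uG: "u G = \<one>" by (rule triv[OF GS]) simp
  have top: "topspace (weak_0_topology T ?S) = ?S"
    by (rule topspace_weak_0_topology) (use S(4) topspace_carrier in auto)
  have "topcontinuous_at (weak_0_topology T ?S) T u G"
    unfolding topcontinuous_at_def top
  proof (intro conjI allI impI GS)
    show "u \<in> ?S \<rightarrow> topspace T" using uU by (simp add: topspace_carrier)
    fix W assume "openin T W \<and> u G \<in> W"
    then obtain \<rho> where \<rho>: "0 < \<rho>" "nhd \<rho> \<subseteq> W" using nhd_basis uG by metis
    define B where "B = {H \<in> ?S. H \<subseteq> tube (\<delta> (\<rho> / 2))}"
    have "openin (weak_0_topology T ?S) B"
      unfolding openin_weak_0_topology B_def by (rule arbitrary_union_of_inc) (use openin_tube in blast)
    moreover have "G \<in> B" unfolding B_def using GS G_subset_tube[of "\<delta> (\<rho> / 2)"] \<delta>[of "\<rho> / 2"] \<rho> by simp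
    moreover have "u K \<in> W" if "K \<in> B" for K
    proof -
      have K: "K \<in> ?S" "K \<subseteq> tube (\<delta> (\<rho> / 2))" using that by (auto simp: B_def)
      obtain u' where u': "u' \<in> nhd (\<rho> / 2)" "conjugates_into_G K u'"
        using conj[OF _ S(1,2)[OF K(1)] K(2)] \<rho> by auto
      have "norm (\<phi> (u K)) < \<rho>" using opt[OF K(1) u'(2)] nhd_norm[OF u'(1)] by simp
      then show ?thesis using \<rho>(2) uD[OF K(1)] by (auto simp: nhd_def)
    qed
    ultimately show "\<exists>B. openin (weak_0_topology T ?S) B \<and> G \<in> B \<and> (\<forall>K\<in>B. u K \<in> W)" by blast
  qed
  moreover have "\<forall>K\<in>?S. (\<lambda>k. u K \<otimes> k \<otimes> inv (u K)) ` K \<subseteq> G"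
    using u by (auto simp: conjugates_into_G_def)
  ultimately show ?thesis
    using openin_tube GV uU uG unfolding V_def by blast
qed

end

section \<open>Charts of a Banach Lie group\<close>

lemma linear_eq_zero_of_little_o:
  fixes f :: "'v::real_normed_vector \<Rightarrow> 'w::real_normed_vector"
  assumes f: "linear f" and o: "\<And>\<eta>. 0 < \<eta> \<Longrightarrow> \<exists>r>0. \<forall>x. norm x < r \<longrightarrow> norm (f x) \<le> \<eta> * norm x"
  shows "f x = 0"
proof (cases "x = 0")
  case True
  then show ?thesis by (simp add: linear_0[OF f])
next
  case False
  have "norm (f x) \<le> 0 + \<epsilon>" if \<epsilon>: "0 < \<epsilon>" for \<epsilon>
  proof -
    have "0 < \<epsilon> / norm x" using \<epsilon> False by simp
    from o[OF this] obtain r where r: "0 < r" "\<And>y. norm y < r \<Longrightarrow> norm (f y) \<le> \<epsilon> / norm x * norm y" by blast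
    define t where "t = r / (2 * norm x)"
    have t: "0 < t" "norm (t *\<^sub>R x) < r" using r False by (simp_all add: t_def)
    have "t * norm (f x) \<le> \<epsilon> / norm x * (t * norm x)"
      using r(2)[OF t(2)] t(1) by (simp add: linear_cmul[OF f])
    also have "\<dots> = t * \<epsilon>" using False by simp
    finally show ?thesis using t(1) by simp
  qed
  then have "norm (f x) \<le> 0" by (rule field_le_epsilon)
  then show ?thesis by simp
qed

context banach_lie_group
begin

lemma chart_inj: "(D, \<xi>) \<in> A \<Longrightarrow> inj_on \<xi> D"
  using homeomorphic_imp_injective_map[OF chart_homeo] openin_subset[OF chart_open]
  by (metis inf.absorb2 topspace_subtopology)

lemma chart_carrier: "(D, \<xi>) \<in> A \<Longrightarrow> D \<subseteq> carrier U"
  using openin_subset[OF chart_open] topspace_eq_carrier by simp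

lemma obtain_chart:
  assumes "x \<in> carrier U" obtains D \<xi> where "(D, \<xi>) \<in> A" "x \<in> D"
proof -
  have "x \<in> (\<Union>(D, \<xi>)\<in>A. D)" using assms charts_cover topspace_eq_carrier by simp
  then show thesis using that by blast
qed

text \<open>Analyticity of the product in terms of a coordinate expression \<open>F\<close>, which hides the
  inverses of the charts.\<close>

lemma mult_in_charts:
  assumes "(D, \<xi>) \<in> A" "(D', \<xi>') \<in> A" "(E, \<psi>) \<in> A" "x \<in> D" "y \<in> D'" "x \<otimes> y \<in> E"
  obtains F where "real_analytic_at F (\<xi> x, \<xi>' y)"
    and "\<And>u v. u \<in> D \<Longrightarrow> v \<in> D' \<Longrightarrow> F (\<xi> u, \<xi>' v) = \<psi> (u \<otimes> v)"
proof -
  define F where "F = \<psi> \<circ> (\<lambda>(x, y). x \<otimes> y) \<circ> inv_into (D \<times> D') (map_prod \<xi> \<xi>')"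
  have "(D \<times> D', map_prod \<xi> \<xi>') \<in> prod_atlas A A"
    unfolding prod_atlas_def using assms(1,2) by force
  with mult_analytic assms have "real_analytic_at F (map_prod \<xi> \<xi>' (x, y))"
    unfolding analytic_map_def F_def by fastforce
  moreover have "F (\<xi> u, \<xi>' v) = \<psi> (u \<otimes> v)" if "u \<in> D" "v \<in> D'" for u v
  proof -
    have "inj_on (map_prod \<xi> \<xi>') (D \<times> D')"
      by (rule map_prod_inj_on[OF chart_inj[OF assms(1)] chart_inj[OF assms(2)]])
    then have "inv_into (D \<times> D') (map_prod \<xi> \<xi>') (map_prod \<xi> \<xi>' (u, v)) = (u, v)"
      using that by (intro inv_into_f_f) auto
    then show ?thesis by (simp add: F_def)
  qed
  ultimately show thesis using that by simp
qed

lemma chart_basis: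
  assumes A: "(D, \<xi>) \<in> A" and W: "openin T W" "u \<in> W" "u \<in> D"
  shows "\<exists>r>0. \<forall>v\<in>D. norm (\<xi> v - \<xi> u) < r \<longrightarrow> v \<in> W"
proof -
  have "openin (subtopology T D) (D \<inter> W)"
    using W(1) by (metis inf_commute openin_subtopology)
  then have "openin (top_of_set (\<xi> ` D)) (\<xi> ` (D \<inter> W))"
    using homeomorphic_imp_open_map[OF chart_homeo[OF A]] by (simp add: open_map_def)
  then have "open (\<xi> ` (D \<inter> W))"
    using chart_open_image[OF A] openin_open_eq by blast
  then obtain r where r: "0 < r" "ball (\<xi> u) r \<subseteq> \<xi> ` (D \<inter> W)"
    using W by (metis IntI image_eqI openE)
  have "v \<in> W" if "v \<in> D" "norm (\<xi> v - \<xi> u) < r" for v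
  proof -
    have "\<xi> v \<in> \<xi> ` (D \<inter> W)" using that r(2) by (auto simp: dist_norm norm_minus_commute)
    then show ?thesis using inj_onD[OF chart_inj[OF A]] that(1) by blast
  qed
  with r(1) show ?thesis by blast
qed

text \<open>The derivative \<open>F'\<close> of the coordinate expression \<open>F\<close> of the product at the identity is addition,
  since \<open>F\<close> restricts to the identity on either axis.  Strict differentiability compares \<open>(u, v)\<close>
  with \<open>(u, \<one>)\<close> and with \<open>(\<one>, v)\<close>, which makes the error small relative to \<open>v\<close> and to \<open>u\<close>.\<close>

lemma chart_mult_strict:
  assumes A: "(D, \<xi>) \<in> A" and one: "\<one> \<in> D" and \<eta>: "0 < \<eta>"
  shows "\<exists>r>0. \<forall>u\<in>D. \<forall>v\<in>D. norm (\<xi> u - \<xi> \<one>) < r \<longrightarrow> norm (\<xi> v - \<xi> \<one>) < r \<longrightarrow>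
    norm (\<xi> (u \<otimes> v) - \<xi> u - (\<xi> v - \<xi> \<one>)) \<le>
      \<eta> * min (norm (\<xi> u - \<xi> \<one>)) (norm (\<xi> v - \<xi> \<one>))"
proof -
  define e where "e = \<xi> \<one>"
  obtain F where an: "real_analytic_at F (e, e)"
    and F: "\<And>u v. u \<in> D \<Longrightarrow> v \<in> D \<Longrightarrow> F (\<xi> u, \<xi> v) = \<xi> (u \<otimes> v)"
    using mult_in_charts[OF A A A one one] one by (auto simp: e_def)
  obtain F' where bl: "bounded_linear F'"
    and F': "\<And>\<eta>. 0 < \<eta> \<Longrightarrow> \<exists>r>0. \<forall>h h'. norm h < r \<longrightarrow> norm h' < r \<longrightarrow>
           norm (F ((e, e) + h) - F ((e, e) + h') - F' (h - h')) \<le> \<eta> * norm (h - h')"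
    using real_analytic_at_imp_strict_derivative[OF an] by metis
  have lin: "linear F'" using bl by (rule bounded_linear.linear)
  obtain R where R: "0 < R" "ball e R \<subseteq> \<xi> ` D"
    using openE[OF chart_open_image[OF A]] one by (metis e_def image_eqI)
  have Funit: "F (x, e) = x" "F (e, x) = x" if "norm (x - e) < R" for x
  proof -
    have "x \<in> \<xi> ` D" using R(2) that by (auto simp: dist_norm norm_minus_commute)
    then obtain u where "u \<in> D" "x = \<xi> u" by blast
    moreover have "u \<in> carrier U" using calculation chart_carrier[OF A] by blast
    ultimately show "F (x, e) = x" "F (e, x) = x" using F[of u \<one>] F[of \<one> u] one by (simp_all add: e_def)
  qed
  have Fe: "F (e, e) = e" using Funit[of e] R by simp
  have L1: "F' (a, 0) = a" for a
  proof -
    have "F' (a, 0) - a = 0"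
    proof (rule linear_eq_zero_of_little_o[where f = "\<lambda>a. F' (a, 0) - a" and x = a])
      have "linear (\<lambda>a. F' (a, 0))"
        using linear_compose[OF _ lin, of "\<lambda>a. (a, 0)"] by (simp add: o_def linear_iff)
      then show "linear (\<lambda>a. F' (a, 0) - a)" by (intro linear_compose_sub linear_ident)
      fix \<epsilon> :: real assume "0 < \<epsilon>"
      from F'[OF this] obtain r where r: "0 < r" "\<And>h h'. norm h < r \<Longrightarrow> norm h' < r \<Longrightarrow>
           norm (F ((e, e) + h) - F ((e, e) + h') - F' (h - h')) \<le> \<epsilon> * norm (h - h')" by blast
      have "norm (F' (a, 0) - a) \<le> \<epsilon> * norm a" if "norm a < min r R" for a
        using r(2)[of "(a, 0)" 0] that r(1) Funit(1)[of "e + a"] Fe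
        by (simp add: zero_prod_def[symmetric] norm_minus_commute)
      then show "\<exists>r>0. \<forall>x. norm x < r \<longrightarrow> norm (F' (x, 0) - x) \<le> \<epsilon> * norm x"
        using r(1) R(1) by (intro exI[of _ "min r R"]) auto
    qed
    then show ?thesis by simp
  qed
  have L2: "F' (0, a) = a" for a
  proof -
    have "F' (0, a) - a = 0"
    proof (rule linear_eq_zero_of_little_o[where f = "\<lambda>a. F' (0, a) - a" and x = a])
      have "linear (\<lambda>a. F' (0, a))"
        using linear_compose[OF _ lin, of "\<lambda>a. (0, a)"] by (simp add: o_def linear_iff)
      then show "linear (\<lambda>a. F' (0, a) - a)" by (intro linear_compose_sub linear_ident)
      fix \<epsilon> :: real assume "0 < \<epsilon>"
      from F'[OF this] obtain r where r: "0 < r" "\<And>h h'. norm h < r \<Longrightarrow> norm h' < r \<Longrightarrow>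
           norm (F ((e, e) + h) - F ((e, e) + h') - F' (h - h')) \<le> \<epsilon> * norm (h - h')" by blast
      have "norm (F' (0, a) - a) \<le> \<epsilon> * norm a" if "norm a < min r R" for a
        using r(2)[of "(0, a)" 0] that r(1) Funit(2)[of "e + a"] Fe
        by (simp add: zero_prod_def[symmetric] norm_minus_commute)
      then show "\<exists>r>0. \<forall>x. norm x < r \<longrightarrow> norm (F' (0, x) - x) \<le> \<epsilon> * norm x"
        using r(1) R(1) by (intro exI[of _ "min r R"]) auto
    qed
    then show ?thesis by simp
  qed
  from F'[OF \<eta>] obtain r where r: "0 < r" "\<And>h h'. norm h < r \<Longrightarrow> norm h' < r \<Longrightarrow>
      norm (F ((e, e) + h) - F ((e, e) + h') - F' (h - h')) \<le> \<eta> * norm (h - h')" by blast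
  have main: "norm (\<xi> (u \<otimes> v) - \<xi> u - (\<xi> v - e)) \<le> \<eta> * min (norm (\<xi> u - e)) (norm (\<xi> v - e))"
    if uv: "u \<in> D" "v \<in> D" "norm (\<xi> u - e) < r / 2" "norm (\<xi> v - e) < r / 2" for u v
  proof -
    have n: "norm (\<xi> u - e, \<xi> v - e) < r" "norm (\<xi> u - e, 0::'e) < r" "norm (0::'e, \<xi> v - e) < r"
      using norm_Pair_le[of "\<xi> u - e" "\<xi> v - e"] uv r(1) by auto
    have F1: "F (\<xi> u, e) = \<xi> u" "F (e, \<xi> v) = \<xi> v"
      using F[of u \<one>] F[of \<one> v] one uv chart_carrier[OF A] by (auto simp: e_def subset_iff)
    have "norm (\<xi> (u \<otimes> v) - \<xi> u - (\<xi> v - e)) \<le> \<eta> * norm (\<xi> v - e)"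
      using r(2)[OF n(1,2)] F1 F[OF uv(1,2)] by (simp add: L2)
    moreover have "norm (\<xi> (u \<otimes> v) - \<xi> u - (\<xi> v - e)) \<le> \<eta> * norm (\<xi> u - e)"
      using r(2)[OF n(1,3)] F1 F[OF uv(1,2)] by (simp add: L1 algebra_simps)
    ultimately show ?thesis by (simp add: min_def)
  qed
  show ?thesis
    using r(1) main unfolding e_def by (intro exI[of _ "r / 2"]) auto
qed

text \<open>Conjugation is left multiplication by \<open>g\<close>, from the chart at \<open>\<one>\<close> to a chart at \<open>g\<close>, followed by right
  multiplication by \<open>g\<^sup>-\<^sup>1\<close>; the chain rule applies to the two coordinate expressions.\<close>

lemma chart_conj_derivative:
  assumes A: "(D, \<xi>) \<in> A" and one: "\<one> \<in> D" and g: "g \<in> carrier U"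
  shows "\<exists>L. bounded_linear L \<and> (\<forall>\<eta>>0. \<exists>r>0. \<forall>u\<in>D. norm (\<xi> u - \<xi> \<one>) < r \<longrightarrow>
    g \<otimes> u \<otimes> inv g \<in> D \<and>
    norm (\<xi> (g \<otimes> u \<otimes> inv g) - \<xi> \<one> - L (\<xi> u - \<xi> \<one>)) \<le> \<eta> * norm (\<xi> u - \<xi> \<one>))"
proof -
  obtain E \<psi> where E: "(E, \<psi>) \<in> A" "g \<in> E" using obtain_chart[OF g] .
  obtain E' \<psi>' where E': "(E', \<psi>') \<in> A" "inv g \<in> E'" using obtain_chart[OF inv_closed[OF g]] .
  obtain F1 where an1: "real_analytic_at F1 (\<psi> g, \<xi> \<one>)"
    and F1: "\<And>x u. x \<in> E \<Longrightarrow> u \<in> D \<Longrightarrow> F1 (\<psi> x, \<xi> u) = \<psi> (x \<otimes> u)"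
    using mult_in_charts[OF E(1) A E(1) E(2) one] E(2) g by auto
  obtain F2 where an2: "real_analytic_at F2 (\<psi> g, \<psi>' (inv g))"
    and F2: "\<And>x y. x \<in> E \<Longrightarrow> y \<in> E' \<Longrightarrow> F2 (\<psi> x, \<psi>' y) = \<xi> (x \<otimes> y)"
    using mult_in_charts[OF E(1) E'(1) A E(2) E'(2)] one g by auto
  obtain F1' where d1: "(F1 has_derivative F1') (at (\<psi> g, \<xi> \<one>))"
    using real_analytic_at_imp_has_derivative[OF an1] .
  obtain F2' where d2: "(F2 has_derivative F2') (at (\<psi> g, \<psi>' (inv g)))"
    using real_analytic_at_imp_has_derivative[OF an2] .
  have i1: "((\<lambda>x. (\<psi> g, x)) has_derivative (\<lambda>h. (0, h))) (at (\<xi> \<one>))"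
    by (auto intro!: derivative_eq_intros)
  have c1: "((\<lambda>x. F1 (\<psi> g, x)) has_derivative (\<lambda>h. F1' (0, h))) (at (\<xi> \<one>))"
    using has_derivative_compose[OF i1 d1] .
  have v1: "F1 (\<psi> g, \<xi> \<one>) = \<psi> g" using F1[OF E(2) one] g by simp
  have i2: "((\<lambda>x. (F1 (\<psi> g, x), \<psi>' (inv g))) has_derivative (\<lambda>h. (F1' (0, h), 0))) (at (\<xi> \<one>))"
    by (intro has_derivative_Pair c1 has_derivative_const)
  define H where "H x = F2 (F1 (\<psi> g, x), \<psi>' (inv g))" for x
  define L where "L h = F2' (F1' (0, h), 0)" for h
  have H: "(H has_derivative L) (at (\<xi> \<one>))"
    using has_derivative_compose[OF i2, of F2 F2'] d2 v1 by (simp add: H_def[abs_def] L_def[abs_def])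
  have mc: "continuous_map (prod_topology T T) T (\<lambda>(x, y). x \<otimes> y)"
    using mult_analytic by (simp add: analytic_map_def)
  have cont: "continuous_map T T (\<lambda>u. f u \<otimes> h u)"
    if "continuous_map T T f" "continuous_map T T h" for f h
    using continuous_map_compose[OF _ mc, of T "\<lambda>u. (f u, h u)"] that
    by (simp add: continuous_map_paired o_def)
  define W where "W = {u \<in> topspace T. g \<otimes> u \<in> E} \<inter> {u \<in> topspace T. g \<otimes> u \<otimes> inv g \<in> D}"
  have cc: "continuous_map T T (\<lambda>u. g)" "continuous_map T T (\<lambda>u. inv g)"
    using g by (simp_all add: topspace_eq_carrier)
  have id: "continuous_map T T (\<lambda>u. u)" by (rule continuous_map_id[unfolded id_def])
  have "openin T W" unfolding W_def
    by (intro openin_Int openin_continuous_map_preimage[OF cont[OF cc(1) id] chart_open[OF E(1)]]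
        openin_continuous_map_preimage[OF cont[OF cont[OF cc(1) id] cc(2)] chart_open[OF A]])
  moreover have "\<one> \<in> W" using one g E(2) by (simp add: W_def topspace_eq_carrier)
  ultimately have "\<exists>s>0. \<forall>u\<in>D. norm (\<xi> u - \<xi> \<one>) < s \<longrightarrow> u \<in> W"
    by (rule chart_basis[OF A _ _ one])
  then obtain s where s: "0 < s" "\<And>u. u \<in> D \<Longrightarrow> norm (\<xi> u - \<xi> \<one>) < s \<Longrightarrow> u \<in> W"
    by auto
  have HW: "H (\<xi> u) = \<xi> (g \<otimes> u \<otimes> inv g)" if "u \<in> D" "u \<in> W" for u
    using F1[OF E(2) that(1)] F2[OF _ E'(2), of "g \<otimes> u"] that by (simp add: H_def W_def)
  have H1: "H (\<xi> \<one>) = \<xi> \<one>" using HW[OF one \<open>\<one> \<in> W\<close>] g by simp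
  have "\<exists>r>0. \<forall>u\<in>D. norm (\<xi> u - \<xi> \<one>) < r \<longrightarrow> g \<otimes> u \<otimes> inv g \<in> D \<and>
      norm (\<xi> (g \<otimes> u \<otimes> inv g) - \<xi> \<one> - L (\<xi> u - \<xi> \<one>)) \<le> \<eta> * norm (\<xi> u - \<xi> \<one>)"
    if "0 < \<eta>" for \<eta>
  proof -
    have "\<exists>r>0. \<forall>y. norm (y - \<xi> \<one>) < r \<longrightarrow>
        norm (H y - H (\<xi> \<one>) - L (y - \<xi> \<one>)) \<le> \<eta> * norm (y - \<xi> \<one>)"
      using H[unfolded has_derivative_at_alt] that by (elim conjE allE impE)
    then obtain r where r: "0 < r" "\<And>y. norm (y - \<xi> \<one>) < r \<Longrightarrow>
        norm (H y - H (\<xi> \<one>) - L (y - \<xi> \<one>)) \<le> \<eta> * norm (y - \<xi> \<one>)"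
      by auto
    have "g \<otimes> u \<otimes> inv g \<in> D \<and>
        norm (\<xi> (g \<otimes> u \<otimes> inv g) - \<xi> \<one> - L (\<xi> u - \<xi> \<one>)) \<le> \<eta> * norm (\<xi> u - \<xi> \<one>)"
      if "u \<in> D" "norm (\<xi> u - \<xi> \<one>) < min r s" for u
      using r(2)[of "\<xi> u"] s(2)[OF that(1)] HW[OF that(1)] H1 that(2) by (auto simp: W_def)
    then show ?thesis using r(1) s(1) by (intro exI[of _ "min r s"]) auto
  qed
  then show ?thesis using has_derivative_bounded_linear[OF H] by blast
qed

lemma strictly_charted:
  obtains D \<phi> where "strictly_charted_group U T D (\<phi> :: 'a \<Rightarrow> 'e)"
proof -
  obtain D \<xi> where A: "(D, \<xi>) \<in> A" and one: "\<one> \<in> D"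
    using obtain_chart[OF one_closed] .
  have mc: "continuous_map (prod_topology T T) T (\<lambda>(x, y). x \<otimes> y)"
    using mult_analytic by (simp add: analytic_map_def)
  have prod_in_D: "\<exists>r>0. \<forall>u\<in>D. \<forall>v\<in>D. norm (\<xi> u - \<xi> \<one>) < r \<longrightarrow> norm (\<xi> v - \<xi> \<one>) < r \<longrightarrow> u \<otimes> v \<in> D"
  proof -
    let ?Z = "{p \<in> topspace (prod_topology T T). (case p of (x, y) \<Rightarrow> x \<otimes> y) \<in> D}"
    have "openin (prod_topology T T) ?Z"
      by (rule openin_continuous_map_preimage[OF mc chart_open[OF A]])
    moreover have "(\<one>, \<one>) \<in> ?Z" using one by (simp add: topspace_eq_carrier)
    ultimately have "\<exists>W W'. openin T W \<and> openin T W' \<and> \<one> \<in> W \<and> \<one> \<in> W' \<and> W \<times> W' \<subseteq> ?Z"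
      unfolding openin_prod_topology_alt by (elim allE impE)
    then obtain W W' where W: "openin T W" "openin T W'" "\<one> \<in> W" "\<one> \<in> W'" and WW': "W \<times> W' \<subseteq> ?Z"
      by (elim exE conjE)
    obtain a where a: "0 < a" "\<forall>v\<in>D. norm (\<xi> v - \<xi> \<one>) < a \<longrightarrow> v \<in> W"
      using chart_basis[OF A W(1,3) one] by blast
    obtain b where b: "0 < b" "\<forall>v\<in>D. norm (\<xi> v - \<xi> \<one>) < b \<longrightarrow> v \<in> W'"
      using chart_basis[OF A W(2,4) one] by blast
    have "u \<otimes> v \<in> D" if "u \<in> D" "v \<in> D" "norm (\<xi> u - \<xi> \<one>) < min a b" "norm (\<xi> v - \<xi> \<one>) < min a b" for u v
    proof -
      have "(u, v) \<in> W \<times> W'" using a b that by auto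
      then have "(u, v) \<in> ?Z" using WW' by blast
      then show ?thesis by simp
    qed
    then show ?thesis using a(1) b(1) by (intro exI[of _ "min a b"]) auto
  qed
  have "strictly_charted_group U T D (\<lambda>u. \<xi> u - \<xi> \<one>)"
  proof unfold_locales
    show "continuous_map T T (\<lambda>x. inv x)" using inv_analytic by (simp add: analytic_map_def)
    show "openin T D" by (rule chart_open[OF A])
    have "continuous_map (subtopology T D) euclidean \<xi>"
      using homeomorphic_imp_continuous_map[OF chart_homeo[OF A]] continuous_map_into_fulltopology by blast
    moreover have "continuous_map euclidean euclidean (\<lambda>x. x - \<xi> \<one>)"
      by (simp add: continuous_intros)
    ultimately have "continuous_map (subtopology T D) euclidean ((\<lambda>x. x - \<xi> \<one>) \<circ> \<xi>)"
      by (rule continuous_map_compose)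
    then show "continuous_map (subtopology T D) euclidean (\<lambda>u. \<xi> u - \<xi> \<one>)" by (simp add: o_def)
  next
    fix W u assume "openin T W" "u \<in> W" "u \<in> D"
    from chart_basis[OF A this]
    show "\<exists>r>0. \<forall>v\<in>D. norm (\<xi> v - \<xi> \<one> - (\<xi> u - \<xi> \<one>)) < r \<longrightarrow> v \<in> W" by simp
  next
    obtain R where R: "0 < R" "ball (\<xi> \<one>) R \<subseteq> \<xi> ` D"
      using openE[OF chart_open_image[OF A]] one by (metis image_eqI)
    have "x \<in> (\<lambda>u. \<xi> u - \<xi> \<one>) ` D" if "norm x < R" for x
    proof -
      have "\<xi> \<one> + x \<in> \<xi> ` D" using R(2) that by (auto simp: dist_norm)
      then show ?thesis by (force simp: image_iff algebra_simps)
    qed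
    then show "\<exists>r>0. \<forall>x. norm x < r \<longrightarrow> x \<in> (\<lambda>u. \<xi> u - \<xi> \<one>) ` D" using R(1) by blast
  next
    fix \<eta> :: real assume "0 < \<eta>"
    from chart_mult_strict[OF A one this] obtain a where a: "0 < a"
      "\<And>u v. \<lbrakk>u \<in> D; v \<in> D; norm (\<xi> u - \<xi> \<one>) < a; norm (\<xi> v - \<xi> \<one>) < a\<rbrakk> \<Longrightarrow>
        norm (\<xi> (u \<otimes> v) - \<xi> u - (\<xi> v - \<xi> \<one>)) \<le> \<eta> * min (norm (\<xi> u - \<xi> \<one>)) (norm (\<xi> v - \<xi> \<one>))"
      by blast
    obtain b where b: "0 < b"
      "\<And>u v. \<lbrakk>u \<in> D; v \<in> D; norm (\<xi> u - \<xi> \<one>) < b; norm (\<xi> v - \<xi> \<one>) < b\<rbrakk> \<Longrightarrow> u \<otimes> v \<in> D"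
      using prod_in_D by blast
    show "\<exists>r>0. \<forall>u\<in>D. \<forall>v\<in>D. norm (\<xi> u - \<xi> \<one>) < r \<longrightarrow> norm (\<xi> v - \<xi> \<one>) < r \<longrightarrow>
        u \<otimes> v \<in> D \<and> norm (\<xi> (u \<otimes> v) - \<xi> \<one> - (\<xi> u - \<xi> \<one>) - (\<xi> v - \<xi> \<one>)) \<le>
          \<eta> * min (norm (\<xi> u - \<xi> \<one>)) (norm (\<xi> v - \<xi> \<one>))"
      using a b by (intro exI[of _ "min a b"]) (auto simp: algebra_simps)
  next
    fix g assume "g \<in> carrier U"
    from chart_conj_derivative[OF A one this]
    show "\<exists>L. bounded_linear L \<and> (\<forall>\<eta>>0. \<exists>r>0. \<forall>u\<in>D. norm (\<xi> u - \<xi> \<one>) < r \<longrightarrow>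
        g \<otimes> u \<otimes> inv g \<in> D \<and>
        norm (\<xi> (g \<otimes> u \<otimes> inv g) - \<xi> \<one> - L (\<xi> u - \<xi> \<one>)) \<le> \<eta> * norm (\<xi> u - \<xi> \<one>))" .
  qed (use topspace_eq_carrier Hausdorff mc one in simp_all)
  then show thesis by (rule that)
qed

end


section \<open>Conjugating nearby compact subgroups of a Banach Lie group\<close>

theorem theorem2p4:
  fixes U :: "('a, 'm) monoid_scheme" (structure)
    and T :: "'a topology"
    and A :: "('a, 'e::banach) chart set"
    and G :: "'a set"
  assumes "banach_lie_group U T A"
    and "subgroup G U"
    and "compactin T G"
  shows "\<exists>V u. openin T V \<and> G \<subseteq> V \<and>
           u \<in> compact_subgroups_in U T V \<rightarrow> carrier U \<and>
           topcontinuous_at (weak_0_topology T (compact_subgroups_in U T V)) T u G \<and>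
           u G = \<one> \<and>
           (\<forall>K \<in> compact_subgroups_in U T V. (\<lambda>k. u K \<otimes> k \<otimes> inv (u K)) ` K \<subseteq> G)"
proof -
  obtain D and \<phi> :: "'a \<Rightarrow> 'e" where "strictly_charted_group U T D \<phi>"
    using banach_lie_group.strictly_charted[OF assms(1)] .
  then interpret charted_group_with_compact_subgroup U T D \<phi> G
    by (intro charted_group_with_compact_subgroup.intro
        charted_group_with_compact_subgroup_axioms.intro assms(2,3))
  show ?thesis by (rule continuous_conjugation_into_G)
qed

end
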